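(* Fix a finite semigroup $S$ and suppose we are given an $S$-labeled tree $T$. Then one can in time $|S|^{\mathcal{O}(1)}\cdot |T|$ construct a data structure that can answer the following query in time $|S|^{\mathcal{O}(1)}$ and using $|S|^{\mathcal{O}(1)}$ operations in $S$: given nodes $x,y\in V(T)$, where $x$ is a strict ancestor of $y$, output $\sigma(x,y)$. The data structure uses $|S|^{\mathcal{O}(1)}\cdot |T|$ memory and stores $|S|^{\mathcal{O}(1)}\cdot |T|$ elements of $S$.
   Context: An $S$-labeled tree is a rooted tree $T$ together with a map $\sigma$ assigning to each edge $e$ of $T$ an element $\sigma(e)\in S$. For nodes $x,y$ with $x$ a strict ancestor of $y$, $\sigma(x,y)=\sigma(e_1)\cdot\sigma(e_2)\cdots\sigma(e_\ell)$, where $e_1,\ldots,e_\ell$ are the consecutive edges of the path from $x$ to $y$ ($e_1$ incident with $x$, $e_\ell$ incident with $y$). Computation is in the word RAM model. *)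

theory Defs
  imports Main
begin

section \<open>Finite semigroups and labeled trees\<close>

definition finite_semigroup :: "'a set \<Rightarrow> ('a \<Rightarrow> 'a \<Rightarrow> 'a) \<Rightarrow> bool" where
  "finite_semigroup S mul \<longleftrightarrow>
     finite S \<and> S \<noteq> {} \<and>
     (\<forall>a\<in>S. \<forall>b\<in>S. mul a b \<in> S) \<and>
     (\<forall>a\<in>S. \<forall>b\<in>S. \<forall>c\<in>S. mul (mul a b) c = mul a (mul b c))"

text \<open>Edges are directed from the parent to the child. The labeling is a total function, of which
  only the values on the edges matter.\<close>

record ('v, 'a) labeled_tree =
  nodes :: "'v set"
  edges :: "('v \<times> 'v) set"
  tree_root :: 'v
  label :: "'v \<times> 'v \<Rightarrow> 'a"

definition rooted_tree :: "'v set \<Rightarrow> ('v \<times> 'v) set \<Rightarrow> 'v \<Rightarrow> bool" where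
  "rooted_tree V E r \<longleftrightarrow>
     finite V \<and> r \<in> V \<and> E \<subseteq> V \<times> V \<and>
     (\<forall>u. (u, r) \<notin> E) \<and>
     (\<forall>v\<in>V - {r}. \<exists>!u. (u, v) \<in> E) \<and>
     (\<forall>v\<in>V. (r, v) \<in> E\<^sup>*)"

definition is_labeled_tree :: "'a set \<Rightarrow> ('v, 'a) labeled_tree \<Rightarrow> bool" where
  "is_labeled_tree S T \<longleftrightarrow>
     rooted_tree (nodes T) (edges T) (tree_root T) \<and> (\<forall>e\<in>edges T. label T e \<in> S)"

definition strict_ancestor :: "('v, 'a) labeled_tree \<Rightarrow> 'v \<Rightarrow> 'v \<Rightarrow> bool" where
  "strict_ancestor T x y \<longleftrightarrow> (x, y) \<in> (edges T)\<^sup>+"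

fun is_path :: "('v \<times> 'v) set \<Rightarrow> 'v \<Rightarrow> ('v \<times> 'v) list \<Rightarrow> 'v \<Rightarrow> bool" where
  "is_path E x [] y \<longleftrightarrow> x = y"
| "is_path E x (e # es) y \<longleftrightarrow> e \<in> E \<and> fst e = x \<and> is_path E (snd e) es y"

text \<open>A semigroup has no empty product; the value on the empty list is irrelevant.\<close>

fun semigroup_prod :: "('a \<Rightarrow> 'a \<Rightarrow> 'a) \<Rightarrow> 'a list \<Rightarrow> 'a" where
  "semigroup_prod mul [] = undefined"
| "semigroup_prod mul [a] = a"
| "semigroup_prod mul (a # b # as) = mul a (semigroup_prod mul (b # as))"

text \<open>The value \<open>\<sigma>(x, y)\<close>, for a strict ancestor \<open>x\<close> of \<open>y\<close>: in a rooted tree the path from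
  \<open>x\<close> down to \<open>y\<close> is unique.\<close>

definition path_product :: "('a \<Rightarrow> 'a \<Rightarrow> 'a) \<Rightarrow> ('v, 'a) labeled_tree \<Rightarrow> 'v \<Rightarrow> 'v \<Rightarrow> 'a" where
  "path_product mul T x y =
     semigroup_prod mul (map (label T) (THE es. is_path (edges T) x es y))"


section \<open>A word RAM with a store for semigroup elements\<close>

text \<open>
  The machine has finitely many registers (those that the program mentions) and a
  random-access memory for \<open>w\<close>-bit words, and, separately, registers and a random-access memory
  for elements of the semigroup. A word is a number below \<open>2 ^ w\<close>. Semigroup elements are opaque:
  they can be copied, multiplied and compared for equality, and nothing else. Control flow is
  structured. Every instruction and every evaluation of a test takes one unit of time;
  multiplications and equality tests of semigroup elements are moreover counted as
  operations in the semigroup.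
\<close>

datatype binop = Add | Sub | Mult | Div | Mod | BitAnd | BitOr | BitXor | ShiftL | ShiftR

fun word_op :: "nat \<Rightarrow> binop \<Rightarrow> nat \<Rightarrow> nat \<Rightarrow> nat" where
  "word_op w Add a b = (a + b) mod 2 ^ w"
| "word_op w Sub a b = (a + 2 ^ w - b) mod 2 ^ w"
| "word_op w Mult a b = (a * b) mod 2 ^ w"
| "word_op w Div a b = a div b"
| "word_op w Mod a b = a mod b"
| "word_op w BitAnd a b = Bit_Operations.and a b"
| "word_op w BitOr a b = Bit_Operations.or a b"
| "word_op w BitXor a b = Bit_Operations.xor a b"
| "word_op w ShiftL a b = (a * 2 ^ b) mod 2 ^ w"
| "word_op w ShiftR a b = a div 2 ^ b"

text \<open>All arguments of the following constructors are register numbers, except the second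
  argument of \<open>Const\<close>, which is a literal. The target register comes first.\<close>

datatype test =
    Less nat nat
  | Equal nat nat
  | ElemEqual nat nat

datatype com =
    Const nat nat
  | Move nat nat
  | Op binop nat nat nat
  | Load nat nat            \<comment> \<open>target, address\<close>
  | Store nat nat           \<comment> \<open>address, source\<close>
  | ElemMove nat nat
  | ElemMul nat nat nat
  | ElemLoad nat nat        \<comment> \<open>target (element register), address (word register)\<close>
  | ElemStore nat nat       \<comment> \<open>address (word register), source (element register)\<close>
  | Skip
  | Seq com com
  | If test com com
  | While test com

record 'a state =
  reg :: "nat \<Rightarrow> nat"
  mem :: "nat \<Rightarrow> nat"
  elem_reg :: "nat \<Rightarrow> 'a"
  elem_mem :: "nat \<Rightarrow> 'a"

fun test_holds :: "test \<Rightarrow> 'a state \<Rightarrow> bool" where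
  "test_holds (Less i j) s \<longleftrightarrow> reg s i < reg s j"
| "test_holds (Equal i j) s \<longleftrightarrow> reg s i = reg s j"
| "test_holds (ElemEqual i j) s \<longleftrightarrow> elem_reg s i = elem_reg s j"

fun test_ops :: "test \<Rightarrow> nat" where
  "test_ops (ElemEqual i j) = 1"
| "test_ops (Less i j) = 0"
| "test_ops (Equal i j) = 0"

text \<open>
  \<open>exec w m k mul c s t p s'\<close>: on the machine with word length \<open>w\<close>, a memory of \<open>m\<close> words and a
  memory of \<open>k\<close> semigroup elements, the program \<open>c\<close> started in \<open>s\<close> terminates in \<open>s'\<close> after \<open>t\<close>
  units of time and \<open>p\<close> operations in the semigroup. An access to a memory cell beyond
  the size of the memory has no successor state, so \<open>m\<close> and \<open>k\<close> bound the memory consumption.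
\<close>

inductive exec ::
  "nat \<Rightarrow> nat \<Rightarrow> nat \<Rightarrow> ('a \<Rightarrow> 'a \<Rightarrow> 'a) \<Rightarrow> com \<Rightarrow> 'a state \<Rightarrow> nat \<Rightarrow> nat \<Rightarrow> 'a state \<Rightarrow> bool"
  for w m k :: nat and mul :: "'a \<Rightarrow> 'a \<Rightarrow> 'a" where
  exec_Const: "exec w m k mul (Const i n) s 1 0 (s\<lparr>reg := (reg s)(i := n mod 2 ^ w)\<rparr>)"
| exec_Move: "exec w m k mul (Move i j) s 1 0 (s\<lparr>reg := (reg s)(i := reg s j)\<rparr>)"
| exec_Op: "exec w m k mul (Op f i j l) s 1 0
    (s\<lparr>reg := (reg s)(i := word_op w f (reg s j) (reg s l))\<rparr>)"
| exec_Load: "reg s j < m \<Longrightarrow>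
    exec w m k mul (Load i j) s 1 0 (s\<lparr>reg := (reg s)(i := mem s (reg s j))\<rparr>)"
| exec_Store: "reg s i < m \<Longrightarrow>
    exec w m k mul (Store i j) s 1 0 (s\<lparr>mem := (mem s)(reg s i := reg s j)\<rparr>)"
| exec_ElemMove: "exec w m k mul (ElemMove i j) s 1 0
    (s\<lparr>elem_reg := (elem_reg s)(i := elem_reg s j)\<rparr>)"
| exec_ElemMul: "exec w m k mul (ElemMul i j l) s 1 1
    (s\<lparr>elem_reg := (elem_reg s)(i := mul (elem_reg s j) (elem_reg s l))\<rparr>)"
| exec_ElemLoad: "reg s j < k \<Longrightarrow>
    exec w m k mul (ElemLoad i j) s 1 0 (s\<lparr>elem_reg := (elem_reg s)(i := elem_mem s (reg s j))\<rparr>)"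
| exec_ElemStore: "reg s i < k \<Longrightarrow>
    exec w m k mul (ElemStore i j) s 1 0 (s\<lparr>elem_mem := (elem_mem s)(reg s i := elem_reg s j)\<rparr>)"
| exec_Skip: "exec w m k mul Skip s 1 0 s"
| exec_Seq: "exec w m k mul c s t p s' \<Longrightarrow> exec w m k mul c' s' t' p' s'' \<Longrightarrow>
    exec w m k mul (Seq c c') s (t + t') (p + p') s''"
| exec_IfTrue: "test_holds b s \<Longrightarrow> exec w m k mul c s t p s' \<Longrightarrow>
    exec w m k mul (If b c c') s (1 + t) (test_ops b + p) s'"
| exec_IfFalse: "\<not> test_holds b s \<Longrightarrow> exec w m k mul c' s t p s' \<Longrightarrow>
    exec w m k mul (If b c c') s (1 + t) (test_ops b + p) s'"
| exec_WhileTrue: "test_holds b s \<Longrightarrow> exec w m k mul c s t p s' \<Longrightarrow>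
    exec w m k mul (While b c) s' t' p' s'' \<Longrightarrow>
    exec w m k mul (While b c) s (1 + t + t') (test_ops b + p + p') s''"
| exec_WhileFalse: "\<not> test_holds b s \<Longrightarrow> exec w m k mul (While b c) s 1 (test_ops b) s"


section \<open>Input and queries\<close>

definition valid_state :: "nat \<Rightarrow> 'a set \<Rightarrow> 'a state \<Rightarrow> bool" where
  "valid_state w S s \<longleftrightarrow>
     (\<forall>i. reg s i < 2 ^ w) \<and> (\<forall>i. mem s i < 2 ^ w) \<and>
     (\<forall>i. elem_reg s i \<in> S) \<and> (\<forall>i. elem_mem s i \<in> S)"

text \<open>
  The input is a list of the elements of \<open>S\<close> without repetitions (in the first \<open>card S\<close> cells of the
  element memory) and an \<open>S\<close>-labeled tree with nodes \<open>0, \<dots>, n - 1\<close>, given by its root and the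
  array of parents; the element memory cell \<open>card S + v\<close> holds the label of the edge from the parent
  of \<open>v\<close> to \<open>v\<close>. All remaining registers and memory cells have arbitrary contents.
\<close>

definition input_state :: "nat \<Rightarrow> 'a set \<Rightarrow> (nat, 'a) labeled_tree \<Rightarrow> 'a state \<Rightarrow> bool" where
  "input_state w S T s \<longleftrightarrow>
     valid_state w S s \<and>
     reg s 0 = card S \<and> reg s 1 = card (nodes T) \<and> reg s 2 = tree_root T \<and>
     bij_betw (elem_mem s) {..<card S} S \<and>
     (\<forall>u v. (u, v) \<in> edges T \<longrightarrow> mem s v = u \<and> elem_mem s (card S + v) = label T (u, v))"

text \<open>The data structure consists of the two memories of a state \<open>D\<close>. Nothing but the query
  itself is passed in registers.\<close>

definition query_state :: "nat \<Rightarrow> 'a set \<Rightarrow> 'a state \<Rightarrow> nat \<Rightarrow> nat \<Rightarrow> 'a state \<Rightarrow> bool" where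
  "query_state w S D x y s \<longleftrightarrow>
     valid_state w S s \<and> mem s = mem D \<and> elem_mem s = elem_mem D \<and> reg s 0 = x \<and> reg s 1 = y"

end

theory Submission
  imports Defs
begin

text \<open>
  Every node \<open>v\<close> has \<open>m = |S|\<close> slots, each holding an element of \<open>S\<close>. A product that starts at an
  ancestor \<open>x\<close> of \<open>v\<close> sits in a slot of \<open>v\<close> with value \<open>\<sigma>(x, v)\<close>. Along an edge all values are
  multiplied by its label; when two slots get equal values, the products in the larger slot move to
  the smaller one, which frees the larger slot. Such a slot is marked at the lower node. Products
  that start with this edge go to a slot that already has the label as its value, or to a freed
  one, which exists by the pigeonhole principle. With a further slot \<open>m\<close> standing for the empty
  product, a query follows a product from slot \<open>m\<close> at \<open>x\<close> down to \<open>y\<close>: find the first node below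
  the current one on the path to \<open>y\<close> at which the current slot is marked, and move there. The slot
  number decreases each time, so there are at most \<open>m + 1\<close> rounds.

  The first marked node is found in constant time with the labels of Schieber and Vishkin: number
  the nodes in preorder from 1, and let \<open>inl v\<close> be the number divisible by the largest power of two
  in the interval of descendants of \<open>v\<close>. Nodes with equal \<open>inl\<close> form a path, and a path from an
  ancestor to a descendant enters the classes in the order of decreasing powers of two. Hence for
  each slot it suffices to store the next marked node of the same class, the topmost marked node
  of every class, and at every node a bit mask of the powers of the classes of its marked ancestors.
\<close>

section \<open>A structured language compiled to the word RAM\<close>

text \<open>The input gives only parents, in no useful order, and the machine has neither recursion
  nor an instruction for the lowest set bit. So a bottom-up order comes from peeling leaves with
  counters of remaining children, and its reverse serves as a top-down order. Subtree sizes reserve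
  an interval for every node, which gives preorder numbers in any top-down order, without
  depth-first search. Masks list the powers in reverse because a query wants the largest power below
  a given one, while only the lowest set bit of a word is easy to isolate. A slot always carries
  some element of \<open>S\<close>, even if no product sits in it. Hence the pigeonhole principle
  applies to all \<open>m + 1\<close> values at a node, and arbitrary values at the root do no harm.
  All loops have the bound \<open>n\<close> or \<open>m + 1\<close>, fixed on entry, so termination
  and time are read off the program text and correctness becomes a matter of weakest preconditions
  over natural numbers. The exponent 2 comes from comparing all pairs of slots at every node; 2000
  exceeds the sum of the coefficients in the time bounds.\<close>

datatype exp = Lit nat | Var nat | Bin binop exp exp | Ld nat exp exp | Top

datatype bexp = Lt exp exp | Eq exp exp | EEq nat nat

datatype hcom =
    Nop
  | Asg nat exp
  | St nat exp exp exp
  | EMulA nat nat nat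
  | ELd nat exp exp
  | ESt exp exp nat
  | Semi hcom hcom (infixr ";;" 60)
  | Cond bexp hcom hcom
  | Loop nat nat hcom

text \<open>Indexing the word arrays by kind, row and cell makes a store a function update at one
  place. That distinct indices have distinct addresses matters only when the compiler is
  verified.\<close>

record 'a hstate =
  var :: "nat \<Rightarrow> nat"
  arr :: "nat \<Rightarrow> nat \<Rightarrow> nat \<Rightarrow> nat"
  evar :: "nat \<Rightarrow> 'a"
  earr :: "nat \<Rightarrow> nat \<Rightarrow> 'a"

abbreviation setv :: "nat \<Rightarrow> nat \<Rightarrow> 'a hstate \<Rightarrow> 'a hstate" where
  "setv x a s \<equiv> s\<lparr>var := (var s)(x := a)\<rparr>"

fun opv :: "binop \<Rightarrow> nat \<Rightarrow> nat \<Rightarrow> nat" where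
  "opv Add a b = a + b"
| "opv Sub a b = a - b"
| "opv Mult a b = a * b"
| "opv Div a b = a div b"
| "opv Mod a b = a mod b"
| "opv BitAnd a b = Bit_Operations.and a b"
| "opv BitOr a b = Bit_Operations.or a b"
| "opv BitXor a b = Bit_Operations.xor a b"
| "opv ShiftL a b = a * 2 ^ b"
| "opv ShiftR a b = a div 2 ^ b"

text \<open>The condition under which word arithmetic agrees with arithmetic on naturals: no
  wrap-around and no truncated difference. The operations of the last clause agree
  unconditionally.\<close>

fun opsafe :: "nat \<Rightarrow> binop \<Rightarrow> nat \<Rightarrow> nat \<Rightarrow> bool" where
  "opsafe w Add a b = (a + b < 2 ^ w)"
| "opsafe w Sub a b = (b \<le> a \<and> a < 2 ^ w)"
| "opsafe w Mult a b = (a * b < 2 ^ w)"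
| "opsafe w ShiftL a b = (a * 2 ^ b < 2 ^ w)"
| "opsafe w f a b = True"

lemma word_op_opv: "opsafe w f a b \<Longrightarrow> word_op w f a b = opv f a b"
  by (cases f) (auto simp: add.commute[of a] simp flip: Nat.add_diff_assoc)

fun mods :: "hcom \<Rightarrow> nat set" where
  "mods (Asg x e) = {x}"
| "mods (c ;; d) = mods c \<union> mods d"
| "mods (Cond b c d) = mods c \<union> mods d"
| "mods (Loop i l c) = insert i (mods c)"
| "mods _ = {}"

fun kinds :: "hcom \<Rightarrow> nat set" where
  "kinds (St kd ei ev e) = {kd}"
| "kinds (c ;; d) = kinds c \<union> kinds d"
| "kinds (Cond b c d) = kinds c \<union> kinds d"
| "kinds (Loop i l c) = kinds c"
| "kinds _ = {}"

fun estores :: "hcom \<Rightarrow> bool" where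
  "estores (ESt ei ev x) = True"
| "estores (c ;; d) = (estores c \<or> estores d)"
| "estores (Cond b c d) = (estores c \<or> estores d)"
| "estores (Loop i l c) = estores c"
| "estores _ = False"

text \<open>Registers from 20 on hold intermediate results of expressions; register 1 holds the number
  of nodes, the row length of all arrays.\<close>

primrec wfe :: "exp \<Rightarrow> bool" where
  "wfe (Lit a) = True"
| "wfe (Var x) = (x < 20)"
| "wfe (Bin f a b) = (wfe a \<and> wfe b)"
| "wfe (Ld kd ei ev) = (kd < 12 \<and> wfe ei \<and> wfe ev)"
| "wfe Top = True"

primrec wfb :: "bexp \<Rightarrow> bool" where
  "wfb (Lt a b) = (wfe a \<and> wfe b)"
| "wfb (Eq a b) = (wfe a \<and> wfe b)"
| "wfb (EEq x y) = True"

primrec wf_com :: "hcom \<Rightarrow> bool" where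
  "wf_com Nop = True"
| "wf_com (Asg x e) = (x < 20 \<and> x \<noteq> 1 \<and> wfe e)"
| "wf_com (St kd ei ev e) = (kd < 12 \<and> wfe ei \<and> wfe ev \<and> wfe e)"
| "wf_com (EMulA x y z) = True"
| "wf_com (ELd x ei ev) = (wfe ei \<and> wfe ev)"
| "wf_com (ESt ei ev x) = (wfe ei \<and> wfe ev)"
| "wf_com (c ;; d) = (wf_com c \<and> wf_com d)"
| "wf_com (Cond b c d) = (wfb b \<and> wf_com c \<and> wf_com d)"
| "wf_com (Loop i l c) = (i < 20 \<and> i \<noteq> 1 \<and> l < 20 \<and> i \<noteq> l \<and> i \<notin> mods c \<and> l \<notin> mods c \<and> wf_com c)"

text \<open>Cell \<open>v\<close> of row \<open>i\<close> of the array of kind \<open>kd\<close> lives at address \<open>(12 i + kd) n + v\<close>; kind 0,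
  row 0 is the parent array of the input.\<close>

primrec compile_exp :: "exp \<Rightarrow> nat \<Rightarrow> com" where
  "compile_exp (Lit a) r = Const r a"
| "compile_exp (Var x) r = Move r x"
| "compile_exp (Bin f a b) r = Seq (compile_exp a r) (Seq (compile_exp b (r + 1)) (Op f r r (r + 1)))"
| "compile_exp (Ld kd ei ev) r =
     Seq (compile_exp ei r) (Seq (Const (r + 1) 12) (Seq (Op Mult r r (r + 1))
     (Seq (Const (r + 1) kd) (Seq (Op Add r r (r + 1)) (Seq (Op Mult r r 1)
     (Seq (compile_exp ev (r + 1)) (Seq (Op Add r r (r + 1)) (Load r r))))))))"
| "compile_exp Top r =
     Seq (Const r 0) (Seq (Const (r + 1) 1) (Seq (Op Sub r r (r + 1))
     (Seq (Const (r + 1) 2) (Seq (Op Div r r (r + 1))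
     (Seq (Const (r + 1) 1) (Op Add r r (r + 1)))))))"

primrec time_exp :: "exp \<Rightarrow> nat" where
  "time_exp (Lit a) = 1"
| "time_exp (Var x) = 1"
| "time_exp (Bin f a b) = time_exp a + time_exp b + 1"
| "time_exp (Ld kd ei ev) = time_exp ei + time_exp ev + 7"
| "time_exp Top = 7"

primrec compile_test :: "bexp \<Rightarrow> com \<Rightarrow> com \<Rightarrow> com" where
  "compile_test (Lt a b) c d = Seq (compile_exp a 20) (Seq (compile_exp b 21) (If (Less 20 21) c d))"
| "compile_test (Eq a b) c d = Seq (compile_exp a 20) (Seq (compile_exp b 21) (If (Equal 20 21) c d))"
| "compile_test (EEq x y) c d = If (ElemEqual x y) c d"

primrec time_test :: "bexp \<Rightarrow> nat" where
  "time_test (Lt a b) = time_exp a + time_exp b + 1"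
| "time_test (Eq a b) = time_exp a + time_exp b + 1"
| "time_test (EEq x y) = 1"

definition addr_exp :: "nat \<Rightarrow> exp \<Rightarrow> exp \<Rightarrow> exp" where
  "addr_exp kd ei ev = Bin Add (Bin Mult (Bin Add (Bin Mult ei (Lit 12)) (Lit kd)) (Var 1)) ev"

definition eaddr_exp :: "exp \<Rightarrow> exp \<Rightarrow> exp" where
  "eaddr_exp ei ev = Bin Add (Bin Add (Bin Mult ei (Var 1)) ev) (Var 0)"

primrec compile :: "hcom \<Rightarrow> com" where
  "compile Nop = Skip"
| "compile (Asg x e) = Seq (compile_exp e 20) (Move x 20)"
| "compile (St kd ei ev e) = Seq (compile_exp (addr_exp kd ei ev) 20) (Seq (compile_exp e 21) (Store 20 21))"
| "compile (EMulA x y z) = ElemMul x y z"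
| "compile (ELd x ei ev) = Seq (compile_exp (eaddr_exp ei ev) 20) (ElemLoad x 20)"
| "compile (ESt ei ev x) = Seq (compile_exp (eaddr_exp ei ev) 20) (ElemStore 20 x)"
| "compile (c ;; d) = Seq (compile c) (compile d)"
| "compile (Cond b c d) = compile_test b (compile c) (compile d)"
| "compile (Loop i l c) =
     Seq (Const i 0) (While (Less i l) (Seq (compile c) (Seq (Const 20 1) (Op Add i i 20))))"

text \<open>\<open>M\<close> bounds both memories. There are 12 kinds of word arrays with
  \<open>m + 1\<close> rows each; the element memory holds the list of \<open>S\<close>, a row of
  labels and \<open>m + 1\<close> rows of slot values. \<open>M \<le> 2 ^ w\<close> makes every
  address a word.\<close>

locale machine =
  fixes w n m M :: nat and mul :: "'a \<Rightarrow> 'a \<Rightarrow> 'a"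
  assumes n_pos: "1 \<le> n" and m_pos: "1 \<le> m"
    and word_space: "12 * (m + 1) * n \<le> M" and elem_space: "m + (m + 2) * n \<le> M"
    and M_le: "M \<le> 2 ^ w"
begin

section \<open>Weakest preconditions for programs with bounded loops\<close>

primrec eval :: "exp \<Rightarrow> 'a hstate \<Rightarrow> nat" where
  "eval (Lit a) s = a"
| "eval (Var x) s = var s x"
| "eval (Bin f a b) s = opv f (eval a s) (eval b s)"
| "eval (Ld kd ei ev) s = arr s kd (eval ei s) (eval ev s)"
| "eval Top s = 2 ^ (w - 1)"

primrec safe :: "exp \<Rightarrow> 'a hstate \<Rightarrow> bool" where
  "safe (Lit a) s = (a < 2 ^ w)"
| "safe (Var x) s = True"
| "safe (Bin f a b) s = (safe a s \<and> safe b s \<and> opsafe w f (eval a s) (eval b s))"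
| "safe (Ld kd ei ev) s = (safe ei s \<and> safe ev s \<and> eval ei s \<le> m \<and> eval ev s < n)"
| "safe Top s = True"

primrec evalb :: "bexp \<Rightarrow> 'a hstate \<Rightarrow> bool" where
  "evalb (Lt a b) s = (eval a s < eval b s)"
| "evalb (Eq a b) s = (eval a s = eval b s)"
| "evalb (EEq x y) s = (evar s x = evar s y)"

primrec safeb :: "bexp \<Rightarrow> 'a hstate \<Rightarrow> bool" where
  "safeb (Lt a b) s = (safe a s \<and> safe b s)"
| "safeb (Eq a b) s = (safe a s \<and> safe b s)"
| "safeb (EEq x y) s = True"

text \<open>Loops run up to the value of register 1, the number of nodes, or of another register
  holding the number \<open>m + 1\<close> of slots.\<close>

definition lim :: "nat \<Rightarrow> nat" where
  "lim l = (if l = 1 then n else m + 1)"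

text \<open>Recursion on the number of rounds left, with the counter value \<open>k\<close> passed
  along, so that total correctness of loops needs no fixed point.\<close>

primrec loop_wp :: "(('a hstate \<Rightarrow> bool) \<Rightarrow> 'a hstate \<Rightarrow> bool) \<Rightarrow> nat \<Rightarrow> nat \<Rightarrow> nat
    \<Rightarrow> ('a hstate \<Rightarrow> bool) \<Rightarrow> 'a hstate \<Rightarrow> bool" where
  "loop_wp W i 0 k Q s = Q (setv i k s)"
| "loop_wp W i (Suc r) k Q s = W (loop_wp W i r (Suc k) Q) (setv i k s)"

text \<open>Safety is part of the precondition: no operation wraps around and no access leaves its
  array. Element accesses ask for \<open>m\<close> in register 0 because their rows start behind the
  \<open>m\<close> listed elements of \<open>S\<close>.\<close>

primrec wp :: "hcom \<Rightarrow> ('a hstate \<Rightarrow> bool) \<Rightarrow> 'a hstate \<Rightarrow> bool" where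
  "wp Nop Q s = Q s"
| "wp (Asg x e) Q s = (safe e s \<and> Q (setv x (eval e s) s))"
| "wp (St kd ei ev e) Q s = (safe ei s \<and> safe ev s \<and> safe e s \<and> eval ei s \<le> m \<and> eval ev s < n \<and>
     Q (s\<lparr>arr := (arr s)(kd := (arr s kd)(eval ei s := (arr s kd (eval ei s))(eval ev s := eval e s)))\<rparr>))"
| "wp (EMulA x y z) Q s = Q (s\<lparr>evar := (evar s)(x := mul (evar s y) (evar s z))\<rparr>)"
| "wp (ELd x ei ev) Q s = (var s 0 = m \<and> safe ei s \<and> safe ev s \<and> eval ei s \<le> m + 1 \<and> eval ev s < n \<and>
     Q (s\<lparr>evar := (evar s)(x := earr s (eval ei s) (eval ev s))\<rparr>))"
| "wp (ESt ei ev x) Q s = (var s 0 = m \<and> safe ei s \<and> safe ev s \<and> eval ei s \<le> m + 1 \<and> eval ev s < n \<and>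
     Q (s\<lparr>earr := (earr s)(eval ei s := (earr s (eval ei s))(eval ev s := evar s x))\<rparr>))"
| "wp (c ;; d) Q s = wp c (wp d Q) s"
| "wp (Cond b c d) Q s = (safeb b s \<and> (if evalb b s then wp c Q s else wp d Q s))"
| "wp (Loop i l c) Q s = (var s l = lim l \<and> loop_wp (wp c) i (lim l) 0 Q s)"

lemma loop_wp_mono:
  assumes "\<And>P Q s. (\<And>s'. P s' \<Longrightarrow> Q s') \<Longrightarrow> W P s \<Longrightarrow> W Q s"
    and "loop_wp W i r k P s" and "\<And>s'. P s' \<Longrightarrow> Q s'"
  shows "loop_wp W i r k Q s"
  using assms(2)
proof (induction r arbitrary: k s)
  case 0
  then show ?case using assms(3) by simp
next
  case (Suc r)
  from Suc.prems have "W (loop_wp W i r (Suc k) P) (setv i k s)" by simp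
  then have "W (loop_wp W i r (Suc k) Q) (setv i k s)"
    by (rule assms(1)[rotated]) (rule Suc.IH)
  then show ?case by simp
qed

lemma wp_mono: "wp c P s \<Longrightarrow> (\<And>s'. P s' \<Longrightarrow> Q s') \<Longrightarrow> wp c Q s"
proof (induction c arbitrary: P Q s)
  case (Semi c d)
  from Semi.prems(1) have "wp c (wp d P) s" by simp
  then have "wp c (wp d Q) s"
    by (rule Semi.IH(1)) (erule Semi.IH(2), rule Semi.prems(2))
  then show ?case by simp
next
  case (Cond b c d)
  then show ?case by (auto split: if_splits)
next
  case (Loop i l c)
  from Loop.prems(1) have "loop_wp (wp c) i (lim l) 0 P s" by simp
  then have "loop_wp (wp c) i (lim l) 0 Q s"
    by (rule loop_wp_mono[rotated]) (rule Loop.prems(2), assumption, rule Loop.IH)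
  then show ?case using Loop.prems(1) by simp
qed auto

definition frame :: "hcom \<Rightarrow> 'a hstate \<Rightarrow> 'a hstate \<Rightarrow> bool" where
  "frame c s s' \<longleftrightarrow> (\<forall>x. x \<notin> mods c \<longrightarrow> var s' x = var s x) \<and>
     (\<forall>kd. kd \<notin> kinds c \<longrightarrow> arr s' kd = arr s kd) \<and> (\<not> estores c \<longrightarrow> earr s' = earr s)"

lemma loop_wp_invariant:
  assumes "I k (setv i k s)" and "k \<le> L"
    and "\<And>k s. k < L \<Longrightarrow> I k s \<Longrightarrow> var s i = k \<Longrightarrow> W (\<lambda>s'. I (Suc k) (setv i (Suc k) s')) s"
    and mono: "\<And>P Q s. (\<And>s'. P s' \<Longrightarrow> Q s') \<Longrightarrow> W P s \<Longrightarrow> W Q s"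
    and "\<And>s. I L s \<Longrightarrow> var s i = L \<Longrightarrow> Q s"
  shows "loop_wp W i (L - k) k Q s"
  using assms(1,2)
proof (induction "L - k" arbitrary: k s)
  case 0
  then have k: "k = L" by simp
  have "I L (setv i L s)" using 0(2) unfolding k .
  then have "Q (setv i L s)" by (rule assms(5)) simp
  then show ?case using 0(1) unfolding k by (simp only: loop_wp.simps diff_self_eq_0)
next
  case (Suc r)
  then have r: "r = L - Suc k" and lt: "k < L" by auto
  have "W (\<lambda>s'. I (Suc k) (setv i (Suc k) s')) (setv i k s)"
    using assms(3)[OF lt Suc.prems(1)] by simp
  then have "W (loop_wp W i r (Suc k) Q) (setv i k s)"
    by (rule mono[rotated]) (use Suc.hyps(1)[OF r] lt r in auto)
  then show ?case using Suc.hyps(2)[symmetric] by simp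
qed

text \<open>Stated for an arbitrary transformer \<open>W\<close> and relation \<open>F\<close> so
  that it applies inside the induction of \<open>wp_frame\<close>, where the frame property of the
  body is only an induction hypothesis.\<close>

lemma loop_wp_cong_frame:
  assumes W: "\<And>Q s. W Q s \<Longrightarrow> W (\<lambda>s'. Q s' \<and> F s s') s"
    and mono: "\<And>P Q s. (\<And>s'. P s' \<Longrightarrow> Q s') \<Longrightarrow> W P s \<Longrightarrow> W Q s"
    and refl: "\<And>s k. F s (setv i k s)"
    and trans: "\<And>a b c. F a b \<Longrightarrow> F b c \<Longrightarrow> F a c"
    and "loop_wp W i r k Q s"
  shows "loop_wp W i r k (\<lambda>s'. Q s' \<and> F s s') s"
  using assms(5)
proof (induction r arbitrary: k s)
  case 0
  then show ?case using refl by simp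
next
  case (Suc r)
  have "W (\<lambda>s'. loop_wp W i r (Suc k) Q s' \<and> F (setv i k s) s') (setv i k s)"
    using W Suc.prems by simp
  then have "W (loop_wp W i r (Suc k) (\<lambda>s'. Q s' \<and> F s s')) (setv i k s)"
  proof (rule mono[rotated])
    fix t assume t: "loop_wp W i r (Suc k) Q t \<and> F (setv i k s) t"
    then have "loop_wp W i r (Suc k) (\<lambda>s'. Q s' \<and> F t s') t" using Suc.IH by blast
    then show "loop_wp W i r (Suc k) (\<lambda>s'. Q s' \<and> F s s') t"
    proof (rule loop_wp_mono[rotated])
      show "\<And>s'. Q s' \<and> F t s' \<Longrightarrow> Q s' \<and> F s s'" using t refl trans by blast
    qed (rule mono)
  qed
  then show ?case by simp
qed

text \<open>Established once from the program text, this allows the loop invariants of the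
  construction to speak only about the data that a loop modifies.\<close>

lemma wp_frame: "wp c Q s \<Longrightarrow> wp c (\<lambda>s'. Q s' \<and> frame c s s') s"
proof (induction c arbitrary: Q s)
  case (Semi c d)
  have "wp c (\<lambda>t. wp d Q t \<and> frame c s t) s" using Semi.IH(1) Semi.prems by simp
  then have "wp c (wp d (\<lambda>s'. Q s' \<and> frame (c ;; d) s s')) s"
  proof (rule wp_mono)
    fix t assume t: "wp d Q t \<and> frame c s t"
    then have "wp d (\<lambda>s'. Q s' \<and> frame d t s') t" using Semi.IH(2) by blast
    then show "wp d (\<lambda>s'. Q s' \<and> frame (c ;; d) s s') t"
      by (rule wp_mono) (use t in \<open>auto simp: frame_def\<close>)
  qed
  then show ?case by simp
next
  case (Cond b c d)
  have "wp c (\<lambda>s'. Q s' \<and> frame (Cond b c d) s s') s" if "evalb b s"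
    by (rule wp_mono[OF Cond.IH(1)[of Q]]) (use Cond.prems that in \<open>auto simp: frame_def\<close>)
  moreover have "wp d (\<lambda>s'. Q s' \<and> frame (Cond b c d) s s') s" if "\<not> evalb b s"
    by (rule wp_mono[OF Cond.IH(2)[of Q]]) (use Cond.prems that in \<open>auto simp: frame_def\<close>)
  ultimately show ?case using Cond.prems by simp
next
  case (Loop i l c)
  have "loop_wp (wp c) i (lim l) 0 (\<lambda>s'. Q s' \<and> frame (Loop i l c) s s') s"
  proof (rule loop_wp_cong_frame)
    show "loop_wp (wp c) i (lim l) 0 Q s" using Loop.prems by simp
  next
    fix Q s assume "wp c Q s"
    then have "wp c (\<lambda>s'. Q s' \<and> frame c s s') s" using Loop.IH by blast
    then show "wp c (\<lambda>s'. Q s' \<and> frame (Loop i l c) s s') s"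
      by (rule wp_mono) (auto simp: frame_def)
  qed (erule wp_mono, auto simp: frame_def)
  then show ?case using Loop.prems by simp
qed (auto simp: frame_def)

text \<open>The invariant is evaluated after the counter is set, matching the increment that ends a
  compiled round. The frame is taken relative to the state before the loop, so facts on entry carry
  over to every round.\<close>

lemma wp_Loop:
  assumes "var s l = lim l" and "I 0 (setv i 0 s)"
    and step: "\<And>k s'. k < lim l \<Longrightarrow> frame (Loop i l c) s s' \<Longrightarrow> I k s' \<Longrightarrow> var s' i = k
      \<Longrightarrow> wp c (\<lambda>s''. I (Suc k) (setv i (Suc k) s'')) s'"
    and post: "\<And>s'. I (lim l) s' \<Longrightarrow> frame (Loop i l c) s s' \<Longrightarrow> var s' i = lim l \<Longrightarrow> Q s'"
  shows "wp (Loop i l c) Q s"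
proof -
  let ?J = "\<lambda>k s'. I k s' \<and> frame (Loop i l c) s s'"
  have "loop_wp (wp c) i (lim l - 0) 0 Q s"
  proof (rule loop_wp_invariant[where I = ?J])
    show "?J 0 (setv i 0 s)" using assms(2) by (auto simp: frame_def)
    fix k s' assume k: "k < lim l" and J: "?J k s'" and vi: "var s' i = k"
    show "wp c (\<lambda>t. ?J (Suc k) (setv i (Suc k) t)) s'"
      by (rule wp_mono[OF wp_frame[OF step[OF k]]]) (use J vi in \<open>auto simp: frame_def\<close>)
  next
    show "Q s'" if "?J (lim l) s'" "var s' i = lim l" for s' using post that by blast
  qed (simp, erule wp_mono, simp_all)
  then show ?thesis using assms(1) by simp
qed


section \<open>Memory layout and the simulation relation\<close>

definition addr :: "nat \<Rightarrow> nat \<Rightarrow> nat \<Rightarrow> nat" where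
  "addr kd i v = (i * 12 + kd) * n + v"

definition eaddr :: "nat \<Rightarrow> nat \<Rightarrow> nat" where
  "eaddr i v = i * n + v + m"

lemma row_less: "a < b \<Longrightarrow> v < n \<Longrightarrow> a * n + v < b * n" for a b v :: nat
proof -
  assume "a < b" "v < n"
  then have "a * n + v < Suc a * n" by simp
  also have "\<dots> \<le> b * n" using \<open>a < b\<close> by (intro mult_le_mono1) simp
  finally show ?thesis .
qed

lemma row_inject: "v < n \<Longrightarrow> v' < n \<Longrightarrow> a * n + v = a' * n + v' \<longleftrightarrow> a = a' \<and> v = v'" for a v :: nat
  using row_less[of a a' v] row_less[of a' a v']
  by (metis add_left_cancel linorder_neqE_nat not_add_less1 trans_less_add1)

lemma addr_less: "kd < 12 \<Longrightarrow> i \<le> m \<Longrightarrow> v < n \<Longrightarrow> addr kd i v < M"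
  using row_less[of "i * 12 + kd" "12 * (m + 1)" v] word_space by (simp add: addr_def)

lemma addr_inject: "kd < 12 \<Longrightarrow> kd' < 12 \<Longrightarrow> v < n \<Longrightarrow> v' < n
    \<Longrightarrow> addr kd i v = addr kd' i' v' \<longleftrightarrow> kd = kd' \<and> i = i' \<and> v = v'"
  unfolding addr_def by (subst row_inject) (auto, presburger+)

lemma eaddr_less: "i \<le> m + 1 \<Longrightarrow> v < n \<Longrightarrow> eaddr i v < M"
  using row_less[of i "m + 2" v] elem_space by (simp add: eaddr_def)

lemma eaddr_inject: "v < n \<Longrightarrow> v' < n \<Longrightarrow> eaddr i v = eaddr i' v' \<longleftrightarrow> i = i' \<and> v = v'"
  unfolding eaddr_def using row_inject by auto

text \<open>Registers from 20 on are left out, being scratch space of expressions. Register 1 is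
  pinned to \<open>n\<close> since every address computation multiplies by it.\<close>

definition rel :: "'a state \<Rightarrow> 'a hstate \<Rightarrow> bool" where
  "rel s h \<longleftrightarrow> (\<forall>x<20. reg s x = var h x) \<and> reg s 1 = n \<and>
     (\<forall>kd<12. \<forall>i\<le>m. \<forall>v<n. mem s (addr kd i v) = arr h kd i v) \<and>
     (\<forall>x. elem_reg s x = evar h x) \<and> (\<forall>i\<le>m + 1. \<forall>v<n. elem_mem s (eaddr i v) = earr h i v)"

text \<open>A function for the atomic instructions lets the simplifier run straight-line code, which
  the relation \<open>exec\<close> does not.\<close>

fun step :: "com \<Rightarrow> 'a state \<Rightarrow> 'a state" where
  "step (Const i a) s = s\<lparr>reg := (reg s)(i := a mod 2 ^ w)\<rparr>"
| "step (Move i j) s = s\<lparr>reg := (reg s)(i := reg s j)\<rparr>"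
| "step (Op f i j l) s = s\<lparr>reg := (reg s)(i := word_op w f (reg s j) (reg s l))\<rparr>"
| "step (Load i j) s = s\<lparr>reg := (reg s)(i := mem s (reg s j))\<rparr>"
| "step (Store i j) s = s\<lparr>mem := (mem s)(reg s i := reg s j)\<rparr>"
| "step (ElemLoad i j) s = s\<lparr>elem_reg := (elem_reg s)(i := elem_mem s (reg s j))\<rparr>"
| "step (ElemStore i j) s = s\<lparr>elem_mem := (elem_mem s)(reg s i := elem_reg s j)\<rparr>"
| "step (ElemMul i j l) s = s\<lparr>elem_reg := (elem_reg s)(i := mul (elem_reg s j) (elem_reg s l))\<rparr>"
| "step _ s = s"

fun step_ok :: "com \<Rightarrow> 'a state \<Rightarrow> bool" where
  "step_ok (Load i j) s = (reg s j < M)"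
| "step_ok (Store i j) s = (reg s i < M)"
| "step_ok (ElemLoad i j) s = (reg s j < M)"
| "step_ok (ElemStore i j) s = (reg s i < M)"
| "step_ok (Seq c d) s = False"
| "step_ok (While b c) s = False"
| "step_ok (If b c d) s = False"
| "step_ok (ElemMove i j) s = False"
| "step_ok _ s = True"

definition runs :: "com \<Rightarrow> 'a state \<Rightarrow> nat \<Rightarrow> ('a state \<Rightarrow> bool) \<Rightarrow> bool" where
  "runs c s T Q \<longleftrightarrow> (\<exists>t p s'. exec w M M mul c s t p s' \<and> t \<le> T \<and> Q s')"

lemma exec_step: "step_ok c s \<Longrightarrow> \<exists>p. exec w M M mul c s 1 p (step c s)"
  by (cases c; simp del: One_nat_def; blast intro: exec.intros)

lemma runs_step: "step_ok c s \<Longrightarrow> Q (step c s) \<Longrightarrow> 1 \<le> T \<Longrightarrow> runs c s T Q"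
  unfolding runs_def using exec_step by blast

lemma runs_Seq:
  assumes "runs c s T (\<lambda>s'. runs d s' (X - T) Q)" and "T \<le> X"
  shows "runs (Seq c d) s X Q"
proof -
  from assms(1) obtain t p s' u p' s'' where "exec w M M mul c s t p s'" "t \<le> T"
    "exec w M M mul d s' u p' s''" "u \<le> X - T" "Q s''" by (auto simp: runs_def)
  moreover from this have "t + u \<le> X" using assms(2) by linarith
  ultimately show ?thesis unfolding runs_def using exec_Seq by blast
qed

lemma runs_step_Seq:
  assumes "step_ok c s" and "runs d (step c s) (X - 1) Q" and "1 \<le> X"
  shows "runs (Seq c d) s X Q"
  using runs_Seq[OF runs_step[OF assms(1), of "\<lambda>s. runs d s (X - 1) Q" 1] assms(3)] assms(2) by simp

lemma runs_mono: "runs c s T P \<Longrightarrow> (\<And>s'. P s' \<Longrightarrow> Q s') \<Longrightarrow> T \<le> U \<Longrightarrow> runs c s U Q"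
  unfolding runs_def by (meson le_trans)

lemma runs_If:
  assumes "runs (if test_holds b s then c else d) s T Q" and "T + 1 \<le> X"
  shows "runs (If b c d) s X Q"
proof (cases "test_holds b s")
  case True
  then obtain t p s' where "exec w M M mul c s t p s'" "t \<le> T" "Q s'"
    using assms(1) by (auto simp: runs_def)
  then show ?thesis using exec_IfTrue[OF True] assms(2) unfolding runs_def by fastforce
next
  case False
  then obtain t p s' where "exec w M M mul d s t p s'" "t \<le> T" "Q s'"
    using assms(1) by (auto simp: runs_def)
  then show ?thesis using exec_IfFalse[OF False] assms(2) unfolding runs_def by fastforce
qed

lemma runs_While_False: "\<not> test_holds b s \<Longrightarrow> Q s \<Longrightarrow> 1 \<le> X \<Longrightarrow> runs (While b c) s X Q"
  unfolding runs_def using exec_WhileFalse by blast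

lemma runs_While_True:
  assumes "test_holds b s" and "runs c s T (\<lambda>s'. runs (While b c) s' U Q)" and "1 + T + U \<le> X"
  shows "runs (While b c) s X Q"
proof -
  from assms(2) obtain t p s' u p' s'' where "exec w M M mul c s t p s'" "t \<le> T"
    "exec w M M mul (While b c) s' u p' s''" "u \<le> U" "Q s''" by (auto simp: runs_def)
  then show ?thesis using exec_WhileTrue[OF assms(1)] assms(3) unfolding runs_def
    by (metis (no_types, lifting) add_le_mono le_trans order_refl)
qed

lemma runs_Seq_mono:
  assumes "runs c s T P" and "\<And>s'. P s' \<Longrightarrow> runs d s' (X - T) Q" and "T \<le> X"
  shows "runs (Seq c d) s X Q"
  using runs_Seq[OF runs_mono[OF assms(1)] assms(3)] assms(2) by blast

definition only_temps :: "nat \<Rightarrow> 'a state \<Rightarrow> 'a state \<Rightarrow> bool" where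
  "only_temps r s s' \<longleftrightarrow> (\<forall>j<r. reg s' j = reg s j) \<and> mem s' = mem s \<and>
     elem_reg s' = elem_reg s \<and> elem_mem s' = elem_mem s"

lemma rel_only_temps: "rel s h \<Longrightarrow> only_temps r s s' \<Longrightarrow> 20 \<le> r \<Longrightarrow> rel s' h"
  by (auto simp: rel_def only_temps_def)

text \<open>The word arrays have at least \<open>12 * 2 * 1\<close> cells and all their addresses
  are words, so the literals up to 12 of the address computation fit.\<close>

lemma const_less: "a \<le> 12 \<Longrightarrow> a < 2 ^ w" for a :: nat
proof -
  assume "a \<le> 12"
  have "12 * 2 * 1 \<le> 12 * (m + 1) * n"
    using n_pos m_pos by (intro mult_le_mono) auto
  also have "\<dots> \<le> 2 ^ w" using word_space M_le by (rule le_trans)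
  finally show ?thesis using \<open>a \<le> 12\<close> by (simp add: less_le_trans)
qed

lemma n_bound: "12 * n \<le> 2 ^ w" and m_bound: "12 * (m + 1) \<le> 2 ^ w"
proof -
  have le: "12 * (m + 1) * n \<le> 2 ^ w" using word_space M_le by (rule le_trans)
  have "12 * 1 * n \<le> 12 * (m + 1) * n" by (intro mult_le_mono) auto
  from le_trans[OF this le] show "12 * n \<le> 2 ^ w" by (simp only: mult_1_right)
  have "12 * (m + 1) * 1 \<le> 12 * (m + 1) * n" using n_pos by (intro mult_le_mono) auto
  from le_trans[OF this le] show "12 * (m + 1) \<le> 2 ^ w" by (simp only: mult_1_right)
qed

lemma w_pos: "1 \<le> w"
  using const_less[of 1] by (cases w) auto

text \<open>Since \<open>n\<close> is positive, the intermediate results of an address computation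
  are at most the address of cell 0 of the row.\<close>

lemma row_index: "kd < 12 \<Longrightarrow> i \<le> m \<Longrightarrow> i * 12 < 2 ^ w \<and> i * 12 + kd < 2 ^ w \<and> (i * 12 + kd) * n < 2 ^ w"
proof -
  assume "kd < 12" "i \<le> m"
  then have *: "(i * 12 + kd) * n < 2 ^ w"
    using addr_less[of kd i 0] n_pos M_le by (simp add: addr_def)
  have "(i * 12 + kd) * 1 \<le> (i * 12 + kd) * n" using n_pos by (rule mult_le_mono2)
  with * have "i * 12 + kd < 2 ^ w" by (simp only: mult_1_right)
  with * show ?thesis by simp
qed

text \<open>A fixed program does not know \<open>w\<close>. The subtraction \<open>0 - 1\<close>
  wraps around to \<open>2 ^ w - 1\<close>, from which this formula yields the value of
  \<open>Top\<close>.\<close>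

lemma top_exp: "(2 ^ w - 1) div 2 + 1 = (2 ^ (w - 1) :: nat)"
proof -
  obtain u where w: "w = Suc u" using w_pos by (cases w) auto
  have "(2 * 2 ^ u - 1) div 2 = (2 ^ u - 1 :: nat)" by arith
  then show ?thesis by (simp add: w)
qed

text \<open>Evaluation follows a stack discipline: code with target \<open>r\<close> writes only
  \<open>r\<close> and higher registers, so the first operand survives in \<open>r\<close> while the
  second is computed in \<open>r + 1\<close>.\<close>

lemma runs_exp:
  assumes "rel s h" "safe e h" "wfe e" "20 \<le> r"
  shows "runs (compile_exp e r) s (time_exp e) (\<lambda>s'. only_temps r s s' \<and> reg s' r = eval e h)"
  using assms
proof (induction e arbitrary: r s)
  case (Lit a)
  then show ?case by (auto intro!: runs_step simp: only_temps_def)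
next
  case (Var x)
  then show ?case by (auto intro!: runs_step simp: only_temps_def rel_def)
next
  case (Bin f a b)
  show ?case
    unfolding compile_exp.simps
  proof (rule runs_Seq_mono[OF Bin.IH(1)])
    fix t assume t: "only_temps r s t \<and> reg t r = eval a h"
    show "runs (Seq (compile_exp b (r + 1)) (Op f r r (r + 1))) t
       (time_exp (Bin f a b) - time_exp a) (\<lambda>s'. only_temps r s s' \<and> reg s' r = eval (Bin f a b) h)"
    proof (rule runs_Seq_mono[OF Bin.IH(2)])
      show "rel t h" using t Bin.prems rel_only_temps by blast
    next
      fix u assume "only_temps (r + 1) t u \<and> reg u (r + 1) = eval b h"
      then show "runs (Op f r r (r + 1)) u (time_exp (Bin f a b) - time_exp a - time_exp b)
        (\<lambda>s'. only_temps r s s' \<and> reg s' r = eval (Bin f a b) h)"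
        using Bin.prems t by (auto intro!: runs_step simp: only_temps_def word_op_opv)
    qed (use Bin.prems in auto)
  qed (use Bin.prems in auto)
next
  case (Ld kd ei ev)
  let ?i = "eval ei h" and ?v = "eval ev h"
  note p = Ld.prems
  have idx: "?i * 12 < 2 ^ w" "?i * 12 + kd < 2 ^ w" "(?i * 12 + kd) * n < 2 ^ w"
    "(?i * 12 + kd) * n + ?v < M" "kd < 2 ^ w" "12 < (2::nat) ^ w"
    using row_index[of kd ?i] addr_less[of kd ?i ?v] const_less[of 12] const_less[of kd] p by (auto simp: addr_def)
  have r1: "reg s 1 = n" using p by (simp add: rel_def)
  show ?case
    unfolding compile_exp.simps
  proof (rule runs_Seq_mono[OF Ld.IH(1)])
    fix t assume t: "only_temps r s t \<and> reg t r = ?i"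
    then have t1: "reg t 1 = n" using r1 p by (simp add: only_temps_def)
    let ?t = "step (Op Mult r r 1) (step (Op Add r r (r + 1)) (step (Const (r + 1) kd)
               (step (Op Mult r r (r + 1)) (step (Const (r + 1) 12) t))))"
    have ot: "only_temps r s ?t" using t p by (auto simp: only_temps_def)
    have r: "reg ?t r = (?i * 12 + kd) * n" using t t1 p idx by (auto simp: only_temps_def)
    show "runs (Seq (Const (r + 1) 12) (Seq (Op Mult r r (r + 1))
     (Seq (Const (r + 1) kd) (Seq (Op Add r r (r + 1)) (Seq (Op Mult r r 1)
     (Seq (compile_exp ev (r + 1)) (Seq (Op Add r r (r + 1)) (Load r r)))))))) t
       (time_exp (Ld kd ei ev) - time_exp ei) (\<lambda>s'. only_temps r s s' \<and> reg s' r = eval (Ld kd ei ev) h)"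
    proof ((rule runs_step_Seq, (simp; fail))+, rule runs_Seq_mono[OF Ld.IH(2)])
      show "rel ?t h" using rel_only_temps[OF p(1) ot p(4)] .
    next
      fix u assume u: "only_temps (r + 1) ?t u \<and> reg u (r + 1) = ?v"
      then have ur: "reg u r = (?i * 12 + kd) * n" using r by (simp add: only_temps_def)
      have "only_temps r s u" using u ot by (auto simp: only_temps_def)
      moreover have "mem u (addr kd ?i ?v) = arr h kd ?i ?v"
        using u p t by (auto simp: only_temps_def rel_def)
      ultimately show "runs (Seq (Op Add r r (r + 1)) (Load r r)) u
         (time_exp (Ld kd ei ev) - time_exp ei - 1 - 1 - 1 - 1 - 1 - time_exp ev)
         (\<lambda>s'. only_temps r s s' \<and> reg s' r = eval (Ld kd ei ev) h)"
        using idx u ur p M_le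
        by (intro runs_step_Seq runs_step) (auto simp: only_temps_def addr_def)
    qed (use p in auto)
  qed (use p in auto)
next
  case Top
  have two: "2 < (2::nat) ^ w" "1 < (2::nat) ^ w" using const_less by auto
  show ?case
    unfolding compile_exp.simps
    by ((rule runs_step_Seq, (simp; fail))+, rule runs_step; use two top_exp w_pos in \<open>simp add: only_temps_def word_op.simps power_0\<close>)
qed

text \<open>An upper bound: a conditional is charged for both branches, which keeps the total a
  polynomial in \<open>m\<close> and \<open>n\<close>. Each round of a loop pays 3 for the test and
  the increment; the summand 2 is for the initialisation and the last test.\<close>

primrec time_com :: "hcom \<Rightarrow> nat" where
  "time_com Nop = 1"
| "time_com (Asg x e) = time_exp e + 1"
| "time_com (St kd ei ev e) = time_exp ei + time_exp ev + time_exp e + 8"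
| "time_com (EMulA x y z) = 1"
| "time_com (ELd x ei ev) = time_exp ei + time_exp ev + 6"
| "time_com (ESt ei ev x) = time_exp ei + time_exp ev + 6"
| "time_com (c ;; d) = time_com c + time_com d"
| "time_com (Cond b c d) = time_test b + time_com c + time_com d"
| "time_com (Loop i l c) = 2 + lim l * (time_com c + 3)"

lemma safe_addr_exp:
  assumes "rel s h"
  shows "safe ei h \<Longrightarrow> safe ev h \<Longrightarrow> kd < 12 \<Longrightarrow> eval ei h \<le> m \<Longrightarrow> eval ev h < n \<Longrightarrow> safe (addr_exp kd ei ev) h"
    and "eval (addr_exp kd ei ev) h = addr kd (eval ei h) (eval ev h)"
proof -
  have n: "var h 1 = n" using assms by (auto simp: rel_def)
  then show "eval (addr_exp kd ei ev) h = addr kd (eval ei h) (eval ev h)" by (simp add: addr_exp_def addr_def)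
  assume "safe ei h" "safe ev h" "kd < 12" "eval ei h \<le> m" "eval ev h < n"
  then show "safe (addr_exp kd ei ev) h"
    using n row_index[of kd "eval ei h"] addr_less[of kd "eval ei h" "eval ev h"] const_less[of 12]
      const_less[of kd] M_le by (simp add: addr_exp_def addr_def)
qed

lemma safe_eaddr_exp:
  assumes "rel s h" "var h 0 = m"
  shows "safe ei h \<Longrightarrow> safe ev h \<Longrightarrow> eval ei h \<le> m + 1 \<Longrightarrow> eval ev h < n \<Longrightarrow> safe (eaddr_exp ei ev) h"
    and "eval (eaddr_exp ei ev) h = eaddr (eval ei h) (eval ev h)"
proof -
  have n: "var h 1 = n" using assms by (auto simp: rel_def)
  with assms(2) show "eval (eaddr_exp ei ev) h = eaddr (eval ei h) (eval ev h)"
    by (simp add: eaddr_exp_def eaddr_def)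
  assume "safe ei h" "safe ev h" "eval ei h \<le> m + 1" "eval ev h < n"
  then show "safe (eaddr_exp ei ev) h"
    using n assms(2) eaddr_less[of "eval ei h" "eval ev h"] M_le by (simp add: eaddr_exp_def eaddr_def)
qed

text \<open>A weakest precondition over natural numbers turns into a terminating run of the compiled
  code with a time bound. The structured programs can thus be verified without reference to machine
  states.\<close>

lemma runs_compile:
  assumes "wp c Q h" "wf_com c" "rel s h"
  shows "runs (compile c) s (time_com c) (\<lambda>s'. \<exists>h'. rel s' h' \<and> Q h')"
  using assms
proof (induction c arbitrary: Q h s)
  case Nop
  then show ?case by (auto intro!: runs_step)
next
  case (Asg x e)
  show ?case
    unfolding compile.simps
  proof (rule runs_Seq_mono[OF runs_exp[of _ h]])
    fix t assume "only_temps 20 s t \<and> reg t 20 = eval e h"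
    then have "rel (step (Move x 20) t) (setv x (eval e h) h)"
      using Asg.prems by (auto simp: rel_def only_temps_def)
    then show "runs (Move x 20) t (time_com (Asg x e) - time_exp e) (\<lambda>s'. \<exists>h'. rel s' h' \<and> Q h')"
      using Asg.prems by (intro runs_step) auto
  qed (use Asg.prems in auto)
next
  case (St kd ei ev e)
  let ?i = "eval ei h" and ?v = "eval ev h"
  let ?h = "h\<lparr>arr := (arr h)(kd := (arr h kd)(?i := (arr h kd ?i)(?v := eval e h)))\<rparr>"
  note p = St.prems
  have a: "addr kd ?i ?v < M" using addr_less p by simp
  show ?case
    unfolding compile.simps
  proof (rule runs_Seq_mono[OF runs_exp[OF p(3) safe_addr_exp(1)[OF p(3)]]])
    fix t assume "only_temps 20 s t \<and> reg t 20 = eval (addr_exp kd ei ev) h"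
    then have t: "only_temps 20 s t" "reg t 20 = addr kd ?i ?v" using safe_addr_exp(2)[OF p(3)] by auto
    show "runs (Seq (compile_exp e 21) (Store 20 21)) t
        (time_com (St kd ei ev e) - time_exp (addr_exp kd ei ev)) (\<lambda>s'. \<exists>h'. rel s' h' \<and> Q h')"
    proof (rule runs_Seq_mono[OF runs_exp[of t h e]])
      show "rel t h" using rel_only_temps[OF p(3) t(1)] by simp
    next
      fix z assume z: "only_temps 21 t z \<and> reg z 21 = eval e h"
      then have oz: "only_temps 20 s z" "reg z 20 = addr kd ?i ?v" using t by (auto simp: only_temps_def)
      have "rel z h" using rel_only_temps[OF p(3) oz(1)] by simp
      then have "rel (step (Store 20 21) z) ?h" using z oz p by (auto simp: rel_def addr_inject)
      then show "runs (Store 20 21) z (time_com (St kd ei ev e) - time_exp (addr_exp kd ei ev) - time_exp e)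
          (\<lambda>s'. \<exists>h'. rel s' h' \<and> Q h')"
        using oz a p by (intro runs_step) (auto simp: addr_exp_def)
    qed (use p in \<open>auto simp: addr_exp_def\<close>)
  qed (use p in \<open>auto simp: addr_exp_def\<close>)
next
  case (EMulA x y z)
  have "rel (step (ElemMul x y z) s) (h\<lparr>evar := (evar h)(x := mul (evar h y) (evar h z))\<rparr>)"
    using EMulA.prems by (auto simp: rel_def)
  then show ?case using EMulA.prems unfolding compile.simps by (intro runs_step) auto
next
  case (ELd x ei ev)
  let ?i = "eval ei h" and ?v = "eval ev h"
  note p = ELd.prems
  show ?case
    unfolding compile.simps
  proof (rule runs_Seq_mono[OF runs_exp[OF p(3) safe_eaddr_exp(1)[OF p(3)]]])
    fix t assume "only_temps 20 s t \<and> reg t 20 = eval (eaddr_exp ei ev) h"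
    then have t: "rel t h" "reg t 20 = eaddr ?i ?v"
      using rel_only_temps[OF p(3)] safe_eaddr_exp(2)[OF p(3)] p by auto
    then have "rel (step (ElemLoad x 20) t) (h\<lparr>evar := (evar h)(x := earr h ?i ?v)\<rparr>)"
      using p by (auto simp: rel_def)
    then show "runs (ElemLoad x 20) t (time_com (ELd x ei ev) - time_exp (eaddr_exp ei ev)) (\<lambda>s'. \<exists>h'. rel s' h' \<and> Q h')"
      using t p eaddr_less[of ?i ?v] by (intro runs_step) (auto simp: eaddr_exp_def)
  qed (use p in \<open>auto simp: eaddr_exp_def\<close>)
next
  case (ESt ei ev x)
  let ?i = "eval ei h" and ?v = "eval ev h"
  note p = ESt.prems
  show ?case
    unfolding compile.simps
  proof (rule runs_Seq_mono[OF runs_exp[OF p(3) safe_eaddr_exp(1)[OF p(3)]]])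
    fix t assume "only_temps 20 s t \<and> reg t 20 = eval (eaddr_exp ei ev) h"
    then have t: "rel t h" "reg t 20 = eaddr ?i ?v"
      using rel_only_temps[OF p(3)] safe_eaddr_exp(2)[OF p(3)] p by auto
    then have "rel (step (ElemStore 20 x) t) (h\<lparr>earr := (earr h)(?i := (earr h ?i)(?v := evar h x))\<rparr>)"
      using p by (auto simp: rel_def eaddr_inject)
    then show "runs (ElemStore 20 x) t (time_com (ESt ei ev x) - time_exp (eaddr_exp ei ev)) (\<lambda>s'. \<exists>h'. rel s' h' \<and> Q h')"
      using t p eaddr_less[of ?i ?v] by (intro runs_step) (auto simp: eaddr_exp_def)
  qed (use p in \<open>auto simp: eaddr_exp_def\<close>)
next
  case (Semi c d)
  show ?case
    unfolding compile.simps
    by (rule runs_Seq_mono[OF Semi.IH(1)[of "wp d Q" h]]; use Semi.prems Semi.IH(2) in auto)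
next
  case (Cond b c d)
  have branch: "runs (if evalb b h then compile c else compile d) t (time_com c + time_com d)
      (\<lambda>s'. \<exists>h'. rel s' h' \<and> Q h')" if "rel t h" for t
    using that Cond.IH(1)[of Q h t] Cond.IH(2)[of Q h t] Cond.prems
    by (auto split: if_splits intro: runs_mono)
  have cmp: "runs (Seq (compile_exp a 20) (Seq (compile_exp a' 21) (If b' (compile c) (compile d)))) s
      (time_exp a + time_exp a' + 1 + time_com c + time_com d) (\<lambda>s'. \<exists>h'. rel s' h' \<and> Q h')"
    if a: "safe a h" "safe a' h" "wfe a" "wfe a'"
      and b': "\<And>t :: 'a state. reg t 20 = eval a h \<Longrightarrow> reg t 21 = eval a' h \<Longrightarrow> test_holds b' t = evalb b h" for a a' b'
  proof (rule runs_Seq_mono[OF runs_exp[of s h a]])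
    fix t assume t: "only_temps 20 s t \<and> reg t 20 = eval a h"
    show "runs (Seq (compile_exp a' 21) (If b' (compile c) (compile d))) t
      (time_exp a + time_exp a' + 1 + time_com c + time_com d - time_exp a) (\<lambda>s'. \<exists>h'. rel s' h' \<and> Q h')"
    proof (rule runs_Seq_mono[OF runs_exp[of t h a']])
      show "rel t h" using rel_only_temps[OF Cond.prems(3)] t by blast
    next
      fix u assume u: "only_temps 21 t u \<and> reg u 21 = eval a' h"
      then have "only_temps 20 s u" "reg u 20 = eval a h" using t by (auto simp: only_temps_def)
      then show "runs (If b' (compile c) (compile d)) u
        (time_exp a + time_exp a' + 1 + time_com c + time_com d - time_exp a - time_exp a')
        (\<lambda>s'. \<exists>h'. rel s' h' \<and> Q h')"
        using branch[OF rel_only_temps[OF Cond.prems(3)], of 20 u] b'[of u] u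
        by (intro runs_If[of _ _ _ _ "time_com c + time_com d"]) auto
    qed (use a in auto)
  qed (use a Cond.prems in auto)
  show ?case
  proof (cases b)
    case (Lt a a')
    then show ?thesis using cmp[of a a' "Less 20 21"] Cond.prems by simp
  next
    case (Eq a a')
    then show ?thesis using cmp[of a a' "Equal 20 21"] Cond.prems by simp
  next
    case (EEq x y)
    then show ?thesis using Cond.prems branch[of s]
      by (auto intro!: runs_If[of _ _ _ _ "time_com c + time_com d"] simp: rel_def)
  qed
next
  case (Loop i l c)
  let ?P = "\<lambda>s'. \<exists>h'. rel s' h' \<and> Q h'"
  let ?W = "While (Less i l) (Seq (compile c) (Seq (Const 20 1) (Op Add i i 20)))"
  have wfc: "wf_com c" "i < 20" "l < 20" "i \<noteq> l" "i \<noteq> 1" "i \<notin> mods c" "l \<notin> mods c"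
    using Loop.prems by auto
  have lw: "lim l < 2 ^ w"
    using n_bound m_bound n_pos by (auto simp: lim_def)
  \<comment> \<open>Induction on the rounds left; the frame of the body guarantees that the counter
    and the bound survive it.\<close>
  have iter: "loop_wp (wp c) i r k Q h \<Longrightarrow> k + r = lim l \<Longrightarrow> var h l = lim l \<Longrightarrow> rel s (setv i k h)
      \<Longrightarrow> runs ?W s (1 + r * (time_com c + 3)) ?P" for r k h s
  proof (induction r arbitrary: k h s)
    case 0
    then have "\<not> test_holds (Less i l) s" using wfc by (auto simp: rel_def)
    moreover have "Q (setv i k h)" using 0(1) by (simp only: loop_wp.simps)
    with 0(4) have "?P s" by (intro exI conjI)
    ultimately show ?case by (rule runs_While_False) simp
  next
    case (Suc r)
    let ?h = "setv i k h"
    have "wp c (loop_wp (wp c) i r (Suc k) Q) ?h" using Suc.prems by simp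
    then have "wp c (\<lambda>h'. loop_wp (wp c) i r (Suc k) Q h' \<and> frame c ?h h') ?h" by (rule wp_frame)
    then have "runs (compile c) s (time_com c)
      (\<lambda>s'. \<exists>h'. rel s' h' \<and> loop_wp (wp c) i r (Suc k) Q h' \<and> frame c ?h h')"
      using Loop.IH Suc.prems(4) wfc by blast
    then have body: "runs (Seq (compile c) (Seq (Const 20 1) (Op Add i i 20))) s (time_com c + 2)
      (\<lambda>s'. runs ?W s' (1 + r * (time_com c + 3)) ?P)"
    proof (rule runs_Seq[OF runs_mono])
      fix t assume "\<exists>h'. rel t h' \<and> loop_wp (wp c) i r (Suc k) Q h' \<and> frame c ?h h'"
      then obtain h' where h': "rel t h'" "loop_wp (wp c) i r (Suc k) Q h'" "frame c ?h h'" by blast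
      have i: "var h' i = k" "var h' l = lim l" using h'(3) wfc Suc.prems by (auto simp: frame_def)
      let ?t = "step (Op Add i i 20) (step (Const 20 1) t)"
      have "Suc k < 2 ^ w" using Suc.prems(2) lw by simp
      moreover have "1 < (2::nat) ^ w" using const_less[of 1] by simp
      ultimately have relt: "rel ?t (setv i (Suc k) h')"
        using h'(1) i wfc w_pos by (auto simp: rel_def)
      have rest: "runs ?W ?t (1 + r * (time_com c + 3)) ?P"
        by (rule Suc.IH[OF h'(2) _ i(2) relt]) (use Suc.prems(2) in simp)
      show "runs (Seq (Const 20 1) (Op Add i i 20)) t (time_com c + 2 - time_com c)
         (\<lambda>s'. runs ?W s' (1 + r * (time_com c + 3)) ?P)"
        by (rule runs_step_Seq, simp, rule runs_step, simp, rule rest) auto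
    qed auto
    have "test_holds (Less i l) s" using Suc.prems wfc by (auto simp: rel_def)
    then show ?case by (rule runs_While_True[OF _ body]) simp
  qed
  have "rel (step (Const i 0) s) (setv i 0 h)" using Loop.prems wfc by (auto simp: rel_def)
  then have "runs ?W (step (Const i 0) s) (1 + lim l * (time_com c + 3)) ?P"
    using iter[of "lim l" 0 h] Loop.prems by simp
  then show ?case unfolding compile.simps by (intro runs_step_Seq) auto
qed

end

section \<open>Intervals, lowest set bits and first marked nodes\<close>

text \<open>For \<open>0 < x\<close> this is the largest power of two dividing \<open>x\<close>: if
  that is \<open>2 ^ j\<close>, then \<open>xor\<close> of \<open>x\<close> and \<open>x - 1\<close>
  is \<open>2 ^ (j + 1) - 1\<close>. The formula uses only word instructions.\<close>

definition lowbit :: "nat \<Rightarrow> nat" where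
  "lowbit x = Bit_Operations.xor x (x - 1) div 2 + 1"

lemma odd_part: "0 < x \<Longrightarrow> \<exists>j q. x = 2 ^ j * (2 * q + 1)" for x :: nat
proof (induction x rule: less_induct)
  case (less x)
  show ?case
  proof (cases "even x")
    case True
    then obtain y where y: "x = 2 * y" by (elim evenE)
    with less.prems less.IH[of y] obtain j q where "y = 2 ^ j * (2 * q + 1)" by auto
    then have "x = 2 ^ Suc j * (2 * q + 1)" using y by simp
    then show ?thesis by blast
  next
    case False
    then obtain q where "x = 2 ^ 0 * (2 * q + 1)" by (auto elim: oddE)
    then show ?thesis by blast
  qed
qed

lemma lowbit_odd: "lowbit (2 * q + 1) = 1"
proof -
  have "Bit_Operations.xor (2 * q + 1) (2 * q) = (1 :: nat)"
    using xor_nat_rec[of "2 * q + 1" "2 * q"] by simp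
  then show ?thesis by (simp add: lowbit_def)
qed

lemma lowbit_double:
  assumes "0 < y"
  shows "lowbit (2 * y) = 2 * lowbit y"
proof -
  let ?x = "Bit_Operations.xor y (y - 1)"
  have "2 * y - 1 = 2 * (y - 1) + 1" using assms by simp
  then have "Bit_Operations.xor (2 * y) (2 * y - 1) = 2 * ?x + 1"
    by (simp add: xor_nat_rec[of "2 * y"])
  moreover have "odd ?x" using assms by (simp add: even_xor_iff)
  ultimately show ?thesis by (auto simp: lowbit_def elim: oddE)
qed

lemma lowbit_eq: "lowbit (2 ^ j * (2 * q + 1)) = 2 ^ j"
proof (induction j)
  case 0
  then show ?case using lowbit_odd[of q] by simp
next
  case (Suc j)
  have "2 ^ Suc j * (2 * q + 1) = 2 * (2 ^ j * (2 * q + 1))" by (simp only: power_Suc mult.assoc)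
  then show ?case using Suc lowbit_double[of "2 ^ j * (2 * q + 1)"] by simp
qed

lemma lowbit_ge: "0 < k \<Longrightarrow> 2 ^ j \<le> lowbit (2 ^ j * k)"
proof -
  assume "0 < k"
  then obtain i q where "k = 2 ^ i * (2 * q + 1)" using odd_part by blast
  then have "2 ^ j * k = 2 ^ (j + i) * (2 * q + 1)" by (simp add: power_add algebra_simps)
  then show ?thesis using lowbit_eq[of "j + i" q] by (simp add: power_increasing)
qed

lemma lowbit_power: "0 < x \<Longrightarrow> \<exists>j. lowbit x = 2 ^ j \<and> 2 ^ j \<le> x"
  using odd_part[of x] lowbit_eq by fastforce

text \<open>If \<open>2 ^ j\<close> is the maximal power, no multiple of \<open>2 ^ (j + 1)\<close>
  lies in the interval. So the interval fits strictly between two consecutive such multiples, which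
  any member \<open>y\<close> determines, and \<open>x\<close> is their midpoint.\<close>

lemma max_lowbit_unique:
  assumes "0 < a" "a \<le> x" "x \<le> b" "a \<le> y" "y \<le> b"
    and max: "\<And>z. a \<le> z \<Longrightarrow> z \<le> b \<Longrightarrow> lowbit z \<le> lowbit x"
  shows "x = y div (lowbit x * 2) * (lowbit x * 2) + lowbit x"
proof -
  obtain j q where x: "x = 2 ^ j * (2 * q + 1)" using odd_part[of x] assms by auto
  have p: "lowbit x = 2 ^ j" using x lowbit_eq by simp
  have no: False if "a \<le> 2 ^ (j + 1) * k" "2 ^ (j + 1) * k \<le> b" for k
  proof -
    have "0 < k" using that(1) assms(1) by (cases k) auto
    then have "2 ^ (j + 1) \<le> lowbit (2 ^ (j + 1) * k)" by (rule lowbit_ge)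
    also have "\<dots> \<le> 2 ^ j" using max[OF that] p by simp
    finally show False by simp
  qed
  have x2: "x = 2 ^ (j + 1) * q + 2 ^ j" using x by (simp add: algebra_simps)
  have "2 ^ (j + 1) * q \<le> y"
  proof (rule ccontr)
    assume "\<not> 2 ^ (j + 1) * q \<le> y"
    then show False using no[of q] x2 assms(3,4) by linarith
  qed
  moreover have "y < 2 ^ (j + 1) * (q + 1)"
  proof (rule ccontr)
    assume "\<not> y < 2 ^ (j + 1) * (q + 1)"
    moreover have "x \<le> 2 ^ (j + 1) * (q + 1)" using x2 by simp
    ultimately show False using no[of "q + 1"] assms(2,5) by linarith
  qed
  ultimately have "y div 2 ^ (j + 1) = q"
    by (intro div_nat_eqI) (auto simp: algebra_simps)
  then show ?thesis using x2 p by (simp add: mult.commute)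
qed

lemma lowbit_bit:
  assumes "0 < x"
  shows "\<exists>t. lowbit x = 2 ^ t \<and> bit x t \<and> (\<forall>i<t. \<not> bit x i)"
proof -
  obtain j q where x: "x = 2 ^ j * (2 * q + 1)" using odd_part assms by blast
  define z where "z = 2 * q + 1"
  have "x = push_bit j z" by (simp add: x z_def push_bit_eq_mult)
  then have "bit x i \<longleftrightarrow> j \<le> i \<and> bit z (i - j)" for i
    by (simp add: bit_push_bit_iff_nat)
  then show ?thesis using x lowbit_eq by (intro exI[of _ j]) (auto simp: bit_0 z_def)
qed

section \<open>Trees given by parent pointers\<close>

locale parent_tree =
  fixes n r :: nat and pa :: "nat \<Rightarrow> nat" and E :: "(nat \<times> nat) set"
  assumes tree: "rooted_tree {..<n} E r" and pa: "\<And>u v. (u, v) \<in> E \<Longrightarrow> pa v = u"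
begin

lemma root_less: "r < n"
  using tree by (auto simp: rooted_tree_def)

lemma edge_iff: "(u, v) \<in> E \<longleftrightarrow> v < n \<and> v \<noteq> r \<and> u = pa v"
proof
  assume "(u, v) \<in> E"
  then show "v < n \<and> v \<noteq> r \<and> u = pa v" using tree pa by (auto simp: rooted_tree_def)
next
  assume v: "v < n \<and> v \<noteq> r \<and> u = pa v"
  then obtain u' where "(u', v) \<in> E" using tree unfolding rooted_tree_def by blast
  then show "(u, v) \<in> E" using pa v by metis
qed

lemma pa_less: "v < n \<Longrightarrow> v \<noteq> r \<Longrightarrow> pa v < n"
  using tree edge_iff[of "pa v" v] unfolding rooted_tree_def by auto

lemma node_induct [consumes 1, case_names root child]:
  assumes "v < n" and "P r" and "\<And>v. v < n \<Longrightarrow> v \<noteq> r \<Longrightarrow> P (pa v) \<Longrightarrow> P v"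
  shows "P v"
proof -
  have "(r, v) \<in> E\<^sup>*" using tree assms(1) by (auto simp: rooted_tree_def)
  then show ?thesis
    by (induction rule: rtrancl_induct) (use assms(2,3) edge_iff in auto)
qed

text \<open>A cycle through a node enters it from its only parent, so rotating it gives a cycle
  through the parent. Descending from the root, which has no incoming edge, excludes all
  cycles.\<close>

lemma acyclic: "acyclic E"
proof -
  have "(v, v) \<notin> E\<^sup>+" if "v < n" for v
    using that
  proof (induction rule: node_induct)
    case root
    show ?case
    proof
      assume "(r, r) \<in> E\<^sup>+"
      then show False by (cases rule: tranclE) (auto simp: edge_iff)
    qed
  next
    case (child v)
    show ?case
    proof
      assume "(v, v) \<in> E\<^sup>+"
      from tranclD2[OF this] obtain u where u: "(v, u) \<in> E\<^sup>*" "(u, v) \<in> E" by blast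
      have "(u, u) \<in> E\<^sup>+" using rtrancl_into_trancl2[OF u(2,1)] .
      then have "(pa v, pa v) \<in> E\<^sup>+" unfolding pa[OF u(2)] .
      with child show False by simp
    qed
  qed
  moreover have "v < n" if "(v, v) \<in> E\<^sup>+" for v
    using that by (cases rule: tranclE) (auto simp: edge_iff)
  ultimately show ?thesis unfolding acyclic_def by blast
qed

lemma finite_edges: "finite E"
proof (rule finite_subset)
  show "E \<subseteq> {..<n} \<times> {..<n}" using tree by (auto simp: rooted_tree_def)
qed simp

lemma wf_converse: "wf (E\<inverse>)"
  by (rule finite_acyclic_wf_converse[OF finite_edges acyclic])

definition anc :: "nat \<Rightarrow> nat \<Rightarrow> bool" where
  "anc u v \<longleftrightarrow> (u, v) \<in> E\<^sup>*"

lemma anc_refl [simp]: "anc v v"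
  by (simp add: anc_def)

lemma anc_trans: "anc u v \<Longrightarrow> anc v x \<Longrightarrow> anc u x"
  by (simp add: anc_def)

lemma anc_antisym: "anc u v \<Longrightarrow> anc v u \<Longrightarrow> u = v"
  using acyclic_impl_antisym_rtrancl[OF acyclic] by (simp add: anc_def antisym_def)

lemma anc_less: "anc u v \<Longrightarrow> v < n \<Longrightarrow> u < n"
  unfolding anc_def
proof (induction rule: converse_rtrancl_induct)
  case (step u x)
  then show ?case using edge_iff[of u x] pa_less by simp
qed simp

lemma anc_parent: "v < n \<Longrightarrow> v \<noteq> r \<Longrightarrow> anc (pa v) v"
  unfolding anc_def using edge_iff[of "pa v" v] by (simp add: r_into_rtrancl)

lemma anc_rec:
  assumes "v < n"
  shows "anc u v \<longleftrightarrow> u = v \<or> v \<noteq> r \<and> anc u (pa v)"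
proof
  assume "anc u v"
  then show "u = v \<or> v \<noteq> r \<and> anc u (pa v)"
    unfolding anc_def
  proof (cases rule: rtranclE)
    case (step z)
    then have "v \<noteq> r" "z = pa v" using edge_iff[of z v] by simp_all
    then show "u = v \<or> v \<noteq> r \<and> (u, pa v) \<in> E\<^sup>*" using step(1) by simp
  qed simp
next
  assume "u = v \<or> v \<noteq> r \<and> anc u (pa v)"
  then show "anc u v" using anc_trans[OF _ anc_parent[OF assms], of u] anc_refl by metis
qed

lemma anc_root: "v < n \<Longrightarrow> anc r v"
  using tree by (auto simp: rooted_tree_def anc_def)

lemma anc_linear:
  assumes "y < n" "anc u y" "anc x y"
  shows "anc u x \<or> anc x u"
  using assms
proof (induction rule: node_induct)
  case root
  then show ?case using anc_rec[OF root_less] by simp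
next
  case (child v)
  then show ?case using anc_rec[OF child.hyps(1), of u] anc_rec[OF child.hyps(1), of x] by auto
qed

end

section \<open>Interval numberings of a tree\<close>

locale numbered_tree = parent_tree +
  fixes lo sz :: "nat \<Rightarrow> nat"
  assumes lo_root: "lo r = 0" and sz_root: "sz r \<le> n"
    and sz_pos: "\<And>v. v < n \<Longrightarrow> 1 \<le> sz v"
    and nested: "\<And>v. v < n \<Longrightarrow> v \<noteq> r \<Longrightarrow> lo (pa v) < lo v \<and> lo v + sz v \<le> lo (pa v) + sz (pa v)"
    and siblings: "\<And>u v. u < n \<Longrightarrow> v < n \<Longrightarrow> u \<noteq> r \<Longrightarrow> v \<noteq> r \<Longrightarrow> u \<noteq> v \<Longrightarrow> pa u = pa v \<Longrightarrow>
      lo u + sz u \<le> lo v \<or> lo v + sz v \<le> lo u"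
begin

lemma anc_nested: "v < n \<Longrightarrow> anc u v \<Longrightarrow> lo u \<le> lo v \<and> lo v + sz v \<le> lo u + sz u"
proof (induction rule: node_induct)
  case root
  then show ?case using anc_rec[OF root_less] by auto
next
  case (child v)
  then consider "u = v" | "lo u \<le> lo (pa v) \<and> lo (pa v) + sz (pa v) \<le> lo u + sz u"
    using anc_rec[of v u] by blast
  then show ?case using nested[OF child.hyps] by cases auto
qed

lemma strict_anc_lo: "v < n \<Longrightarrow> anc u v \<Longrightarrow> u \<noteq> v \<Longrightarrow> lo u < lo v"
proof -
  assume "v < n" "anc u v" "u \<noteq> v"
  then have v: "v \<noteq> r" "anc u (pa v)" using anc_rec[of v u] by auto
  show "lo u < lo v"
    using anc_nested[OF pa_less v(2)] nested[of v] \<open>v < n\<close> v(1) by linarith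
qed

text \<open>The parent of \<open>u\<close> is either incomparable with \<open>v\<close> as well, or it is a strict ancestor of \<open>v\<close>
  and then the child of it towards \<open>v\<close> is a sibling of \<open>u\<close>.\<close>

lemma incomparable_disjoint:
  assumes "u < n" "v < n" "\<not> anc u v" "\<not> anc v u"
  shows "lo u + sz u \<le> lo v \<or> lo v + sz v \<le> lo u"
  using assms
proof (induction u rule: node_induct)
  case root
  then show ?case using anc_root by blast
next
  case (child u)
  show ?case
  proof (cases "anc (pa u) v")
    case True
    have "pa u \<noteq> v" using child.hyps child.prems anc_parent by blast
    then have "(pa u, v) \<in> E\<^sup>+" using True by (auto simp: anc_def rtrancl_eq_or_trancl)
    then obtain c where c: "(pa u, c) \<in> E" "(c, v) \<in> E\<^sup>*" by (blast dest: tranclD)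
    then have "c < n" "c \<noteq> r" "pa c = pa u" "anc c v" using edge_iff by (auto simp: anc_def)
    moreover have "u \<noteq> c" using child.prems \<open>anc c v\<close> by auto
    ultimately have "lo u + sz u \<le> lo c \<or> lo c + sz c \<le> lo u"
      using siblings[of u c] child.hyps by simp
    then show ?thesis using anc_nested[OF \<open>v < n\<close> \<open>anc c v\<close>] by linarith
  next
    case False
    moreover have "\<not> anc v (pa u)" using child.hyps child.prems anc_rec[of u v] by blast
    ultimately have "lo (pa u) + sz (pa u) \<le> lo v \<or> lo v + sz v \<le> lo (pa u)"
      using child by blast
    then show ?thesis using nested[of u] child.hyps by linarith
  qed
qed

text \<open>This is the constant-time ancestor test of the queries. Overlapping intervals exclude
  incomparable nodes, and numbers increase strictly towards descendants, which fixes the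
  direction.\<close>

lemma anc_iff:
  assumes "u < n" "v < n"
  shows "anc u v \<longleftrightarrow> lo u \<le> lo v \<and> lo v < lo u + sz u"
proof
  assume "anc u v"
  then show "lo u \<le> lo v \<and> lo v < lo u + sz u" using anc_nested[of v u] sz_pos[of v] assms by auto
next
  assume *: "lo u \<le> lo v \<and> lo v < lo u + sz u"
  then have "anc u v \<or> anc v u"
    using incomparable_disjoint[OF assms] sz_pos[of v] assms by fastforce
  then show "anc u v" using strict_anc_lo[of u v] assms * by fastforce
qed

lemma lo_less: "v < n \<Longrightarrow> lo v < n"
  using anc_nested[OF _ anc_root, of v] sz_pos[of v] lo_root sz_root by fastforce

lemma lo_inj: "inj_on lo {..<n}"
proof (rule inj_onI)
  fix u v assume "u \<in> {..<n}" "v \<in> {..<n}" "lo u = lo v"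
  then show "u = v" using anc_iff[of u v] anc_iff[of v u] sz_pos[of u] sz_pos[of v] anc_antisym by fastforce
qed

text \<open>Only nesting and disjointness of intervals are assumed; that all numbers below
  \<open>n\<close> occur follows by counting, as an injective map of a finite set into itself is
  onto.\<close>

lemma lo_surj: "lo ` {..<n} = {..<n}"
  using lo_inj lo_less by (intro endo_inj_surj) auto

text \<open>It turns a maximum over descendants into one over all numbers of the interval, the form
  that \<open>max_lowbit_unique\<close> demands.\<close>

lemma interval_descendant: "v < n \<Longrightarrow> lo v \<le> a \<Longrightarrow> a < lo v + sz v \<Longrightarrow> \<exists>d<n. anc v d \<and> lo d = a"
proof -
  assume *: "v < n" "lo v \<le> a" "a < lo v + sz v"
  then have "a < n" using anc_nested[OF _ anc_root, of v] lo_root sz_root by fastforce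
  then obtain d where "d < n" "lo d = a" using lo_surj by (metis imageE lessThan_iff)
  then show ?thesis using anc_iff[of v d] * by auto
qed

end

section \<open>Classes of nodes with equal \<open>inl\<close>\<close>

locale labeled_numbering = numbered_tree +
  fixes inl :: "nat \<Rightarrow> nat"
  assumes inl_mem: "\<And>v. v < n \<Longrightarrow> \<exists>d<n. anc v d \<and> inl v = lo d + 1"
    and inl_max: "\<And>v d. v < n \<Longrightarrow> d < n \<Longrightarrow> anc v d \<Longrightarrow> lowbit (lo d + 1) \<le> lowbit (inl v)"
begin

lemma inl_interval: "v < n \<Longrightarrow> lo v < inl v \<and> inl v \<le> lo v + sz v"
  using inl_mem[of v] anc_iff by force

lemma inl_le: "v < n \<Longrightarrow> inl v \<le> n"
  using inl_mem[of v] lo_less by force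

text \<open>Both \<open>inl u\<close> and \<open>inl v\<close> lie in the interval of
  \<open>u\<close>, where \<open>inl u\<close> attains the maximal power of two, so
  \<open>max_lowbit_unique\<close> applies. A query uses this to recover the class of an ancestor
  from \<open>inl v\<close> and the power alone.\<close>

lemma inl_unique:
  assumes "v < n" "anc u v"
  shows "inl u = inl v div (lowbit (inl u) * 2) * (lowbit (inl u) * 2) + lowbit (inl u)"
proof (rule max_lowbit_unique[of "lo u + 1" _ "lo u + sz u"])
  have u: "u < n" using assms anc_less by blast
  then show "lo u + 1 \<le> inl u" "inl u \<le> lo u + sz u" using inl_interval[of u] by auto
  show "lo u + 1 \<le> inl v" "inl v \<le> lo u + sz u"
    using inl_interval[of v] anc_nested[OF assms] assms(1) by auto
  show "lowbit z \<le> lowbit (inl u)" if "lo u + 1 \<le> z" "z \<le> lo u + sz u" for z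
    using interval_descendant[of u "z - 1"] inl_max[of u] that u by force
qed simp

lemma lowbit_inl_mono: "v < n \<Longrightarrow> anc u v \<Longrightarrow> lowbit (inl v) \<le> lowbit (inl u)"
  using inl_mem[of v] inl_max[of u] anc_less anc_trans by metis

text \<open>By \<open>inl_unique\<close>, both values arise from \<open>inl v\<close> by a formula
  that depends only on the power of two.\<close>

lemma same_lowbit: "v < n \<Longrightarrow> anc u v \<Longrightarrow> lowbit (inl u) = lowbit (inl v) \<Longrightarrow> inl u = inl v"
  using inl_unique[of v u] inl_unique[of v v] by simp

text \<open>The common value lies in both intervals, so they are not disjoint. Hence a class is a
  chain.\<close>

lemma same_inl_comparable:
  assumes "u < n" "v < n" "inl u = inl v"
  shows "anc u v \<or> anc v u"
  using incomparable_disjoint[OF assms(1,2)] inl_interval[OF assms(1)] inl_interval[OF assms(2)] assms(3)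
  by linarith

lemma lowbit_inl_power: "v < n \<Longrightarrow> \<exists>j. lowbit (inl v) = 2 ^ j \<and> 2 ^ j \<le> n"
  using lowbit_power[of "inl v"] inl_interval[of v] inl_le[of v] by fastforce

definition first_marked :: "(nat \<Rightarrow> bool) \<Rightarrow> nat \<Rightarrow> nat \<Rightarrow> nat \<Rightarrow> bool" where
  "first_marked mk x y f \<longleftrightarrow> f < n \<and> mk f \<and> anc x f \<and> f \<noteq> x \<and> anc f y \<and>
     (\<forall>z<n. mk z \<and> anc x z \<and> z \<noteq> x \<and> anc z y \<longrightarrow> anc f z)"

definition none_marked :: "(nat \<Rightarrow> bool) \<Rightarrow> nat \<Rightarrow> nat \<Rightarrow> bool" where
  "none_marked mk x y \<longleftrightarrow> (\<forall>z<n. mk z \<and> anc x z \<and> z \<noteq> x \<and> anc z y \<longrightarrow> False)"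

text \<open>The value \<open>n\<close> says that there is no such node. The candidates form a chain,
  so the nearest one is characterised as an ancestor of all others.\<close>

definition next_spec :: "(nat \<Rightarrow> bool) \<Rightarrow> (nat \<Rightarrow> nat) \<Rightarrow> nat \<Rightarrow> bool" where
  "next_spec mk nx v \<longleftrightarrow>
     nx v = n \<and> (\<forall>z<n. mk z \<and> anc v z \<and> z \<noteq> v \<longrightarrow> inl z \<noteq> inl v) \<or>
     nx v < n \<and> mk (nx v) \<and> anc v (nx v) \<and> nx v \<noteq> v \<and> inl (nx v) = inl v \<and>
       (\<forall>z<n. mk z \<and> anc v z \<and> z \<noteq> v \<and> inl z = inl v \<longrightarrow> anc (nx v) z)"

definition head_spec :: "(nat \<Rightarrow> bool) \<Rightarrow> (nat \<Rightarrow> nat) \<Rightarrow> nat \<Rightarrow> bool" where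
  "head_spec mk hm z \<longleftrightarrow> (mk z \<longrightarrow> hm (inl z - 1) < n \<and> mk (hm (inl z - 1)) \<and>
     inl (hm (inl z - 1)) = inl z \<and> anc (hm (inl z - 1)) z)"

text \<open>The mask of \<open>v\<close> has one bit for each value of \<open>lowbit (inl z)\<close> taken by a marked ancestor
  \<open>z\<close>, the larger values at the lower positions.\<close>

definition mask_spec :: "nat \<Rightarrow> (nat \<Rightarrow> bool) \<Rightarrow> nat \<Rightarrow> nat \<Rightarrow> bool" where
  "mask_spec w mk v A \<longleftrightarrow> (\<forall>k. bit A k \<longleftrightarrow> (\<exists>z<n. mk z \<and> anc z v \<and> 2 ^ (w - 1) div lowbit (inl z) = 2 ^ k))"

text \<open>A node between \<open>x\<close> and \<open>nx x\<close> belongs to the class of both,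
  because its power of two is squeezed between equal values. So a marked node before
  \<open>nx x\<close> would contradict the choice of \<open>nx x\<close>.\<close>

lemma first_marked_chain:
  assumes "x < n" "y < n" "next_spec mk nx x" "nx x < n" "anc (nx x) y"
  shows "first_marked mk x y (nx x)"
  unfolding first_marked_def
proof (intro conjI allI impI)
  fix z assume z: "z < n" "mk z \<and> anc x z \<and> z \<noteq> x \<and> anc z y"
  have nx: "mk (nx x)" "anc x (nx x)" "nx x \<noteq> x" "inl (nx x) = inl x"
    "\<And>z. z < n \<Longrightarrow> mk z \<Longrightarrow> anc x z \<Longrightarrow> z \<noteq> x \<Longrightarrow> inl z = inl x \<Longrightarrow> anc (nx x) z"
    using assms(3,4) by (auto simp: next_spec_def)
  from anc_linear[OF assms(2), of z "nx x"] z assms(5)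
  consider "anc z (nx x)" | "anc (nx x) z" by blast
  then show "anc (nx x) z"
  proof cases
    case 1
    have "lowbit (inl x) \<le> lowbit (inl z)" using lowbit_inl_mono[OF assms(4) 1] nx(4) by simp
    then have "lowbit (inl x) = lowbit (inl z)" using lowbit_inl_mono[OF z(1), of x] z(2) by simp
    then have "inl x = inl z" using same_lowbit[OF z(1), of x] z(2) by blast
    then show ?thesis using nx(5) z by simp
  qed
qed (use assms in \<open>auto simp: next_spec_def\<close>)

text \<open>The next marked node of the class is an ancestor of all later ones; if it misses the
  path to \<open>y\<close>, so do they.\<close>

lemma chain_unmarked:
  assumes "y < n" "next_spec mk nx x" "\<not> (nx x < n \<and> anc (nx x) y)"
    and "z < n" "mk z" "anc x z" "z \<noteq> x" "anc z y"
  shows "inl z \<noteq> inl x"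
proof
  assume "inl z = inl x"
  then have "nx x < n \<and> anc (nx x) z" using assms by (auto simp: next_spec_def)
  then show False using assms(3,8) anc_trans by blast
qed

text \<open>The two divisions shift out the bits of all powers that are at least
  \<open>lowbit (inl x)\<close>. The marked nodes that remain visible have a smaller power, so those
  at or above \<open>x\<close> disappear by monotonicity.\<close>

lemma mask_quotient:
  assumes "n < 2 ^ w" "x < n" "mask_spec w mk y A"
  shows "bit (A div (2 ^ (w - 1) div lowbit (inl x)) div 2) t \<longleftrightarrow>
    (\<exists>z<n. mk z \<and> anc z y \<and> lowbit (inl z) * 2 ^ (t + 1) = lowbit (inl x))"
proof -
  have lb: "\<exists>j\<le>w - 1. lowbit (inl v) = 2 ^ j" if v: "v < n" for v
  proof -
    obtain j where j: "lowbit (inl v) = 2 ^ j" "2 ^ j \<le> n" using lowbit_inl_power[OF v] by blast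
    have "(2::nat) ^ j < 2 ^ w" using j(2) assms(1) by (rule le_less_trans)
    then have "j < w" by (rule power_less_imp_less_exp[rotated]) simp
    then show ?thesis using j by auto
  qed
  obtain h where h: "h \<le> w - 1" "lowbit (inl x) = 2 ^ h" using lb[OF assms(2)] by blast
  have top: "2 ^ (w - 1) div (2::nat) ^ j = 2 ^ (w - 1 - j)" if "j \<le> w - 1" for j
    by (rule power_diff[symmetric]) (use that in auto)
  have "A div (2 ^ (w - 1) div lowbit (inl x)) div 2 = A div 2 ^ (w - 1 - h + 1)"
    using h top by (simp add: div_mult2_eq[symmetric] mult.commute)
  then have "bit (A div (2 ^ (w - 1) div lowbit (inl x)) div 2) t \<longleftrightarrow> bit A (w - 1 - h + 1 + t)"
    by (simp add: bit_iff_odd div_mult2_eq[symmetric] power_add mult.assoc)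
  also have "\<dots> \<longleftrightarrow> (\<exists>z<n. mk z \<and> anc z y \<and> 2 ^ (w - 1) div lowbit (inl z) = 2 ^ (w - 1 - h + 1 + t))"
    using assms(3) by (simp add: mask_spec_def)
  also have "\<dots> \<longleftrightarrow> (\<exists>z<n. mk z \<and> anc z y \<and> lowbit (inl z) * 2 ^ (t + 1) = lowbit (inl x))"
  proof -
    have "2 ^ (w - 1) div lowbit (inl z) = 2 ^ (w - 1 - h + 1 + t) \<longleftrightarrow>
        lowbit (inl z) * 2 ^ (t + 1) = lowbit (inl x)" if zn: "z < n" for z
    proof -
      obtain j where j: "j \<le> w - 1" "lowbit (inl z) = 2 ^ j" using lb[OF zn] by blast
      have "2 ^ (w - 1) div lowbit (inl z) = 2 ^ (w - 1 - h + 1 + t) \<longleftrightarrow> w - 1 - j = w - 1 - h + 1 + t"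
        unfolding j(2) top[OF j(1)] by (rule power_inject_exp) simp
      also have "\<dots> \<longleftrightarrow> j + (t + 1) = h" using j h by linarith
      also have "\<dots> \<longleftrightarrow> (2::nat) ^ (j + (t + 1)) = 2 ^ h" by (rule power_inject_exp[symmetric]) simp
      also have "\<dots> \<longleftrightarrow> lowbit (inl z) * 2 ^ (t + 1) = lowbit (inl x)"
        unfolding j(2) h(2) by (simp only: power_add)
      finally show ?thesis .
    qed
    then show ?thesis by blast
  qed
  finally show ?thesis .
qed

lemma mask_less: "n < 2 ^ w \<Longrightarrow> 1 \<le> w \<Longrightarrow> mask_spec w mk v A \<Longrightarrow> A < 2 ^ w"
proof -
  assume w: "n < 2 ^ w" "1 \<le> w" and A: "mask_spec w mk v A"
  have "k < w" if k: "bit A k" for k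
  proof -
    obtain z where "(2::nat) ^ k = 2 ^ (w - 1) div lowbit (inl z)"
      using A k unfolding mask_spec_def by metis
    then have "(2::nat) ^ k \<le> 2 ^ (w - 1)" by simp
    then have "k \<le> w - 1" by (rule power_le_imp_le_exp[rotated]) simp
    then show ?thesis using w by simp
  qed
  then have "take_bit w A = A" by (auto intro!: bit_eqI simp: bit_take_bit_iff)
  then show ?thesis by (simp add: take_bit_nat_eq_self_iff)
qed

text \<open>Powers decrease along the path, so the lowest set bit of \<open>Q\<close> belongs to the
  first class after that of \<open>x\<close> with a marked node on the path. \<open>p\<close> is its
  power of two, \<open>I\<close> its \<open>inl\<close> value as recovered by
  \<open>inl_unique\<close>, and the topmost marked node of the class is the answer.\<close>

lemma first_marked_below:
  fixes w A x y :: nat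
  defines "Q \<equiv> A div (2 ^ (w - 1) div lowbit (inl x)) div 2"
  defines "p \<equiv> lowbit (inl x) div 2 div lowbit Q"
  defines "I \<equiv> inl y div (p * 2) * (p * 2) + p"
  assumes n: "n < 2 ^ w" and xy: "y < n" "anc x y" and A: "mask_spec w mk y A"
    and chain: "\<And>z. z < n \<Longrightarrow> mk z \<Longrightarrow> anc x z \<Longrightarrow> z \<noteq> x \<Longrightarrow> anc z y \<Longrightarrow> inl z \<noteq> inl x"
    and hm: "\<And>z. z < n \<Longrightarrow> head_spec mk hm z"
  shows "Q = 0 \<Longrightarrow> none_marked mk x y"
    and "Q \<noteq> 0 \<Longrightarrow> first_marked mk x y (hm (I - 1)) \<and> 1 \<le> p \<and> p * 2 \<le> n \<and> 1 \<le> I \<and> I \<le> n"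
proof -
  have x: "x < n" using xy anc_less by blast
  have bitQ: "bit Q t \<longleftrightarrow> (\<exists>z<n. mk z \<and> anc z y \<and> lowbit (inl z) * 2 ^ (t + 1) = lowbit (inl x))" for t
    unfolding Q_def by (rule mask_quotient[OF n x A])
  have below: "\<exists>t. bit Q t \<and> lowbit (inl z) * 2 ^ (t + 1) = lowbit (inl x)"
    if z: "z < n" "mk z" "anc x z" "z \<noteq> x" "anc z y" for z
  proof -
    have "lowbit (inl z) \<noteq> lowbit (inl x)" using chain[OF z] same_lowbit[OF z(1,3)] by metis
    moreover have "lowbit (inl z) \<le> lowbit (inl x)" using lowbit_inl_mono[OF z(1,3)] .
    moreover obtain i j where ij: "lowbit (inl z) = 2 ^ i" "lowbit (inl x) = 2 ^ j"
      using lowbit_inl_power z(1) x by metis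
    ultimately have "(2::nat) ^ i < 2 ^ j" by simp
    then have "i < j" by (rule power_less_imp_less_exp[rotated]) simp
    then obtain t where "j = i + (t + 1)" using less_imp_add_positive by (metis Suc_eq_plus1 Suc_pred)
    then have "lowbit (inl z) * 2 ^ (t + 1) = lowbit (inl x)" using ij by (simp only: power_add)
    then show ?thesis using bitQ z by blast
  qed
  show "none_marked mk x y" if "Q = 0"
    unfolding none_marked_def using below that by fastforce
  show "first_marked mk x y (hm (I - 1)) \<and> 1 \<le> p \<and> p * 2 \<le> n \<and> 1 \<le> I \<and> I \<le> n" if "Q \<noteq> 0"
  proof -
    obtain t where t: "lowbit Q = 2 ^ t" "bit Q t" "\<And>i. i < t \<Longrightarrow> \<not> bit Q i"
      using lowbit_bit[of Q] \<open>Q \<noteq> 0\<close> by auto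
    then obtain z where z: "z < n" "mk z" "anc z y" "lowbit (inl z) * 2 ^ (t + 1) = lowbit (inl x)"
      using bitQ by blast
    have lbx: "lowbit (inl x) = lowbit (inl z) * 2 ^ t * 2" using z(4) by simp
    have p: "p = lowbit (inl z)" unfolding p_def t(1) lbx by simp
    obtain i where i: "lowbit (inl z) = 2 ^ i" using lowbit_inl_power[OF z(1)] by blast
    have "lowbit (inl z) * 2 * 1 \<le> lowbit (inl z) * 2 * 2 ^ t" by (intro mult_le_mono2) simp
    then have "p * 2 \<le> lowbit (inl x)" using lbx p by (simp add: mult.commute mult.left_commute)
    moreover have "lowbit (inl x) \<le> n" using lowbit_inl_power[OF x] by auto
    ultimately have p2: "p * 2 \<le> n" by simp
    have I: "I = inl z" using inl_unique[OF xy(1) z(3)] unfolding I_def p by simp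
    let ?g = "hm (I - 1)"
    have g: "?g < n" "mk ?g" "inl ?g = inl z" "anc ?g z"
      using hm[OF z(1)] z(2) unfolding head_spec_def I by auto
    have gy: "anc ?g y" using g(4) z(3) by (rule anc_trans)
    have less: "lowbit (inl ?g) < lowbit (inl x)"
      unfolding g(3) z(4)[symmetric] i using one_less_power[of "2::nat" "t + 1"] by (simp del: power_add power_Suc)
    \<comment> \<open>The topmost marked node of the whole class cannot lie above \<open>x\<close>,
      since its power is smaller; as an ancestor of \<open>y\<close> it is comparable with
      \<open>x\<close>, hence strictly below.\<close>
    have "\<not> anc ?g x" using lowbit_inl_mono[OF x, of ?g] less by auto
    then have xg: "anc x ?g" "?g \<noteq> x" using anc_linear[OF xy(1) gy xy(2)] by auto
    have "anc ?g u" if u: "u < n" "mk u \<and> anc x u \<and> u \<noteq> x \<and> anc u y" for u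
    proof -
      obtain t' where t': "bit Q t'" "lowbit (inl u) * 2 ^ (t' + 1) = lowbit (inl x)"
        using below[of u] u by blast
      have "t \<le> t'" using t(3) t'(1) by (meson not_le)
      have "lowbit (inl u) * 2 ^ (t + 1) \<le> lowbit (inl u) * 2 ^ (t' + 1)"
        using \<open>t \<le> t'\<close> by (intro mult_le_mono2 power_increasing) auto
      also have "\<dots> = lowbit (inl z) * 2 ^ (t + 1)" using t'(2) z(4) by simp
      finally have le: "lowbit (inl u) \<le> lowbit (inl z)" by simp
      from anc_linear[OF xy(1) gy, of u] u consider "anc ?g u" | "anc u ?g" by blast
      then show ?thesis
      proof cases
        case 2
        then have "lowbit (inl ?g) \<le> lowbit (inl u)" using lowbit_inl_mono[OF g(1)] by blast
        then have "lowbit (inl u) = lowbit (inl ?g)" using le g(3) by simp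
        then have "inl u = inl z" using same_lowbit[OF g(1) 2] g(3) by simp
        then show ?thesis using hm[OF u(1)] u(2) unfolding head_spec_def I by simp
      qed
    qed
    then have "first_marked mk x y ?g"
      unfolding first_marked_def using g xg gy by blast
    moreover have "1 \<le> p" using p i by simp
    moreover have "1 \<le> I" "I \<le> n" using I inl_interval[OF z(1)] inl_le[OF z(1)] by auto
    ultimately show ?thesis using p2 by blast
  qed
qed

end

section \<open>Invariants of the preprocessing loops\<close>

context parent_tree
begin

section \<open>Ordering the nodes by peeling leaves\<close>

definition children :: "nat \<Rightarrow> nat set" where
  "children u = {c. c < n \<and> c \<noteq> r \<and> pa c = u}"

lemma finite_children [simp]: "finite (children u)"
  by (rule finite_subset[of _ "{..<n}"]) (auto simp: children_def)

text \<open>The queue \<open>Q\<close> of the leaf-peeling loop holds \<open>t\<close> nodes, of which the first \<open>k\<close> have been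
  removed from the tree; \<open>dg\<close> counts remaining children.\<close>

definition peeling :: "nat \<Rightarrow> nat \<Rightarrow> (nat \<Rightarrow> nat) \<Rightarrow> (nat \<Rightarrow> nat) \<Rightarrow> bool" where
  "peeling k t Q dg \<longleftrightarrow> k \<le> t \<and> t \<le> n \<and> inj_on Q {..<t} \<and> Q ` {..<t} = {u. u < n \<and> dg u = 0} \<and>
     (\<forall>u<n. dg u = card (children u - Q ` {..<k})) \<and> (\<forall>j<k. children (Q j) \<subseteq> Q ` {..<j})"

definition topological :: "(nat \<Rightarrow> nat) \<Rightarrow> bool" where
  "topological Q \<longleftrightarrow> bij_betw Q {..<n} {..<n} \<and> (\<forall>j<n. children (Q j) \<subseteq> Q ` {..<j})"

text \<open>Were the queue exhausted early, a lowest remaining node would have no remaining child,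
  so its counter would be zero and it would be in the queue.\<close>

lemma peeling_progress:
  assumes "peeling k t Q dg" "k < n"
  shows "k < t"
proof (rule ccontr)
  assume "\<not> k < t"
  then have k: "k = t" using assms(1) by (auto simp: peeling_def)
  have "inj_on Q {..<k}" using assms(1) k by (simp add: peeling_def)
  then have "card (Q ` {..<k}) = k" by (simp add: card_image)
  then have "Q ` {..<k} \<noteq> {..<n}" using assms(2) by auto
  moreover have "Q ` {..<k} \<subseteq> {..<n}" using assms(1) k by (auto simp: peeling_def)
  ultimately obtain v where "v \<in> {..<n} - Q ` {..<k}" by blast
  with wfE_min[OF wf_converse, of v "{..<n} - Q ` {..<k}"]
  obtain u where u: "u < n" "u \<notin> Q ` {..<k}"
    and min: "\<And>c. (c, u) \<in> E\<inverse> \<Longrightarrow> c \<notin> {..<n} - Q ` {..<k}" by (metis DiffD1 DiffD2 lessThan_iff)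
  have "children u - Q ` {..<k} = {}"
  proof -
    have "c \<in> Q ` {..<k}" if "c \<in> children u" for c
      using min[of c] that edge_iff[of u c] by (auto simp: children_def)
    then show ?thesis by blast
  qed
  then have "dg u = 0" using assms(1) u(1) unfolding peeling_def by (metis card.empty)
  then have "u \<in> Q ` {..<t}" using assms(1) u(1) by (auto simp: peeling_def)
  then show False using u(2) k by simp
qed

lemma peeling_node:
  assumes "peeling k t Q dg" "k < n"
  shows "Q k < n" and "children (Q k) \<subseteq> Q ` {..<k}" and "Q k \<notin> Q ` {..<k}"
proof -
  have k: "k < t" by (rule peeling_progress[OF assms])
  then have "Q k \<in> {u. u < n \<and> dg u = 0}" using assms(1) unfolding peeling_def by blast
  then show "Q k < n" by simp
  then have "card (children (Q k) - Q ` {..<k}) = 0"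
    using assms(1) \<open>Q k \<in> _\<close> unfolding peeling_def by auto
  then show "children (Q k) \<subseteq> Q ` {..<k}" by (simp add: card_eq_0_iff)
  have "inj_on Q {..<t}" using assms(1) by (simp add: peeling_def)
  then show "Q k \<notin> Q ` {..<k}" using k by (auto dest!: inj_onD)
qed

lemma peeling_children_Suc:
  "children u - Q ` {..<Suc k} = (children u - Q ` {..<k}) - {Q k}"
  by (auto simp: lessThan_Suc)

lemma peeling_root:
  assumes "peeling k t Q dg" "k < n" "Q k = r"
  shows "peeling (Suc k) t Q dg"
proof -
  have "children u - Q ` {..<Suc k} = children u - Q ` {..<k}" for u
    unfolding peeling_children_Suc using assms(3) by (auto simp: children_def)
  then show ?thesis
    using assms(1) peeling_progress[OF assms(1,2)] peeling_node(2)[OF assms(1,2)]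
    by (auto simp: peeling_def less_Suc_eq)
qed

text \<open>Removing \<open>Q k\<close> changes only the counter of its parent, which is appended at
  the moment this counter drops to zero.\<close>

lemma peeling_step:
  assumes p: "peeling k t Q dg" "k < n" "Q k \<noteq> r"
  defines "u \<equiv> pa (Q k)"
  shows "u < n" "1 \<le> dg u" "dg u \<le> n"
    and "dg u \<noteq> 1 \<Longrightarrow> peeling (Suc k) t Q (dg(u := dg u - 1))"
    and "dg u = 1 \<Longrightarrow> t < n \<and> peeling (Suc k) (Suc t) (Q(t := u)) (dg(u := dg u - 1))"
proof -
  note node = peeling_node[OF p(1,2)]
  have k: "k < t" by (rule peeling_progress[OF p(1,2)])
  show u: "u < n" unfolding u_def using node(1) p(3) by (rule pa_less)
  have mem: "Q k \<in> children u - Q ` {..<k}" using node p(3) by (auto simp: children_def u_def)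
  have other: "Q k \<notin> children v" if "v \<noteq> u" for v using that by (auto simp: children_def u_def)
  have dg: "dg v = card (children v - Q ` {..<k})" if "v < n" for v
    using p(1) that by (auto simp: peeling_def)
  have "children u - Q ` {..<k} \<noteq> {}" using mem by blast
  then show pos: "1 \<le> dg u" using dg[OF u] card_gt_0_iff[of "children u - Q ` {..<k}"] by simp
  have "card (children u - Q ` {..<k}) \<le> card {..<n}" by (rule card_mono) (auto simp: children_def)
  then show "dg u \<le> n" using dg[OF u] by simp
  let ?dg = "dg(u := dg u - 1)"
  have dg': "?dg v = card (children v - Q ` {..<Suc k})" if "v < n" for v
    unfolding peeling_children_Suc using dg[OF that] mem other[of v] by auto
  have top: "\<forall>j<Suc k. children (Q j) \<subseteq> Q ` {..<j}"
    using p(1) node(2) by (auto simp: peeling_def less_Suc_eq)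
  have img: "Q ` {..<t} = {v. v < n \<and> dg v = 0}" and inj: "inj_on Q {..<t}" and tn: "t \<le> n"
    using p(1) by (auto simp: peeling_def)
  show "peeling (Suc k) t Q ?dg" if "dg u \<noteq> 1"
    unfolding peeling_def using k tn inj img dg' top pos that by auto
  assume one: "dg u = 1"
  have notin: "u \<notin> Q ` {..<t}" using img one by auto
  \<comment> \<open>Queue entries are distinct nodes even after adding \<open>u\<close>, so the
    queue has room for it.\<close>
  have "card (insert u (Q ` {..<t})) \<le> card {..<n}" using img u by (intro card_mono) auto
  then have tn': "t < n" using notin inj by (simp add: card_image)
  have img': "(Q(t := u)) ` {..<Suc t} = {v. v < n \<and> ?dg v = 0}"
  proof -
    have "(Q(t := u)) ` {..<Suc t} = insert u (Q ` {..<t})" by (auto simp: lessThan_Suc)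
    then show ?thesis using img one u by auto
  qed
  have inj': "inj_on (Q(t := u)) {..<Suc t}"
    using inj notin by (auto simp: inj_on_def lessThan_Suc)
  have same: "(Q(t := u)) ` {..<j} = Q ` {..<j}" if "j \<le> t" for j using that by auto
  have "\<forall>v<n. ?dg v = card (children v - (Q(t := u)) ` {..<Suc k})"
    using dg' same[of "Suc k"] k by simp
  moreover have "\<forall>j<Suc k. children ((Q(t := u)) j) \<subseteq> (Q(t := u)) ` {..<j}"
    using top same k by (metis (no_types, lifting) fun_upd_other less_Suc_eq less_trans order.strict_implies_order order_less_irrefl)
  ultimately show "t < n \<and> peeling (Suc k) (Suc t) (Q(t := u)) ?dg"
    unfolding peeling_def using k tn' inj' img' by (auto simp del: fun_upd_apply)
qed

lemma peeling_topological:
  assumes "peeling n t Q dg"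
  shows "topological Q"
proof -
  have t: "t = n" and inj: "inj_on Q {..<n}" using assms by (auto simp: peeling_def)
  have "Q ` {..<n} \<subseteq> {..<n}" using assms t unfolding peeling_def by blast
  with inj have "bij_betw Q {..<n} {..<n}" by (simp add: bij_betw_def endo_inj_surj)
  then show ?thesis using assms by (auto simp: topological_def peeling_def)
qed

section \<open>Processing the order upwards and downwards\<close>

definition below :: "(nat \<Rightarrow> nat) \<Rightarrow> nat \<Rightarrow> nat set" where
  "below Q k = Q ` {..<k}"

text \<open>For a topological \<open>Q\<close> these are the last \<open>k\<close> nodes of the
  order, the ones already visited when it is read backwards.\<close>

definition above :: "(nat \<Rightarrow> nat) \<Rightarrow> nat \<Rightarrow> nat set" where
  "above Q k = {..<n} - Q ` {..<n - k}"

lemma below_0 [simp]: "below Q 0 = {}" and below_Suc: "below Q (Suc k) = insert (Q k) (below Q k)"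
  by (auto simp: below_def lessThan_Suc)

lemma below_n: "topological Q \<Longrightarrow> below Q n = {..<n}"
  by (auto simp: topological_def below_def bij_betw_def)

lemma topological_node:
  assumes "topological Q" "k < n"
  shows "Q k < n" "Q k \<notin> below Q k" "children (Q k) \<subseteq> below Q k"
    "Q k \<noteq> r \<Longrightarrow> pa (Q k) < n" "Q k \<noteq> r \<Longrightarrow> pa (Q k) \<notin> below Q (Suc k)"
    "Q k \<noteq> r \<Longrightarrow> pa (Q k) \<noteq> Q k"
proof -
  have inj: "inj_on Q {..<n}" and img: "Q ` {..<n} = {..<n}"
    and ch: "\<And>j. j < n \<Longrightarrow> children (Q j) \<subseteq> Q ` {..<j}"
    using assms(1) by (auto simp: topological_def bij_betw_def)
  show v: "Q k < n" using img assms(2) by blast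
  have notin: "Q j \<notin> below Q i" if "j < n" "i \<le> j" for i j
    using inj that by (auto simp: below_def dest!: inj_onD)
  then show "Q k \<notin> below Q k" using assms(2) by blast
  show "children (Q k) \<subseteq> below Q k" using ch assms(2) by (simp add: below_def)
  assume r: "Q k \<noteq> r"
  then show pn: "pa (Q k) < n" using v pa_less by blast
  then obtain j where j: "j < n" "pa (Q k) = Q j" using img by (metis imageE lessThan_iff)
  then have "Q k \<in> below Q j" using ch[OF j(1)] v r by (auto simp: children_def below_def)
  then have "k < j" using notin[OF assms(2), of j] by (meson not_le)
  then show par: "pa (Q k) \<notin> below Q (Suc k)" using j notin[of j "Suc k"] by simp
  then show "pa (Q k) \<noteq> Q k" by (auto simp: below_Suc)
qed

lemma below_closed:
  assumes "topological Q" "k \<le> n" "v \<in> below Q k"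
  shows "z < n \<Longrightarrow> anc v z \<Longrightarrow> z \<in> below Q k"
proof (induction z rule: node_induct)
  case root
  then show ?case using anc_rec[OF root_less, of v] assms(3) by simp
next
  case (child z)
  show ?case
  proof (cases "v = z")
    case True
    then show ?thesis using assms(3) by simp
  next
    case False
    then have "pa z \<in> below Q k" using child anc_rec[of z v] by simp
    then obtain j where j: "j < k" "pa z = Q j" by (auto simp: below_def)
    then have "z \<in> children (Q j)" using child.hyps by (simp add: children_def)
    then have "z \<in> below Q j" using topological_node(3)[OF assms(1), of j] j(1) assms(2) by (simp add: subset_iff)
    then show ?thesis using j(1) by (auto simp: below_def)
  qed
qed

lemma above_0 [simp]: "topological Q \<Longrightarrow> above Q 0 = {}"
  using below_n[of Q] by (auto simp: above_def below_def)

lemma above_n [simp]: "above Q n = {..<n}"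
  by (auto simp: above_def)

lemma above_node:
  assumes "topological Q" "k < n"
  defines "v \<equiv> Q (n - 1 - k)"
  shows "v < n" "above Q (Suc k) = insert v (above Q k)" "v \<notin> above Q k"
    "v \<noteq> r \<Longrightarrow> pa v \<in> above Q k" "children v \<inter> above Q (Suc k) = {}" "above Q k \<subseteq> {..<n}"
proof -
  obtain j where j: "j < n" "n - k = Suc j" "n - Suc k = j" "n - 1 - k = j" using assms(2) by force
  have v_eq: "v = Q j" by (simp only: v_def j(4))
  note node = topological_node[OF assms(1) j(1), folded v_eq]
  have ab: "above Q k = {..<n} - below Q (Suc j)" "above Q (Suc k) = {..<n} - below Q j"
    unfolding above_def below_def j(2,3) by simp_all
  show "v < n" by (rule node(1))
  show "above Q (Suc k) = insert v (above Q k)"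
    unfolding ab below_Suc v_eq[symmetric] using node(1,2) by blast
  show "v \<notin> above Q k" unfolding ab below_Suc v_eq by blast
  show "v \<noteq> r \<Longrightarrow> pa v \<in> above Q k" unfolding ab using node(4,5) by blast
  show "children v \<inter> above Q (Suc k) = {}" unfolding ab using node(3) by blast
  show "above Q k \<subseteq> {..<n}" unfolding ab by blast
qed

text \<open>The sizes of the subtrees whose root has not been merged into its parent add up to the number
  of nodes.\<close>

definition sizes :: "nat set \<Rightarrow> (nat \<Rightarrow> nat) \<Rightarrow> bool" where
  "sizes P sz \<longleftrightarrow> (\<forall>u<n. sz u = 1 + sum sz (children u \<inter> P)) \<and> sum sz ({..<n} - (P - {r})) = n"

lemma sizes_init: "(\<forall>u<n. sz u = 1) \<Longrightarrow> sizes {} sz"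
  by (simp add: sizes_def)

text \<open>Adding \<open>sz\<close> of a node to its parent while dropping the node from the sum
  leaves the total at \<open>n\<close>. The total is what excludes overflow of the addition and
  gives the root the size \<open>n\<close>.\<close>

lemma sizes_step:
  assumes "topological Q" "k < n" "sizes (below Q k) sz"
  shows "Q k = r \<Longrightarrow> sizes (below Q (Suc k)) sz"
    and "Q k \<noteq> r \<Longrightarrow> sz (pa (Q k)) + sz (Q k) \<le> n"
    and "Q k \<noteq> r \<Longrightarrow> sizes (below Q (Suc k)) (sz(pa (Q k) := sz (pa (Q k)) + sz (Q k)))"
proof -
  note node = topological_node[OF assms(1,2)]
  let ?P = "below Q k" and ?P' = "below Q (Suc k)" and ?v = "Q k"
  show "sizes ?P' sz" if v: "?v = r"
  proof -
    have "?P' - {r} = ?P - {r}" "\<And>u. children u \<inter> ?P' = children u \<inter> ?P"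
      using v by (auto simp: below_Suc children_def)
    then show ?thesis using assms(3) unfolding sizes_def by metis
  qed
  assume v: "?v \<noteq> r"
  let ?p = "pa ?v"
  let ?sz = "sz(?p := sz ?p + sz ?v)"
  have p: "?p < n" "?p \<notin> ?P'" "?p \<noteq> ?v" using node v by auto
  let ?U = "{..<n} - (?P - {r})" and ?U' = "{..<n} - (?P' - {r})"
  have U: "?U = insert ?v (insert ?p (?U' - {?p}))" "?U' = insert ?p (?U' - {?p})"
    using p node v by (auto simp: below_Suc)
  have "sum sz ?U = sz ?v + sum sz (insert ?p (?U' - {?p}))"
    unfolding U(1) by (subst sum.insert) (use p v in \<open>auto simp: below_Suc\<close>)
  also have "\<dots> = sz ?v + (sz ?p + sum sz (?U' - {?p}))"
    by (subst sum.insert) auto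
  finally have total: "sz ?v + (sz ?p + sum sz (?U' - {?p})) = n" using assms(3) unfolding sizes_def by metis
  then show "sz ?p + sz ?v \<le> n" by linarith
  have "sum ?sz ?U' = ?sz ?p + sum ?sz (?U' - {?p})"
    by (subst U(2), subst sum.insert) auto
  also have "sum ?sz (?U' - {?p}) = sum sz (?U' - {?p})" by (rule sum.cong) auto
  finally have "sum ?sz ?U' = n" using total by simp
  moreover have "?sz u = 1 + sum ?sz (children u \<inter> ?P')" if u: "u < n" for u
  proof -
    have "sum ?sz (children u \<inter> ?P') = sum sz (children u \<inter> ?P')"
      by (rule sum.cong) (use p in auto)
    moreover have "sum sz (children u \<inter> ?P') = sum sz (children u \<inter> ?P) + (if u = ?p then sz ?v else 0)"
    proof (cases "u = ?p")
      case True
      then have "children u \<inter> ?P' = insert ?v (children u \<inter> ?P)"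
        using node(1) v by (auto simp: below_Suc children_def)
      then show ?thesis using True node(2) by simp
    next
      case False
      then have "children u \<inter> ?P' = children u \<inter> ?P"
        by (auto simp: below_Suc children_def)
      then show ?thesis using False by simp
    qed
    moreover have "sz u = 1 + sum sz (children u \<inter> ?P)" using assms(3) u by (simp add: sizes_def)
    ultimately show ?thesis by auto
  qed
  ultimately show "sizes ?P' ?sz" by (auto simp: sizes_def simp del: fun_upd_apply)
qed

lemma sizes_final:
  assumes "sizes {..<n} sz"
  shows "sz r = n" and "u < n \<Longrightarrow> sz u = 1 + sum sz (children u)"
proof -
  have "{..<n} - ({..<n} - {r}) = {r}" using root_less by auto
  then show "sz r = n" using assms by (simp add: sizes_def del: Diff_Diff_Int)
  have "children u \<inter> {..<n} = children u" by (auto simp: children_def)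
  then show "u < n \<Longrightarrow> sz u = 1 + sum sz (children u)" using assms by (simp add: sizes_def)
qed

text \<open>\<open>off u\<close> is the next free number in the interval of \<open>u\<close>.\<close>

definition numbering :: "(nat \<Rightarrow> nat) \<Rightarrow> nat set \<Rightarrow> (nat \<Rightarrow> nat) \<Rightarrow> (nat \<Rightarrow> nat) \<Rightarrow> bool" where
  "numbering sz D lo off \<longleftrightarrow> (r \<in> D \<longrightarrow> lo r = 0) \<and>
     (\<forall>v\<in>D. v \<noteq> r \<longrightarrow> lo (pa v) < lo v \<and> lo v + sz v \<le> off (pa v)) \<and>
     (\<forall>u\<in>D. \<forall>v\<in>D. u \<noteq> r \<and> v \<noteq> r \<and> u \<noteq> v \<and> pa u = pa v \<longrightarrow>
        lo u + sz u \<le> lo v \<or> lo v + sz v \<le> lo u) \<and>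
     (\<forall>u\<in>D. lo u < off u \<and> off u + sum sz (children u - D) = lo u + sz u \<and> lo u + sz u \<le> n)"

text \<open>The free rest of the parent's interval has exactly the length of the intervals its
  unnumbered children still need, so each child can take the next \<open>sz v\<close> numbers in
  whatever order the children come.\<close>

lemma numbering_step:
  assumes "topological Q" "k < n" "sizes {..<n} sz" "numbering sz (above Q k) lo off"
  defines "v \<equiv> Q (n - 1 - k)"
  shows "v = r \<Longrightarrow> numbering sz (above Q (Suc k)) (lo(v := 0)) (off(v := 1))"
    and "v \<noteq> r \<Longrightarrow> off (pa v) + sz v \<le> n \<and> off (pa v) < n \<and> pa v < n \<and> pa v \<noteq> v \<and>
      numbering sz (above Q (Suc k)) (lo(v := off (pa v))) (off(pa v := off (pa v) + sz v, v := off (pa v) + 1))"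
proof -
  note node = above_node[OF assms(1,2), folded v_def]
  let ?D = "above Q k"
  have szv: "sz v = 1 + sum sz (children v)" using sizes_final(2)[OF assms(3) node(1)] .
  have chv: "children v - insert v ?D = children v" using node(2,5) by auto
  have num: "r \<in> ?D \<Longrightarrow> lo r = 0"
    "\<And>u. u \<in> ?D \<Longrightarrow> u \<noteq> r \<Longrightarrow> lo (pa u) < lo u \<and> lo u + sz u \<le> off (pa u)"
    "\<And>u x. u \<in> ?D \<Longrightarrow> x \<in> ?D \<Longrightarrow> u \<noteq> r \<Longrightarrow> x \<noteq> r \<Longrightarrow> u \<noteq> x \<Longrightarrow> pa u = pa x \<Longrightarrow>
      lo u + sz u \<le> lo x \<or> lo x + sz x \<le> lo u"
    "\<And>u. u \<in> ?D \<Longrightarrow> lo u < off u \<and> off u + sum sz (children u - ?D) = lo u + sz u \<and> lo u + sz u \<le> n"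
    using assms(4) unfolding numbering_def by blast+
  have paD: "pa u \<noteq> v" if "u \<in> ?D" "u \<noteq> r" for u
    using node(5,6) that by (auto simp: children_def node(2))
  show "numbering sz (above Q (Suc k)) (lo(v := 0)) (off(v := 1))" if v: "v = r"
  proof -
    \<comment> \<open>A prefix of the order that contains the root contains all its descendants,
      that is, all nodes. So the root comes first when the order is read backwards.\<close>
    have "n - k = Suc (n - 1 - k)" using assms(2) by simp
    then have "r \<in> below Q (n - k)" using v by (simp add: below_Suc v_def)
    then have "u \<notin> ?D" for u
      using below_closed[OF assms(1), of "n - k" r u] anc_root[of u] by (auto simp: above_def below_def)
    then have D: "?D = {}" by blast
    show ?thesis
      unfolding node(2) D using szv chv[unfolded D] v sizes_final(1)[OF assms(3)]
      by (auto simp: numbering_def)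
  qed
  assume v: "v \<noteq> r"
  let ?p = "pa v"
  have p: "?p \<in> ?D" "?p < n" "?p \<noteq> v" using node v by auto
  let ?lo = "lo(v := off ?p)" and ?off = "off(?p := off ?p + sz v, v := off ?p + 1)"
  have chp: "children ?p - ?D = insert v (children ?p - insert v ?D)" 
    using node(1,3) v by (auto simp: children_def)
  have sump: "sum sz (children ?p - ?D) = sz v + sum sz (children ?p - insert v ?D)"
    unfolding chp by (subst sum.insert) auto
  have offp: "off ?p + sz v + sum sz (children ?p - insert v ?D) = lo ?p + sz ?p" "lo ?p + sz ?p \<le> n" "lo ?p < off ?p"
    using num(4)[OF p(1)] sump by auto
  then have le: "off ?p + sz v \<le> n" by linarith
  have cho: "children u - insert v ?D = children u - ?D" if "u \<noteq> ?p" for u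
    using that by (auto simp: children_def)
  have "numbering sz (insert v ?D) ?lo ?off"
    unfolding numbering_def
  proof (intro conjI ballI impI)
    show "?lo r = 0" if "r \<in> insert v ?D" using that v num(1) by auto
  next
    fix u assume u: "u \<in> insert v ?D" "u \<noteq> r"
    show "?lo (pa u) < ?lo u"
      using u num(2)[of u] paD[of u] node(3) p(3) offp(3) by (cases "u = v") auto
    show "?lo u + sz u \<le> ?off (pa u)"
      using u num(2)[of u] paD[of u] node(3) p(3) by (cases "u = v") auto
  next
    fix u x assume ux: "u \<in> insert v ?D" "x \<in> insert v ?D" "u \<noteq> r \<and> x \<noteq> r \<and> u \<noteq> x \<and> pa u = pa x"
    consider "u = v" "x \<in> ?D" "x \<noteq> v" | "x = v" "u \<in> ?D" "u \<noteq> v" | "u \<in> ?D" "x \<in> ?D" "u \<noteq> v" "x \<noteq> v"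
      using ux node(3) by blast
    then show "?lo u + sz u \<le> ?lo x \<or> ?lo x + sz x \<le> ?lo u"
    proof cases
      case 1
      then show ?thesis using num(2)[of x] ux by auto
    next
      case 2
      then show ?thesis using num(2)[of u] ux by auto
    next
      case 3
      then show ?thesis using num(3)[of u x] ux by auto
    qed
  next
    fix u assume u: "u \<in> insert v ?D"
    consider "u = v" | "u \<noteq> v" "u = ?p" | "u \<noteq> v" "u \<noteq> ?p" "u \<in> ?D" using u by blast
    note cs = this
    show "?lo u < ?off u"
      using cs num(4)[of u] offp by cases auto
    show "?off u + sum sz (children u - insert v ?D) = ?lo u + sz u"
      using cs
    proof cases
      case 1
      then show ?thesis using szv chv by simp
    next
      case 2
      then show ?thesis using offp p by simp
    next
      case 3
      then show ?thesis using num(4)[of u] cho by simp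
    qed
    show "?lo u + sz u \<le> n"
      using cs num(4)[of u] offp le by cases auto
  qed
  moreover have "off ?p < n" using le szv by simp
  ultimately show "off ?p + sz v \<le> n \<and> off ?p < n \<and> ?p < n \<and> ?p \<noteq> v \<and> numbering sz (above Q (Suc k)) ?lo ?off"
    unfolding node(2) using le p by blast
qed

lemma numbering_final:
  assumes "sizes {..<n} sz" "numbering sz {..<n} lo off"
  shows "numbered_tree n r pa E lo sz"
proof
  show "lo r = 0" "sz r \<le> n"
    using assms root_less sizes_final(1)[OF assms(1)] by (auto simp: numbering_def)
  show "1 \<le> sz v" if "v < n" for v using sizes_final(2)[OF assms(1) that] by simp
  show "lo (pa v) < lo v \<and> lo v + sz v \<le> lo (pa v) + sz (pa v)" if v: "v < n" "v \<noteq> r" for v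
  proof -
    have "off (pa v) \<le> lo (pa v) + sz (pa v)"
      using assms(2) pa_less[OF v] unfolding numbering_def by (metis le_add1 lessThan_iff)
    then show ?thesis using assms(2) v unfolding numbering_def by force
  qed
  show "lo u + sz u \<le> lo v \<or> lo v + sz v \<le> lo u"
    if "u < n" "v < n" "u \<noteq> r" "v \<noteq> r" "u \<noteq> v" "pa u = pa v" for u v
    using assms(2) that unfolding numbering_def by blast
qed

section \<open>Computing \<open>inl\<close> from the leaves upwards\<close>

definition inlabeling :: "(nat \<Rightarrow> nat) \<Rightarrow> nat set \<Rightarrow> (nat \<Rightarrow> nat) \<Rightarrow> bool" where
  "inlabeling lo P inl \<longleftrightarrow> (\<forall>v<n. (inl v = lo v + 1 \<or> (\<exists>c\<in>children v \<inter> P. inl v = inl c)) \<and>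
     lowbit (lo v + 1) \<le> lowbit (inl v) \<and> (\<forall>c\<in>children v \<inter> P. lowbit (inl c) \<le> lowbit (inl v)))"

lemma inlabeling_init: "(\<forall>v<n. inl v = lo v + 1) \<Longrightarrow> inlabeling lo {} inl"
  by (simp add: inlabeling_def)

text \<open>The node hands its value to the parent if its power is larger. The parent is not yet
  processed, so no value that has already been inherited changes.\<close>

lemma inlabeling_step:
  assumes "topological Q" "k < n" "inlabeling lo (below Q k) inl"
  shows "Q k = r \<Longrightarrow> inlabeling lo (below Q (Suc k)) inl"
    and "Q k \<noteq> r \<Longrightarrow> \<not> lowbit (inl (pa (Q k))) < lowbit (inl (Q k)) \<Longrightarrow> inlabeling lo (below Q (Suc k)) inl"
    and "Q k \<noteq> r \<Longrightarrow> lowbit (inl (pa (Q k))) < lowbit (inl (Q k)) \<Longrightarrow>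
      inlabeling lo (below Q (Suc k)) (inl(pa (Q k) := inl (Q k)))"
proof -
  note node = topological_node[OF assms(1,2)]
  let ?v = "Q k" and ?P = "below Q k" and ?P' = "below Q (Suc k)"
  have ch: "children u \<inter> ?P' = (if ?v \<in> children u then insert ?v (children u \<inter> ?P) else children u \<inter> ?P)" for u
    by (auto simp: below_Suc)
  have mem: "?v \<in> children u \<longleftrightarrow> ?v \<noteq> r \<and> u = pa ?v" for u using node(1) by (auto simp: children_def)
  show "?v = r \<Longrightarrow> inlabeling lo ?P' inl"
    using assms(3) unfolding inlabeling_def ch mem by simp
  show "?v \<noteq> r \<Longrightarrow> \<not> lowbit (inl (pa ?v)) < lowbit (inl ?v) \<Longrightarrow> inlabeling lo ?P' inl"
    using assms(3) unfolding inlabeling_def ch mem by auto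
  assume v: "?v \<noteq> r" and less: "lowbit (inl (pa ?v)) < lowbit (inl ?v)"
  let ?inl = "inl(pa ?v := inl ?v)"
  have notin: "pa ?v \<notin> ?P'" using node v by blast
  show "inlabeling lo ?P' ?inl"
    unfolding inlabeling_def
  proof (intro allI impI)
    fix u assume u: "u < n"
    have same: "?inl c = inl c" if "c \<in> ?P'" for c using that notin by auto
    from assms(3) u have old: "inl u = lo u + 1 \<or> (\<exists>c\<in>children u \<inter> ?P. inl u = inl c)"
      "lowbit (lo u + 1) \<le> lowbit (inl u)" "\<forall>c\<in>children u \<inter> ?P. lowbit (inl c) \<le> lowbit (inl u)"
      by (auto simp: inlabeling_def)
    show "(?inl u = lo u + 1 \<or> (\<exists>c\<in>children u \<inter> ?P'. ?inl u = ?inl c)) \<and>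
     lowbit (lo u + 1) \<le> lowbit (?inl u) \<and> (\<forall>c\<in>children u \<inter> ?P'. lowbit (?inl c) \<le> lowbit (?inl u))"
    proof (cases "u = pa ?v")
      case True
      have "?v \<in> children u \<inter> ?P'" using True v mem by (auto simp: below_Suc)
      moreover have "?inl u = inl ?v" using True by simp
      moreover have "lowbit (inl c) \<le> lowbit (inl ?v)" if "c \<in> children u \<inter> ?P'" for c
      proof (cases "c = ?v")
        case False
        then have "c \<in> children u \<inter> ?P" using that by (auto simp: below_Suc)
        then show ?thesis using old(3) less True by (meson less_imp_le order.trans)
      qed simp
      moreover have "lowbit (lo u + 1) \<le> lowbit (inl ?v)" using old(2) less True by simp
      ultimately show ?thesis using same by auto
    next
      case False
      then have "children u \<inter> ?P' = children u \<inter> ?P" using ch mem by auto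
      moreover have "?inl u = inl u" using False by simp
      moreover have "?inl c = inl c" if "c \<in> children u \<inter> ?P" for c using same that by (auto simp: below_Suc)
      ultimately show ?thesis using old by simp
    qed
  qed
qed

end

text \<open>Comparisons with children extend to all descendants: by induction from the leaves for
  the node attaining the value, by induction from the root for maximality.\<close>

lemma (in numbered_tree) inlabeling_final:
  assumes "inlabeling lo {..<n} inl"
  shows "labeled_numbering n r pa E lo sz inl"
proof
  have ch: "children v \<inter> {..<n} = children v" for v by (auto simp: children_def)
  have in1: "inl v = lo v + 1 \<or> (\<exists>c\<in>children v. inl v = inl c)" if "v < n" for v
    using assms that by (auto simp: inlabeling_def ch)
  have in2: "lowbit (lo v + 1) \<le> lowbit (inl v)" if "v < n" for v
    using assms that by (auto simp: inlabeling_def ch)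
  have in3: "lowbit (inl c) \<le> lowbit (inl v)" if "v < n" "c \<in> children v" for v c
    using assms that by (auto simp: inlabeling_def ch)
  show "\<exists>d<n. anc v d \<and> inl v = lo d + 1" if "v < n" for v
    using wf_converse that
  proof (induction v rule: wf_induct_rule)
    case (less v)
    show ?case
    proof (cases "inl v = lo v + 1")
      case True
      then show ?thesis using less.prems by auto
    next
      case False
      then obtain c where c: "c \<in> children v" "inl v = inl c" using in1[OF less.prems] by blast
      then have "(c, v) \<in> E\<inverse>" "c < n" "anc v c"
        using edge_iff[of v c] anc_parent[of c] by (auto simp: children_def)
      then obtain d where "d < n" "anc c d" "inl c = lo d + 1" using less.IH by blast
      then show ?thesis using c \<open>anc v c\<close> anc_trans by metis
    qed
  qed
  have "lowbit (inl d) \<le> lowbit (inl v)" if "d < n" "anc v d" for v d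
    using that
  proof (induction d rule: node_induct)
    case root
    then show ?case using anc_rec[OF root_less, of v] by auto
  next
    case (child d)
    have "lowbit (inl d) \<le> lowbit (inl (pa d))"
      using in3[OF pa_less[OF child.hyps]] child.hyps by (auto simp: children_def)
    then show ?case using child anc_rec[of d v] by (auto intro: order.trans)
  qed
  then show "lowbit (lo d + 1) \<le> lowbit (inl v)" if "v < n" "d < n" "anc v d" for v d
    using in2[OF that(2)] that order.trans by blast
qed

section \<open>Numbering the tree\<close>

abbreviation ld :: "nat \<Rightarrow> exp \<Rightarrow> exp" where "ld kd \<equiv> Ld kd (Lit 0)"
abbreviation st :: "nat \<Rightarrow> exp \<Rightarrow> exp \<Rightarrow> hcom" where "st kd \<equiv> St kd (Lit 0)"
abbreviation plus1 :: "exp \<Rightarrow> exp" where "plus1 e \<equiv> Bin Add e (Lit 1)"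
abbreviation minus1 :: "exp \<Rightarrow> exp" where "minus1 e \<equiv> Bin Sub e (Lit 1)"

definition lowbit_exp :: "exp \<Rightarrow> exp" where
  "lowbit_exp e = plus1 (Bin Div (Bin BitXor e (minus1 e)) (Lit 2))"

text \<open>
  Kinds of arrays: 0 parents, 1 remaining children, 2 nodes in an order with children first,
  3 sizes of subtrees, 4 preorder numbers, 5 next free number, 6 \<open>inl\<close>, 7 \<open>lowbit (inl v)\<close>;
  and with one row for each slot: 8 target slots, 9 masks, 10 next marked node of the same class,
  11 topmost marked node of the class \<open>inl\<close>, at index \<open>inl - 1\<close>. Row 0 of the element memory holds
  the labels, row \<open>i + 1\<close> the values of slot \<open>i\<close>. Registers 0 to 3 hold \<open>m\<close>, \<open>n\<close>, the root and \<open>m + 1\<close>.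
\<close>

definition ph_count :: hcom where
  "ph_count = Loop 4 1 (st 1 (Var 4) (Lit 0)) ;;
     Loop 4 1 (Cond (Eq (Var 4) (Var 2)) Nop (st 1 (ld 0 (Var 4)) (plus1 (ld 1 (ld 0 (Var 4))))))"

definition ph_queue :: hcom where
  "ph_queue = Asg 7 (Lit 0) ;;
     Loop 4 1 (Cond (Eq (ld 1 (Var 4)) (Lit 0)) (st 2 (Var 7) (Var 4) ;; Asg 7 (plus1 (Var 7))) Nop)"

definition ph_peel :: hcom where
  "ph_peel = Loop 4 1 (Asg 5 (ld 2 (Var 4)) ;;
     Cond (Eq (Var 5) (Var 2)) Nop
       (Asg 6 (ld 0 (Var 5)) ;; st 1 (Var 6) (minus1 (ld 1 (Var 6))) ;;
        Cond (Eq (ld 1 (Var 6)) (Lit 0)) (st 2 (Var 7) (Var 6) ;; Asg 7 (plus1 (Var 7))) Nop))"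

definition ph_size :: hcom where
  "ph_size = Loop 4 1 (st 3 (Var 4) (Lit 1)) ;;
     Loop 4 1 (Asg 5 (ld 2 (Var 4)) ;; Cond (Eq (Var 5) (Var 2)) Nop
       (Asg 6 (ld 0 (Var 5)) ;; st 3 (Var 6) (Bin Add (ld 3 (Var 6)) (ld 3 (Var 5)))))"

definition ph_number :: hcom where
  "ph_number = Loop 4 1 (Asg 5 (ld 2 (Bin Sub (minus1 (Var 1)) (Var 4))) ;;
     Cond (Eq (Var 5) (Var 2)) (st 4 (Var 5) (Lit 0) ;; st 5 (Var 5) (Lit 1))
       (Asg 6 (ld 0 (Var 5)) ;; st 4 (Var 5) (ld 5 (Var 6)) ;;
        st 5 (Var 6) (Bin Add (ld 5 (Var 6)) (ld 3 (Var 5))) ;; st 5 (Var 5) (plus1 (ld 4 (Var 5)))))"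

definition ph_inlabel :: hcom where
  "ph_inlabel = Loop 4 1 (st 6 (Var 4) (plus1 (ld 4 (Var 4))) ;; st 7 (Var 4) (lowbit_exp (ld 6 (Var 4)))) ;;
     Loop 4 1 (Asg 5 (ld 2 (Var 4)) ;; Cond (Eq (Var 5) (Var 2)) Nop
       (Asg 6 (ld 0 (Var 5)) ;;
        Cond (Lt (ld 7 (Var 6)) (ld 7 (Var 5))) (st 6 (Var 6) (ld 6 (Var 5)) ;; st 7 (Var 6) (ld 7 (Var 5))) Nop))"

lemma inj_on_snoc: "inj_on f {..<t} \<Longrightarrow> y \<notin> f ` {..<t} \<Longrightarrow> inj_on (f(t := y)) {..<Suc t}"
  by (auto simp: inj_on_def lessThan_Suc)

lemma image_snoc: "(f(t := y)) ` {..<Suc t} = insert y (f ` {..<t})"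
  by (auto simp: lessThan_Suc)

context machine
begin

lemma wp_seqI:
  assumes "wp c P s" and "\<And>s'. P s' \<Longrightarrow> frame c s s' \<Longrightarrow> wp d Q s'"
  shows "wp (c ;; d) Q s"
  using wp_mono[OF wp_frame[OF assms(1)], of "wp d Q"] assms(2) by auto

lemma w_gt: "4 < w"
proof (rule ccontr)
  assume "\<not> 4 < w"
  then have "(2::nat) ^ w \<le> 2 ^ 4" by (intro power_increasing) auto
  then show False using m_bound m_pos by simp
qed

lemma one_less [simp]: "Suc 0 < 2 ^ w" and two_less [simp]: "(2::nat) < 2 ^ w"
  using const_less[of 1] const_less[of 2] by simp_all

text \<open>The final increment cannot wrap around because \<open>lowbit x \<le> x\<close>.\<close>

lemma lowbit_exp:
  assumes "safe e s" "1 \<le> eval e s" "eval e s < 2 ^ w"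
  shows "safe (lowbit_exp e) s \<and> eval (lowbit_exp e) s = lowbit (eval e s)"
proof -
  have ev: "eval (lowbit_exp e) s = lowbit (eval e s)"
    by (simp add: lowbit_exp_def lowbit_def)
  have "lowbit (eval e s) \<le> eval e s" using lowbit_power[of "eval e s"] assms(2) by auto
  then have "lowbit (eval e s) < 2 ^ w" using assms(3) by (rule le_less_trans)
  then show ?thesis using assms ev w_gt two_less by (simp add: lowbit_exp_def lowbit_def)
qed

end

section \<open>Correctness of the numbering phases\<close>

locale builder = machine w n m M mul + parent_tree n r pa E
  for w n m M :: nat and mul :: "'a \<Rightarrow> 'a \<Rightarrow> 'a" and r :: nat and pa E
begin

definition base :: "'a hstate \<Rightarrow> bool" where
  "base s \<longleftrightarrow> var s 0 = m \<and> var s 1 = n \<and> var s 2 = r \<and> var s 3 = m + 1 \<and>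
     (\<forall>v<n. v \<noteq> r \<longrightarrow> arr s 0 0 v = pa v)"

lemma base_frame: "base s \<Longrightarrow> frame c s s' \<Longrightarrow> mods c \<inter> {0, 1, 2, 3} = {} \<Longrightarrow> 0 \<notin> kinds c \<Longrightarrow> base s'"
  by (auto simp: base_def frame_def)

lemmas bounds = n_bound m_bound w_gt two_less n_pos m_pos

lemma wp_count:
  assumes "base s"
  shows "wp ph_count (\<lambda>s. \<forall>u<n. arr s 1 0 u = card (children u)) s"
  unfolding ph_count_def
proof (rule wp_seqI[where P = "\<lambda>s. \<forall>u<n. arr s 1 0 u = 0"])
  show "wp (Loop 4 1 (st 1 (Var 4) (Lit 0))) (\<lambda>s. \<forall>u<n. arr s 1 0 u = 0) s"
    by (rule wp_Loop[where I = "\<lambda>k s. \<forall>u<k. arr s 1 0 u = 0"])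
      (use assms in \<open>auto simp: base_def lim_def less_Suc_eq\<close>)
next
  fix s1 assume s1: "\<forall>u<n. arr s1 1 0 u = 0" and f1: "frame (Loop 4 1 (st 1 (Var 4) (Lit 0))) s s1"
  have b1: "base s1" using base_frame[OF assms f1] by simp
  \<comment> \<open>The children of \<open>u\<close> among the first \<open>k\<close> nodes; there
    are at most \<open>k\<close>, so the counter does not overflow.\<close>
  let ?C = "\<lambda>k u. {c. c < k \<and> c \<noteq> r \<and> pa c = u}"
  have C: "?C (Suc k) u = (if k \<noteq> r \<and> pa k = u then insert k (?C k u) else ?C k u)" for k u
    by (auto simp: less_Suc_eq)
  have cardC: "card (?C k u) \<le> k" for k u
    using card_mono[of "{..<k}" "?C k u"] by auto
  show "wp (Loop 4 1 (Cond (Eq (Var 4) (Var 2)) Nop (st 1 (ld 0 (Var 4)) (plus1 (ld 1 (ld 0 (Var 4)))))))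
     (\<lambda>s. \<forall>u<n. arr s 1 0 u = card (children u)) s1"
  proof (rule wp_Loop[where I = "\<lambda>k s. \<forall>u<n. arr s 1 0 u = card (?C k u)"])
    fix k s' assume k: "k < lim 1" and inv: "\<forall>u<n. arr s' 1 0 u = card (?C k u)" and v: "var s' 4 = k"
      and f: "frame (Loop 4 1 (Cond (Eq (Var 4) (Var 2)) Nop (st 1 (ld 0 (Var 4)) (plus1 (ld 1 (ld 0 (Var 4))))))) s1 s'"
    have b: "base s'" using base_frame[OF b1 f] by simp
    have fin: "finite (?C k u)" for u by (rule finite_subset[of _ "{..<k}"]) auto
    have "Suc (card (?C k (pa k))) < 2 ^ w" using cardC[of k "pa k"] k bounds by (simp add: lim_def)
    then show "wp (Cond (Eq (Var 4) (Var 2)) Nop (st 1 (ld 0 (Var 4)) (plus1 (ld 1 (ld 0 (Var 4))))))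
      (\<lambda>s''. \<forall>u<n. arr (setv 4 (Suc k) s'') 1 0 u = card (?C (Suc k) u)) s'"
      using b inv v k w_gt pa_less[of k] fin unfolding C by (auto simp: base_def lim_def)
  qed (use s1 b1 in \<open>auto simp: base_def lim_def children_def\<close>)
qed

lemma wp_queue:
  assumes "base s" and dg: "\<forall>u<n. arr s 1 0 u = card (children u)"
  shows "wp ph_queue (\<lambda>s. peeling 0 (var s 7) (arr s 2 0) (arr s 1 0)) s"
proof -
  let ?I = "\<lambda>k s. var s 7 \<le> k \<and> inj_on (arr s 2 0) {..<var s 7} \<and>
    arr s 2 0 ` {..<var s 7} = {u. u < k \<and> arr s 1 0 u = 0}"
  let ?c = "Cond (Eq (ld 1 (Var 4)) (Lit 0)) (st 2 (Var 7) (Var 4) ;; Asg 7 (plus1 (Var 7))) Nop"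
  let ?s = "setv 7 0 s"
  have "wp (Loop 4 1 ?c) (\<lambda>s. peeling 0 (var s 7) (arr s 2 0) (arr s 1 0)) ?s"
  proof (rule wp_Loop[where I = ?I])
    fix k s' assume k: "k < lim 1" and inv: "?I k s'" and v: "var s' 4 = k"
      and f: "frame (Loop 4 1 ?c) ?s s'"
    let ?Q = "arr s' 2 0" and ?t = "var s' 7"
    note t1 = conjunct1[OF inv] and inj = conjunct1[OF conjunct2[OF inv]]
      and img = conjunct2[OF conjunct2[OF inv]]
    have "k \<notin> ?Q ` {..<?t}" unfolding img by simp
    with inj have inj': "inj_on (?Q(?t := k)) {..<Suc ?t}" by (rule inj_on_snoc)
    have img': "(?Q(?t := k)) ` {..<Suc ?t} = {u. u < Suc k \<and> arr s' 1 0 u = 0}" if "arr s' 1 0 k = 0"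
      unfolding image_snoc img using that by (auto simp: less_Suc_eq)
    have t: "?t \<le> k" "k < n" using t1 k by (simp_all add: lim_def)
    show "wp ?c (\<lambda>s''. ?I (Suc k) (setv 4 (Suc k) s'')) s'"
    proof (cases "arr s' 1 0 k = 0")
      case True
      have "Suc ?t < 2 ^ w" "?t < n" using t bounds by linarith+
      then show ?thesis using True t v inj' img'[OF True] w_gt by (simp del: fun_upd_apply add: fun_upd_same fun_upd_other)
    next
      case False
      then have "{u. u < Suc k \<and> arr s' 1 0 u = 0} = {u. u < k \<and> arr s' 1 0 u = 0}"
        by (auto simp: less_Suc_eq)
      then show ?thesis using False t v inj img bounds by simp
    qed
  next
    fix s' assume "?I (lim 1) s'" and f: "frame (Loop 4 1 ?c) ?s s'"
    then show "peeling 0 (var s' 7) (arr s' 2 0) (arr s' 1 0)"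
      using dg by (simp add: peeling_def lim_def frame_def)
  qed (use assms(1) in \<open>simp_all add: base_def lim_def\<close>)
  then show ?thesis by (simp add: ph_queue_def)
qed

lemma wp_peel:
  assumes "base s" and "peeling 0 (var s 7) (arr s 2 0) (arr s 1 0)"
  shows "wp ph_peel (\<lambda>s. topological (arr s 2 0)) s"
  unfolding ph_peel_def
proof (rule wp_Loop[where I = "\<lambda>k s. peeling k (var s 7) (arr s 2 0) (arr s 1 0)"])
  let ?I = "\<lambda>k s. peeling k (var s 7) (arr s 2 0) (arr s 1 0)"
  let ?c = "Asg 5 (ld 2 (Var 4)) ;; Cond (Eq (Var 5) (Var 2)) Nop
       (Asg 6 (ld 0 (Var 5)) ;; st 1 (Var 6) (minus1 (ld 1 (Var 6))) ;;
        Cond (Eq (ld 1 (Var 6)) (Lit 0)) (st 2 (Var 7) (Var 6) ;; Asg 7 (plus1 (Var 7))) Nop)"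
  fix k s'
  assume k: "k < lim 1" and inv: "?I k s'" and v: "var s' 4 = k"
    and f: "frame (Loop 4 1 ?c) s s'"
  have b: "base s'" using base_frame[OF assms(1) f] by simp
  have kn: "k < n" using k by (simp add: lim_def)
  let ?Q = "arr s' 2 0" and ?dg = "arr s' 1 0" and ?t = "var s' 7"
  show "wp ?c
     (\<lambda>s''. ?I (Suc k) (setv 4 (Suc k) s'')) s'"
  proof (cases "?Q k = r")
    case True
    then show ?thesis using b v kn peeling_root[OF inv kn] by (simp add: base_def)
  next
    case False
    note st = peeling_step[OF inv kn False]
    have Qk: "?Q k < n" using peeling_node[OF inv kn] by blast
    then have pak: "arr s' 0 0 (?Q k) = pa (?Q k)" using b False by (simp add: base_def)
    have t: "?t \<le> n" using inv by (simp add: peeling_def)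
    show ?thesis
    proof (cases "?dg (pa (?Q k)) = 1")
      case True
      then show ?thesis using b v kn False Qk pak st(1-3) st(5)[OF True] bounds
        by (simp add: base_def)
    next
      case ne: False
      then show ?thesis using b v kn False Qk pak st(1-3) st(4)[OF ne] bounds
        by (simp add: base_def)
    qed
  qed
qed (use assms peeling_topological in \<open>auto simp: base_def lim_def\<close>)

lemma wp_size:
  assumes "base s" and Q: "topological (arr s 2 0)"
  shows "wp ph_size (\<lambda>s. sizes {..<n} (arr s 3 0)) s"
  unfolding ph_size_def
proof (rule wp_seqI[where P = "\<lambda>s. \<forall>u<n. arr s 3 0 u = 1"])
  show "wp (Loop 4 1 (st 3 (Var 4) (Lit 1))) (\<lambda>s. \<forall>u<n. arr s 3 0 u = 1) s"
    by (rule wp_Loop[where I = "\<lambda>k s. \<forall>u<k. arr s 3 0 u = 1"])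
      (use assms w_gt in \<open>auto simp: base_def lim_def less_Suc_eq\<close>)
next
  fix s1 assume s1: "\<forall>u<n. arr s1 3 0 u = 1" and f1: "frame (Loop 4 1 (st 3 (Var 4) (Lit 1))) s s1"
  have b1: "base s1" using base_frame[OF assms(1) f1] by simp
  have Q1: "topological (arr s1 2 0)" using Q f1 by (simp add: frame_def)
  let ?c = "Asg 5 (ld 2 (Var 4)) ;; Cond (Eq (Var 5) (Var 2)) Nop
       (Asg 6 (ld 0 (Var 5)) ;; st 3 (Var 6) (Bin Add (ld 3 (Var 6)) (ld 3 (Var 5))))"
  show "wp (Loop 4 1 ?c) (\<lambda>s. sizes {..<n} (arr s 3 0)) s1"
  proof (rule wp_Loop[where I = "\<lambda>k s. sizes (below (arr s 2 0) k) (arr s 3 0)"])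
    fix k s' assume k: "k < lim 1" and inv: "sizes (below (arr s' 2 0) k) (arr s' 3 0)" and v: "var s' 4 = k"
      and f: "frame (Loop 4 1 ?c) s1 s'"
    have b: "base s'" using base_frame[OF b1 f] by simp
    have kn: "k < n" using k by (simp add: lim_def)
    have Q': "topological (arr s' 2 0)" using Q1 f by (simp add: frame_def)
    note node = topological_node[OF Q' kn] and st = sizes_step[OF Q' kn inv]
    show "wp ?c (\<lambda>s''. sizes (below (arr (setv 4 (Suc k) s'') 2 0) (Suc k)) (arr (setv 4 (Suc k) s'') 3 0)) s'"
      using b v kn node st bounds by (cases "arr s' 2 0 k = r") (simp_all add: base_def)
  next
    fix s' assume "sizes (below (arr s' 2 0) (lim 1)) (arr s' 3 0)" "frame (Loop 4 1 ?c) s1 s'"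
    then show "sizes {..<n} (arr s' 3 0)" using below_n[OF Q1] by (simp add: lim_def frame_def)
  qed (use s1 b1 sizes_init in \<open>auto simp: base_def lim_def\<close>)
qed

lemma wp_number:
  assumes "base s" and Q: "topological (arr s 2 0)" and sz: "sizes {..<n} (arr s 3 0)"
  shows "wp ph_number (\<lambda>s. numbered_tree n r pa E (arr s 4 0) (arr s 3 0)) s"
  unfolding ph_number_def
proof (rule wp_Loop[where I = "\<lambda>k s. numbering (arr s 3 0) (above (arr s 2 0) k) (arr s 4 0) (arr s 5 0)"])
  let ?c = "Asg 5 (ld 2 (Bin Sub (minus1 (Var 1)) (Var 4))) ;;
     Cond (Eq (Var 5) (Var 2)) (st 4 (Var 5) (Lit 0) ;; st 5 (Var 5) (Lit 1))
       (Asg 6 (ld 0 (Var 5)) ;; st 4 (Var 5) (ld 5 (Var 6)) ;;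
        st 5 (Var 6) (Bin Add (ld 5 (Var 6)) (ld 3 (Var 5))) ;; st 5 (Var 5) (plus1 (ld 4 (Var 5))))"
  let ?I = "\<lambda>k s. numbering (arr s 3 0) (above (arr s 2 0) k) (arr s 4 0) (arr s 5 0)"
  fix k s' assume k: "k < lim 1" and inv: "?I k s'" and v: "var s' 4 = k" and f: "frame (Loop 4 1 ?c) s s'"
  have b: "base s'" using base_frame[OF assms(1) f] by simp
  have kn: "k < n" using k by (simp add: lim_def)
  have Q': "topological (arr s' 2 0)" and sz': "sizes {..<n} (arr s' 3 0)"
    using Q sz f by (simp_all add: frame_def)
  note node = above_node[OF Q' kn] and st = numbering_step[OF Q' kn sz' inv]
  have idx: "k \<le> n - Suc 0" "n - Suc 0 < 2 ^ w" "n < 2 ^ w" using kn n_bound by linarith+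
  show "wp ?c (\<lambda>s''. ?I (Suc k) (setv 4 (Suc k) s'')) s'"
    using b v kn idx node st bounds by (cases "arr s' 2 0 (n - 1 - k) = r") (simp_all add: base_def)
next
  fix s' assume I: "numbering (arr s' 3 0) (above (arr s' 2 0) (lim 1)) (arr s' 4 0) (arr s' 5 0)"
    and f: "frame (Loop 4 1 (Asg 5 (ld 2 (Bin Sub (minus1 (Var 1)) (Var 4))) ;;
     Cond (Eq (Var 5) (Var 2)) (st 4 (Var 5) (Lit 0) ;; st 5 (Var 5) (Lit 1))
       (Asg 6 (ld 0 (Var 5)) ;; st 4 (Var 5) (ld 5 (Var 6)) ;;
        st 5 (Var 6) (Bin Add (ld 5 (Var 6)) (ld 3 (Var 5))) ;; st 5 (Var 5) (plus1 (ld 4 (Var 5)))))) s s'"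
  have "arr s' 3 0 = arr s 3 0" using f by (simp add: frame_def)
  then show "numbered_tree n r pa E (arr s' 4 0) (arr s' 3 0)"
    using numbering_final[OF sz, of "arr s' 4 0" "arr s' 5 0"] I by (simp add: lim_def)
qed (use assms in \<open>auto simp: base_def lim_def numbering_def\<close>)

lemma wp_inlabel:
  assumes "base s" and Q: "topological (arr s 2 0)" and lo: "numbered_tree n r pa E (arr s 4 0) (arr s 3 0)"
  shows "wp ph_inlabel (\<lambda>s. labeled_numbering n r pa E (arr s 4 0) (arr s 3 0) (arr s 6 0) \<and>
    (\<forall>v<n. arr s 7 0 v = lowbit (arr s 6 0 v))) s"
  unfolding ph_inlabel_def
proof (rule wp_seqI[where P = "\<lambda>s. \<forall>u<n. arr s 6 0 u = arr s 4 0 u + 1 \<and> arr s 7 0 u = lowbit (arr s 6 0 u)"])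
  let ?c = "st 6 (Var 4) (plus1 (ld 4 (Var 4))) ;; st 7 (Var 4) (lowbit_exp (ld 6 (Var 4)))"
  let ?I = "\<lambda>k s. \<forall>u<k. arr s 6 0 u = arr s 4 0 u + 1 \<and> arr s 7 0 u = lowbit (arr s 6 0 u)"
  show "wp (Loop 4 1 ?c) (?I n) s"
  proof (rule wp_Loop[where I = ?I])
    fix k s' assume k: "k < lim 1" and inv: "?I k s'" and v: "var s' 4 = k" and f: "frame (Loop 4 1 ?c) s s'"
    have kn: "k < n" using k by (simp add: lim_def)
    have "arr s' 4 0 = arr s 4 0" using f by (simp add: frame_def)
    then have "arr s' 4 0 k < n" using numbered_tree.lo_less[OF lo kn] by simp
    then show "wp ?c (\<lambda>s''. ?I (Suc k) (setv 4 (Suc k) s'')) s'"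
      using v kn inv bounds by (auto simp: lowbit_exp less_Suc_eq)
  qed (use assms in \<open>auto simp: base_def lim_def\<close>)
next
  let ?c1 = "st 6 (Var 4) (plus1 (ld 4 (Var 4))) ;; st 7 (Var 4) (lowbit_exp (ld 6 (Var 4)))"
  let ?c = "Asg 5 (ld 2 (Var 4)) ;; Cond (Eq (Var 5) (Var 2)) Nop
       (Asg 6 (ld 0 (Var 5)) ;;
        Cond (Lt (ld 7 (Var 6)) (ld 7 (Var 5))) (st 6 (Var 6) (ld 6 (Var 5)) ;; st 7 (Var 6) (ld 7 (Var 5))) Nop)"
  fix s1 assume s1: "\<forall>u<n. arr s1 6 0 u = arr s1 4 0 u + 1 \<and> arr s1 7 0 u = lowbit (arr s1 6 0 u)"
    and f1: "frame (Loop 4 1 ?c1) s s1"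
  have b1: "base s1" using base_frame[OF assms(1) f1] by simp
  have Q1: "topological (arr s1 2 0)" and lo1: "numbered_tree n r pa E (arr s1 4 0) (arr s1 3 0)"
    using Q lo f1 by (simp_all add: frame_def)
  let ?I = "\<lambda>k s. inlabeling (arr s 4 0) (below (arr s 2 0) k) (arr s 6 0) \<and> (\<forall>v<n. arr s 7 0 v = lowbit (arr s 6 0 v))"
  show "wp (Loop 4 1 ?c) (\<lambda>s. labeled_numbering n r pa E (arr s 4 0) (arr s 3 0) (arr s 6 0) \<and>
    (\<forall>v<n. arr s 7 0 v = lowbit (arr s 6 0 v))) s1"
  proof (rule wp_Loop[where I = ?I])
    fix k s' assume k: "k < lim 1" and inv: "?I k s'" and v: "var s' 4 = k" and f: "frame (Loop 4 1 ?c) s1 s'"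
    have b: "base s'" using base_frame[OF b1 f] by simp
    have kn: "k < n" using k by (simp add: lim_def)
    have Q': "topological (arr s' 2 0)" using Q1 f by (simp add: frame_def)
    note node = topological_node[OF Q' kn] and st = inlabeling_step[OF Q' kn conjunct1[OF inv]]
    show "wp ?c (\<lambda>s''. ?I (Suc k) (setv 4 (Suc k) s'')) s'"
      using b v kn node st bounds inv by (cases "arr s' 2 0 k = r") (simp_all add: base_def)
  next
    fix s' assume I: "?I (lim 1) s'" and f: "frame (Loop 4 1 ?c) s1 s'"
    have "numbered_tree n r pa E (arr s' 4 0) (arr s' 3 0)" "below (arr s' 2 0) n = {..<n}"
      using lo1 below_n[OF Q1] f by (simp_all add: frame_def)
    then show "labeled_numbering n r pa E (arr s' 4 0) (arr s' 3 0) (arr s' 6 0) \<and>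
      (\<forall>v<n. arr s' 7 0 v = lowbit (arr s' 6 0 v))"
      using I numbered_tree.inlabeling_final by (simp add: lim_def)
  qed (use s1 b1 inlabeling_init in \<open>auto simp: base_def lim_def\<close>)
qed

end

section \<open>Slots for the partial products\<close>

definition ph_product :: hcom where
  "ph_product = Loop 8 3 (ELd 1 (plus1 (Var 8)) (Var 6) ;; EMulA 1 1 0 ;; ESt (plus1 (Var 8)) (Var 5) 1)"

text \<open>Register 10 enters with \<open>m + 1\<close>, meaning that no match has been found;
  testing for this value keeps the least match.\<close>

definition ph_scan :: hcom where
  "ph_scan = Loop 9 3 (Cond (Eq (Var 10) (Var 3))
     (ELd 2 (plus1 (Var 9)) (Var 5) ;; Cond (EEq 1 2) (Asg 10 (Var 9)) Nop) Nop)"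

definition ph_first :: hcom where
  "ph_first = Loop 8 3 (ELd 1 (plus1 (Var 8)) (Var 5) ;; Asg 10 (Var 3) ;; ph_scan ;; St 8 (Var 8) (Var 5) (Var 10))"

definition ph_moved :: hcom where
  "ph_moved = Loop 8 3 (Cond (Eq (Ld 8 (Var 8) (Var 5)) (Var 8)) Nop (Asg 11 (Var 8)))"

text \<open>Slot \<open>m\<close> is its own target exactly if no proper slot holds the label. Only
  then is a freed slot needed.\<close>

definition ph_relocate :: hcom where
  "ph_relocate = Cond (Eq (Ld 8 (Var 0) (Var 5)) (Var 0))
     (ph_moved ;; ESt (plus1 (Var 11)) (Var 5) 0 ;; St 8 (Var 0) (Var 5) (Var 11)) Nop"

definition ph_mask :: hcom where
  "ph_mask = Loop 8 3 (Cond (Eq (Ld 8 (Var 8) (Var 5)) (Var 8)) (St 9 (Var 8) (Var 5) (Ld 9 (Var 8) (Var 6)))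
     (St 9 (Var 8) (Var 5) (Bin BitOr (Ld 9 (Var 8) (Var 6)) (Bin Div Top (ld 7 (Var 5))))))"

text \<open>Slot \<open>m\<close> stands for the empty product, which has no value in a semigroup;
  the result of \<open>ph_product\<close> for it is therefore overwritten by the label
  itself.\<close>

definition ph_node :: hcom where
  "ph_node = ELd 0 (Lit 0) (Var 5) ;; ph_product ;; ESt (plus1 (Var 0)) (Var 5) 0 ;; ph_first ;; ph_relocate ;; ph_mask"

text \<open>Slot values at the root stay as found in memory: no product of edges ends there, and
  only their membership in \<open>S\<close> is used.\<close>

definition ph_root :: hcom where
  "ph_root = Loop 8 3 (St 8 (Var 8) (Var 5) (Var 8) ;; St 9 (Var 8) (Var 5) (Lit 0))"

definition ph_slots :: hcom where
  "ph_slots = Loop 4 1 (Asg 5 (ld 2 (Bin Sub (minus1 (Var 1)) (Var 4))) ;;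
     Cond (Eq (Var 5) (Var 2)) ph_root (Asg 6 (ld 0 (Var 5)) ;; ph_node))"

text \<open>Nodes come with children first, so the entry of a class is the topmost marked node so
  far, which for the current node is the next one below it. The current node then replaces it if
  marked.\<close>

definition ph_head :: hcom where
  "ph_head = Loop 4 1 (St 11 (Var 8) (Var 4) (Var 1)) ;;
     Loop 4 1 (Asg 5 (ld 2 (Var 4)) ;; St 10 (Var 8) (Var 5) (Ld 11 (Var 8) (minus1 (ld 6 (Var 5)))) ;;
       Cond (Eq (Ld 8 (Var 8) (Var 5)) (Var 8)) Nop (St 11 (Var 8) (minus1 (ld 6 (Var 5))) (Var 5)))"

definition ph_heads :: hcom where
  "ph_heads = Loop 8 3 ph_head"

text \<open>The two final stores keep \<open>n\<close> and \<open>m\<close> for queries, which are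
  passed nothing but \<open>x\<close> and \<open>y\<close>. \<open>n\<close> goes to address 0,
  which can be read without knowing \<open>n\<close>.\<close>

definition ph_build :: hcom where
  "ph_build = Asg 3 (plus1 (Var 0)) ;; ph_count ;; ph_queue ;; ph_peel ;; ph_size ;; ph_number ;;
     ph_inlabel ;; ph_slots ;; ph_heads ;; st 0 (Lit 0) (Var 1) ;; st 1 (Lit 0) (Var 0)"

lemmas ph_defs = ph_product_def ph_scan_def ph_first_def ph_moved_def ph_relocate_def ph_mask_def ph_node_def ph_root_def

section \<open>Correctness of the slot phases\<close>

locale slot_builder = builder w n m M mul r pa E
  for w n m M :: nat and mul :: "'a \<Rightarrow> 'a \<Rightarrow> 'a" and r :: nat and pa E +
  fixes S :: "'a set" and lab :: "nat \<Rightarrow> 'a"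
  assumes finite_S: "finite S" and card_S: "card S = m"
    and closed: "\<And>a b. a \<in> S \<Longrightarrow> b \<in> S \<Longrightarrow> mul a b \<in> S"
    and lab: "\<And>v. v < n \<Longrightarrow> v \<noteq> r \<Longrightarrow> lab v \<in> S"
begin

definition elems_ok :: "'a hstate \<Rightarrow> bool" where
  "elems_ok s \<longleftrightarrow> (\<forall>v<n. v \<noteq> r \<longrightarrow> earr s 0 v = lab v) \<and> (\<forall>i\<le>m. \<forall>v<n. earr s (i + 1) v \<in> S)"

text \<open>The value of slot \<open>i\<close> at node \<open>v\<close> is \<open>e (i + 1) v\<close>. A partial product in slot \<open>i\<close> at the
  parent of \<open>v\<close> continues in slot \<open>tg i v\<close> at \<open>v\<close>, and the products starting with the edge
  into \<open>v\<close> begin in slot \<open>tg m v\<close>.\<close>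

definition slot_step :: "(nat \<Rightarrow> nat \<Rightarrow> 'a) \<Rightarrow> (nat \<Rightarrow> nat \<Rightarrow> nat) \<Rightarrow> nat \<Rightarrow> bool" where
  "slot_step e tg v \<longleftrightarrow>
     (\<forall>i<m. tg i v \<le> i \<and> e (tg i v + 1) v = mul (e (i + 1) (pa v)) (lab v)) \<and>
     tg m v < m \<and> e (tg m v + 1) v = lab v"

definition at_node :: "nat \<Rightarrow> 'a hstate \<Rightarrow> bool" where
  "at_node v s \<longleftrightarrow> base s \<and> var s 5 = v \<and> var s 6 = pa v \<and> v < n \<and> v \<noteq> r \<and> pa v < n \<and> pa v \<noteq> v"

lemma at_node_frame: "at_node v s \<Longrightarrow> frame c s s' \<Longrightarrow> mods c \<inter> {0, 1, 2, 3, 5, 6} = {} \<Longrightarrow> 0 \<notin> kinds c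
    \<Longrightarrow> at_node v s'"
  using base_frame[of s c s'] by (auto simp: at_node_def frame_def)

lemma slot_bounds: "i \<le> m \<Longrightarrow> Suc i < 2 ^ w"
  using m_bound by auto

lemma frame_arr: "frame c s s' \<Longrightarrow> kinds c = {} \<Longrightarrow> arr s' = arr s"
  by (auto simp: frame_def)

lemma wp_product:
  assumes "at_node v s"
  shows "wp ph_product (\<lambda>t. evar t 0 = evar s 0 \<and> earr t =
    (\<lambda>i u. if u = v \<and> 1 \<le> i \<and> i \<le> m + 1 then mul (earr s i (pa v)) (evar s 0) else earr s i u)) s"
  unfolding ph_product_def
proof (rule wp_Loop[where I = "\<lambda>k t. evar t 0 = evar s 0 \<and> earr t =
    (\<lambda>i u. if u = v \<and> 1 \<le> i \<and> i \<le> k then mul (earr s i (pa v)) (evar s 0) else earr s i u)"])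
  let ?c = "ELd 1 (plus1 (Var 8)) (Var 6) ;; EMulA 1 1 0 ;; ESt (plus1 (Var 8)) (Var 5) 1"
  let ?I = "\<lambda>k t. evar t 0 = evar s 0 \<and> earr t =
    (\<lambda>i u. if u = v \<and> 1 \<le> i \<and> i \<le> k then mul (earr s i (pa v)) (evar s 0) else earr s i u)"
  fix k t assume k: "k < lim 3" and I: "?I k t" and v: "var t 8 = k" and f: "frame (Loop 8 3 ?c) s t"
  have t: "at_node v t" using at_node_frame[OF assms f] by simp
  have km: "k \<le> m" using k by (simp add: lim_def)
  have step: "(earr t)(Suc k := (earr t (Suc k))(v := mul (earr t (Suc k) (pa v)) (evar s 0))) =
     (\<lambda>i u. if u = v \<and> 1 \<le> i \<and> i \<le> Suc k then mul (earr s i (pa v)) (evar s 0) else earr s i u)"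
    using I t by (auto simp: fun_eq_iff at_node_def le_Suc_eq)
  show "wp ?c (\<lambda>t'. ?I (Suc k) (setv 8 (Suc k) t')) t"
    using conjunct1[OF I] t v km slot_bounds[OF km] step by (simp add: at_node_def base_def)
qed (use assms in \<open>auto simp: at_node_def base_def lim_def fun_eq_iff\<close>)

definition is_first :: "(nat \<Rightarrow> 'a) \<Rightarrow> nat \<Rightarrow> nat \<Rightarrow> bool" where
  "is_first g i x \<longleftrightarrow> g x = g i \<and> (\<forall>j<x. g j \<noteq> g i)"

lemma is_first_le: "is_first g i x \<Longrightarrow> x \<le> i"
  unfolding is_first_def by (rule leI) auto

lemma wp_first:
  assumes "at_node v s"
  shows "wp ph_first (\<lambda>t. evar t 0 = evar s 0 \<and> (\<forall>i\<le>m. is_first (\<lambda>j. earr s (j + 1) v) i (arr t 8 i v)) \<and>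
    (\<forall>i u. u \<noteq> v \<longrightarrow> arr t 8 i u = arr s 8 i u)) s"
  unfolding ph_first_def
proof (rule wp_Loop[where I = "\<lambda>k t. evar t 0 = evar s 0 \<and>
    (\<forall>i<k. is_first (\<lambda>j. earr s (j + 1) v) i (arr t 8 i v)) \<and> (\<forall>i u. u \<noteq> v \<longrightarrow> arr t 8 i u = arr s 8 i u)"])
  let ?b = "Cond (Eq (Var 10) (Var 3))
       (ELd 2 (plus1 (Var 9)) (Var 5) ;; Cond (EEq 1 2) (Asg 10 (Var 9)) Nop) Nop"
  let ?c = "ELd 1 (plus1 (Var 8)) (Var 5) ;; Asg 10 (Var 3) ;; ph_scan ;; St 8 (Var 8) (Var 5) (Var 10)"
  let ?g = "\<lambda>j. earr s (j + 1) v"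
  let ?I = "\<lambda>k t. evar t 0 = evar s 0 \<and> (\<forall>i<k. is_first ?g i (arr t 8 i v)) \<and>
    (\<forall>i u. u \<noteq> v \<longrightarrow> arr t 8 i u = arr s 8 i u)"
  fix k t assume k: "k < lim 3" and I: "?I k t" and v: "var t 8 = k" and f: "frame (Loop 8 3 ?c) s t"
  have t: "at_node v t" using at_node_frame[OF assms f] by (simp add: ph_scan_def)
  have et: "earr t = earr s" using f by (simp add: frame_def ph_scan_def)
  have km: "k \<le> m" using k by (simp add: lim_def)
  let ?t = "setv 10 (m + 1) (t\<lparr>evar := (evar t)(1 := ?g k)\<rparr>)"
  let ?J = "\<lambda>j t'. evar t' 0 = evar s 0 \<and> evar t' 1 = ?g k \<and>
    (var t' 10 = m + 1 \<and> (\<forall>i<j. ?g i \<noteq> ?g k) \<or> var t' 10 < j \<and> is_first ?g k (var t' 10))"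
  have "wp ph_scan (\<lambda>t'. ?J (m + 1) t' \<and> frame ph_scan ?t t') ?t"
    unfolding ph_scan_def
  proof (rule wp_frame, rule wp_Loop[where I = ?J])
    fix j t' assume j: "j < lim 3" and J: "?J j t'" and vj: "var t' 9 = j" and f': "frame (Loop 9 3 ?b) ?t t'"
    have "at_node v ?t" using t by (simp add: at_node_def base_def)
    then have t': "at_node v t'" using at_node_frame[OF _ f'] by simp
    have et': "earr t' = earr s" using f' et by (simp add: frame_def)
    have jm: "j \<le> m" using j by (simp add: lim_def)
    show "wp ?b (\<lambda>t''. ?J (Suc j) (setv 9 (Suc j) t'')) t'"
      using J t' et' vj jm slot_bounds[OF jm] by (auto simp: at_node_def base_def is_first_def less_Suc_eq)
  qed (use t I in \<open>auto simp: at_node_def base_def lim_def\<close>)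
  then have "wp ph_scan (wp (St 8 (Var 8) (Var 5) (Var 10)) (\<lambda>t'. ?I (Suc k) (setv 8 (Suc k) t'))) ?t"
  proof (rule wp_mono)
    fix t' assume t': "?J (m + 1) t' \<and> frame ph_scan ?t t'"
    then have f': "frame ph_scan ?t t'" by blast
    have "var t' 8 = k" "var t' 5 = v" "arr t' = arr t"
      using f' v t frame_arr[OF f'] by (simp_all add: frame_def at_node_def ph_scan_def)
    \<comment> \<open>Slot \<open>k\<close> matches itself and is scanned, so register 10 cannot
      still hold \<open>m + 1\<close>.\<close>
    moreover have "is_first ?g k (var t' 10)" using t' km by (auto simp: less_Suc_eq_le)
    ultimately show "wp (St 8 (Var 8) (Var 5) (Var 10)) (\<lambda>t'. ?I (Suc k) (setv 8 (Suc k) t')) t'"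
      using t' I km t by (auto simp: at_node_def less_Suc_eq)
  qed
  then show "wp ?c (\<lambda>t'. ?I (Suc k) (setv 8 (Suc k) t')) t"
    using v t km slot_bounds[OF km] by (simp add: at_node_def base_def et)
qed (use assms in \<open>auto simp: at_node_def base_def lim_def less_Suc_eq_le\<close>)

text \<open>If a proper slot holds the label, slot \<open>m\<close> already points to it. Otherwise
  two of the \<open>m + 1\<close> values agree, the larger of these slots is merged away, and a slot
  merged away may be overwritten since it is the target of none.\<close>

lemma wp_relocate:
  assumes "at_node v s" and c: "evar s 0 = lab v" and g: "\<And>i. i \<le> m \<Longrightarrow> earr s (i + 1) v \<in> S"
    and prod: "\<And>i. i < m \<Longrightarrow> earr s (i + 1) v = mul (e (i + 1) (pa v)) (lab v)"
    and last: "earr s (m + 1) v = lab v"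
    and first: "\<And>i. i \<le> m \<Longrightarrow> is_first (\<lambda>j. earr s (j + 1) v) i (arr s 8 i v)"
    and eq: "\<And>i u. u \<noteq> v \<Longrightarrow> earr s i u = e i u"
  shows "wp ph_relocate (\<lambda>t. slot_step (earr t) (arr t 8) v \<and> (\<forall>i. i \<le> m \<longrightarrow> earr t (i + 1) v \<in> S) \<and>
    (\<forall>i u. u \<noteq> v \<longrightarrow> arr t 8 i u = arr s 8 i u) \<and> (\<forall>i u. u \<noteq> v \<or> i = 0 \<longrightarrow> earr t i u = earr s i u)) s"
proof -
  let ?tg = "\<lambda>i. arr s 8 i v" and ?g = "\<lambda>j. earr s (j + 1) v"
  have pv: "pa v \<noteq> v" using assms(1) by (simp add: at_node_def)
  have le: "?tg i \<le> i" "?g (?tg i) = ?g i" if "i \<le> m" for i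
    using first[OF that] is_first_le by (auto simp: is_first_def)
  \<comment> \<open>Targets are fixed points, so a slot that moves elsewhere receives no
    product.\<close>
  have idem: "?tg (?tg i) = ?tg i" if "i \<le> m" for i
  proof -
    have "?tg i \<le> m" using le[OF that] that by simp
    then have "?tg (?tg i) \<le> ?tg i" "?g (?tg (?tg i)) = ?g i" using le[of "?tg i"] le[OF that] by auto
    then show ?thesis using first[OF that] unfolding is_first_def by (metis le_neq_implies_less)
  qed
  let ?Q = "\<lambda>t. slot_step (earr t) (arr t 8) v \<and> (\<forall>i. i \<le> m \<longrightarrow> earr t (i + 1) v \<in> S) \<and>
    (\<forall>i u. u \<noteq> v \<longrightarrow> arr t 8 i u = arr s 8 i u) \<and> (\<forall>i u. u \<noteq> v \<or> i = 0 \<longrightarrow> earr t i u = earr s i u)"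
  show ?thesis
  proof (cases "?tg m = m")
    case False
    have "slot_step (earr s) (arr s 8) v"
      unfolding slot_step_def using le prod last False eq pv
      by (metis le_neq_implies_less less_imp_le_nat order_refl)
    then have "?Q s" using g by simp
    then show ?thesis using False assms(1) by (simp add: ph_relocate_def at_node_def base_def)
  next
    case True
    have "\<not> inj_on ?g {..m}"
    proof
      assume "inj_on ?g {..m}"
      then have "card {..m} \<le> card S" using g finite_S by (intro card_inj_on_le) auto
      then show False using card_S by simp
    qed
    then obtain i j where ij: "i \<le> m" "j \<le> m" "i < j" "?g i = ?g j"
      unfolding inj_on_def by (metis atMost_iff linorder_neqE_nat)
    then have dup: "?tg j \<noteq> j" using first[of j] by (auto simp: is_first_def)
    let ?b = "Cond (Eq (Ld 8 (Var 8) (Var 5)) (Var 8)) Nop (Asg 11 (Var 8))"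
    let ?I = "\<lambda>k t. (\<exists>i<k. ?tg i \<noteq> i) \<longrightarrow> var t 11 < k \<and> ?tg (var t 11) \<noteq> var t 11"
    have "wp ph_moved (\<lambda>t. (?I (m + 1) t \<and> evar t = evar s) \<and> frame ph_moved s t) s"
      unfolding ph_moved_def
    proof (rule wp_frame, rule wp_Loop[where I = "\<lambda>k t. ?I k t \<and> evar t = evar s"])
      fix k t assume k: "k < lim 3" and I: "?I k t \<and> evar t = evar s" and v: "var t 8 = k"
        and f: "frame (Loop 8 3 ?b) s t"
      have t: "at_node v t" using at_node_frame[OF assms(1) f] by simp
      have "arr t = arr s" using frame_arr[OF f] by simp
      then show "wp ?b (\<lambda>t'. ?I (Suc k) (setv 8 (Suc k) t') \<and> evar (setv 8 (Suc k) t') = evar s) t"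
        using I v k t by (auto simp: lim_def at_node_def less_Suc_eq)
    qed (use assms(1) in \<open>auto simp: at_node_def base_def lim_def\<close>)
    then have "wp ph_moved (wp (ESt (plus1 (Var 11)) (Var 5) 0 ;; St 8 (Var 0) (Var 5) (Var 11)) ?Q) s"
    proof (rule wp_mono)
      fix t assume t: "(?I (m + 1) t \<and> evar t = evar s) \<and> frame ph_moved s t"
      then have f: "frame ph_moved s t" by blast
      have nt: "at_node v t" using at_node_frame[OF assms(1) f] by (simp add: ph_moved_def)
      have ar: "arr t = arr s" "earr t = earr s" using frame_arr[OF f] f by (simp_all add: frame_def ph_moved_def)
      let ?s = "var t 11"
      have s: "?s \<le> m" "?tg ?s \<noteq> ?s" using t dup ij(2) by (auto simp: less_Suc_eq_le)
      then have sm: "?s < m" using True by (metis le_neq_implies_less)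
      let ?e = "(earr s)(Suc ?s := (earr s (Suc ?s))(v := lab v))"
      let ?a = "(arr s 8)(m := (arr s 8 m)(v := ?s))"
      have "slot_step ?e ?a v"
        unfolding slot_step_def
      proof (intro conjI allI impI)
        fix i assume i: "i < m"
        have "?tg i \<noteq> ?s" using idem[of i] s i by auto
        then show "?e (?a i v + 1) v = mul (?e (i + 1) (pa v)) (lab v)"
          using i le[of i] prod[OF i] eq[OF pv] pv by auto
      qed (use sm le in auto)
      moreover have "?e (i + 1) v \<in> S" if "i \<le> m" for i
        using g[OF that] lab assms(1) by (auto simp: at_node_def)
      ultimately show "wp (ESt (plus1 (Var 11)) (Var 5) 0 ;; St 8 (Var 0) (Var 5) (Var 11)) ?Q t"
        using nt t c s(1) slot_bounds[OF s(1)] by (simp add: ar at_node_def base_def)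
    qed
    then show ?thesis using True assms(1) by (simp add: ph_relocate_def at_node_def base_def)
  qed
qed

definition mask_step :: "'a hstate \<Rightarrow> nat \<Rightarrow> nat \<Rightarrow> bool" where
  "mask_step s v i \<longleftrightarrow> arr s 9 i v = (if arr s 8 i v = i then arr s 9 i (pa v)
     else Bit_Operations.or (arr s 9 i (pa v)) (2 ^ (w - 1) div arr s 7 0 v))"

lemma wp_mask:
  assumes "at_node v s"
  shows "wp ph_mask (\<lambda>t. (\<forall>i\<le>m. mask_step t v i) \<and> (\<forall>i u. u \<noteq> v \<longrightarrow> arr t 9 i u = arr s 9 i u)) s"
  unfolding ph_mask_def
proof (rule wp_Loop[where I = "\<lambda>k t. (\<forall>i<k. mask_step t v i) \<and> (\<forall>i u. u \<noteq> v \<longrightarrow> arr t 9 i u = arr s 9 i u)"])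
  let ?c = "Cond (Eq (Ld 8 (Var 8) (Var 5)) (Var 8)) (St 9 (Var 8) (Var 5) (Ld 9 (Var 8) (Var 6)))
     (St 9 (Var 8) (Var 5) (Bin BitOr (Ld 9 (Var 8) (Var 6)) (Bin Div Top (ld 7 (Var 5)))))"
  let ?I = "\<lambda>k t. (\<forall>i<k. mask_step t v i) \<and> (\<forall>i u. u \<noteq> v \<longrightarrow> arr t 9 i u = arr s 9 i u)"
  fix k t assume k: "k < lim 3" and I: "?I k t" and v: "var t 8 = k" and f: "frame (Loop 8 3 ?c) s t"
  have t: "at_node v t" using at_node_frame[OF assms f] by simp
  have km: "k \<le> m" using k by (simp add: lim_def)
  show "wp ?c (\<lambda>t'. ?I (Suc k) (setv 8 (Suc k) t')) t"
    using I t v km by (auto simp: at_node_def mask_step_def less_Suc_eq)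
qed (use assms in \<open>auto simp: at_node_def base_def lim_def less_Suc_eq_le\<close>)

definition columns :: "nat \<Rightarrow> 'a hstate \<Rightarrow> 'a hstate \<Rightarrow> bool" where
  "columns v s t \<longleftrightarrow> (\<forall>kd i u. u \<noteq> v \<longrightarrow> arr t kd i u = arr s kd i u) \<and>
     (\<forall>i u. u \<noteq> v \<or> i = 0 \<longrightarrow> earr t i u = earr s i u)"

lemma wp_node:
  assumes "at_node v s" "elems_ok s"
  shows "wp ph_node (\<lambda>t. columns v s t \<and> slot_step (earr t) (arr t 8) v \<and> (\<forall>i\<le>m. mask_step t v i) \<and>
    (\<forall>i\<le>m. earr t (i + 1) v \<in> S)) s"
proof -
  let ?Q = "\<lambda>t. columns v s t \<and> slot_step (earr t) (arr t 8) v \<and> (\<forall>i\<le>m. mask_step t v i) \<and>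
    (\<forall>i\<le>m. earr t (i + 1) v \<in> S)"
  have v: "v < n" "v \<noteq> r" "pa v < n" "pa v \<noteq> v" using assms(1) by (simp_all add: at_node_def)
  let ?s = "s\<lparr>evar := (evar s)(0 := lab v)\<rparr>"
  have s: "at_node v ?s" using assms(1) by (simp add: at_node_def base_def)
  have "wp (ph_product ;; ESt (plus1 (Var 0)) (Var 5) 0 ;; ph_first ;; ph_relocate ;; ph_mask) ?Q ?s"
  proof (rule wp_seqI[OF wp_product[OF s]], erule conjE)
    fix s1 assume e1: "evar s1 0 = evar ?s 0" "earr s1 = (\<lambda>i u. if u = v \<and> 1 \<le> i \<and> i \<le> m + 1
        then mul (earr ?s i (pa v)) (evar ?s 0) else earr ?s i u)"
      and f1: "frame ph_product ?s s1"
    have n1: "at_node v s1" using at_node_frame[OF s f1] by (simp add: ph_defs)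
    have a1: "arr s1 = arr s" using frame_arr[OF f1] by (simp add: ph_defs)
    let ?s2 = "s1\<lparr>earr := (earr s1)(m + 1 := (earr s1 (m + 1))(v := lab v))\<rparr>"
    have n2: "at_node v ?s2" using n1 by (simp add: at_node_def base_def)
    have e2: "earr ?s2 (i + 1) v = mul (earr s (i + 1) (pa v)) (lab v)" if "i < m" for i
      using that e1 by simp
    have e2m: "earr ?s2 (m + 1) v = lab v" by simp
    have e2o: "earr ?s2 i u = earr s i u" if "u \<noteq> v \<or> i = 0" for i u
      using that e1 by auto
    have e2S: "earr ?s2 (i + 1) v \<in> S" if "i \<le> m" for i
    proof (cases "i = m")
      case True
      then show ?thesis using e2m lab[OF v(1,2)] by simp
    next
      case False
      then have "earr s (i + 1) (pa v) \<in> S" using assms(2) that v by (simp add: elems_ok_def)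
      then show ?thesis using e2[of i] False that closed lab[OF v(1,2)] by simp
    qed
    have "wp (ph_first ;; ph_relocate ;; ph_mask) ?Q ?s2"
    proof (rule wp_seqI[OF wp_first[OF n2]], (erule conjE)+)
      fix s3 assume e3: "evar s3 0 = evar ?s2 0" and first: "\<forall>i\<le>m. is_first (\<lambda>j. earr ?s2 (j + 1) v) i (arr s3 8 i v)"
        and a3: "\<forall>i u. u \<noteq> v \<longrightarrow> arr s3 8 i u = arr ?s2 8 i u" and f3: "frame ph_first ?s2 s3"
      have n3: "at_node v s3" using at_node_frame[OF n2 f3] by (simp add: ph_defs)
      have es3: "earr s3 = earr ?s2" and as3: "\<And>kd. kd \<noteq> 8 \<Longrightarrow> arr s3 kd = arr s kd"
        using f3 by (simp_all add: frame_def ph_defs a1)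
      show "wp (ph_relocate ;; ph_mask) ?Q s3"
      proof (rule wp_seqI[OF wp_relocate[OF n3, where e = "earr s"]], goal_cases)
        case (7 s4)
        have n4: "at_node v s4" using at_node_frame[OF n3 7(2)] by (simp add: ph_defs)
        have as4: "\<And>kd. kd \<noteq> 8 \<Longrightarrow> arr s4 kd = arr s kd"
          using 7(2) as3 by (simp add: frame_def ph_defs)
        have step4: "slot_step (earr s4) (arr s4 8) v" and S4: "\<forall>i\<le>m. earr s4 (i + 1) v \<in> S"
          and a4: "\<forall>i u. u \<noteq> v \<longrightarrow> arr s4 8 i u = arr s3 8 i u"
          and e4: "\<forall>i u. u \<noteq> v \<or> i = 0 \<longrightarrow> earr s4 i u = earr s3 i u"
          using 7(1) by blast+
        have a84: "\<forall>i u. u \<noteq> v \<longrightarrow> arr s4 8 i u = arr s 8 i u" using a4 a3 a1 by simp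
        have e84: "\<forall>i u. u \<noteq> v \<or> i = 0 \<longrightarrow> earr s4 i u = earr s i u" using e4 e2o es3 by simp
        show ?case
        proof (rule wp_mono[OF wp_frame[OF wp_mask[OF n4]]])
          fix t assume t: "((\<forall>i\<le>m. mask_step t v i) \<and> (\<forall>i u. u \<noteq> v \<longrightarrow> arr t 9 i u = arr s4 9 i u)) \<and>
            frame ph_mask s4 t"
          have at: "\<And>kd. kd \<noteq> 9 \<Longrightarrow> arr t kd = arr s4 kd" and et: "earr t = earr s4"
            using t by (simp_all add: frame_def ph_defs)
          have "arr t kd i u = arr s kd i u" if "u \<noteq> v" for kd i u
            using that t at[of kd] as4[of kd] a84 by (cases "kd = 9"; cases "kd = 8") auto
          then have "columns v s t" using e84 et by (simp add: columns_def)
          then show "?Q t" using t step4 S4 at[of 8] et by simp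
        qed
      qed (use e1 e3 e2 e2m e2o e2S first in \<open>simp_all add: es3\<close>)
    qed
    then show "wp (ESt (plus1 (Var 0)) (Var 5) 0 ;; ph_first ;; ph_relocate ;; ph_mask) ?Q s1"
      using n1 e1(1) slot_bounds[of m] by (simp add: at_node_def base_def)
  qed
  then show ?thesis
    using assms v by (simp add: ph_node_def at_node_def base_def elems_ok_def)
qed

definition slots_ok :: "nat set \<Rightarrow> 'a hstate \<Rightarrow> bool" where
  "slots_ok D s \<longleftrightarrow> (r \<in> D \<longrightarrow> (\<forall>i\<le>m. arr s 8 i r = i \<and> arr s 9 i r = 0)) \<and>
     (\<forall>v\<in>D. v \<noteq> r \<longrightarrow> slot_step (earr s) (arr s 8) v \<and> (\<forall>i\<le>m. mask_step s v i))"

text \<open>The conditions at a node concern only its own column and that of its parent. Neither is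
  \<open>v\<close>, as no child of \<open>v\<close> has been visited.\<close>

lemma slots_ok_columns:
  assumes "slots_ok D s" "columns v s t" "v \<notin> D" "children v \<inter> D = {}" "D \<subseteq> {..<n}"
    and "arr t 7 = arr s 7"
  shows "slots_ok D t"
proof -
  have pu: "pa u \<noteq> v" if "u \<in> D" "u \<noteq> r" for u using that assms(4,5) by (auto simp: children_def)
  have same: "arr t kd i u = arr s kd i u" "earr t i u = earr s i u" if "u \<noteq> v" for kd i u
    using assms(2) that by (auto simp: columns_def)
  have "slot_step (earr t) (arr t 8) u" "\<forall>i\<le>m. mask_step t u i" if u: "u \<in> D" "u \<noteq> r" for u
  proof -
    have "u \<noteq> v" using u assms(3) by blast
    moreover have "slot_step (earr s) (arr s 8) u" "\<forall>i\<le>m. mask_step s u i"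
      using assms(1) u by (auto simp: slots_ok_def)
    ultimately show "slot_step (earr t) (arr t 8) u" "\<forall>i\<le>m. mask_step t u i"
      using same pu[OF u] assms(6) by (simp_all add: slot_step_def mask_step_def)
  qed
  moreover have "\<forall>i\<le>m. arr t 8 i r = i \<and> arr t 9 i r = 0" if "r \<in> D"
  proof -
    have "r \<noteq> v" using that assms(3) by blast
    then show ?thesis using assms(1) same that by (simp add: slots_ok_def)
  qed
  ultimately show ?thesis by (simp add: slots_ok_def)
qed

lemma wp_root:
  assumes "base s" "var s 5 = r"
  shows "wp ph_root (\<lambda>t. columns r s t \<and> (\<forall>i\<le>m. arr t 8 i r = i \<and> arr t 9 i r = 0)) s"
  unfolding ph_root_def
proof (rule wp_Loop[where I = "\<lambda>k t. columns r s t \<and> (\<forall>i<k. arr t 8 i r = i \<and> arr t 9 i r = 0)"])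
  let ?c = "St 8 (Var 8) (Var 5) (Var 8) ;; St 9 (Var 8) (Var 5) (Lit 0)"
  let ?I = "\<lambda>k t. columns r s t \<and> (\<forall>i<k. arr t 8 i r = i \<and> arr t 9 i r = 0)"
  fix k t assume k: "k < lim 3" and I: "?I k t" and v: "var t 8 = k" and f: "frame (Loop 8 3 ?c) s t"
  have "base t" "var t 5 = r" using base_frame[OF assms(1) f] f assms(2) by (simp_all add: frame_def)
  then show "wp ?c (\<lambda>t'. ?I (Suc k) (setv 8 (Suc k) t')) t"
    using I v k root_less by (auto simp: lim_def base_def columns_def less_Suc_eq)
qed (use assms in \<open>auto simp: base_def lim_def columns_def less_Suc_eq_le\<close>)

lemma wp_slots:
  assumes "base s" "elems_ok s" and Q: "topological (arr s 2 0)"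
  shows "wp ph_slots (\<lambda>t. slots_ok {..<n} t \<and> elems_ok t) s"
  unfolding ph_slots_def
proof (rule wp_Loop[where I = "\<lambda>k t. slots_ok (above (arr s 2 0) k) t \<and> elems_ok t"])
  let ?c = "Asg 5 (ld 2 (Bin Sub (minus1 (Var 1)) (Var 4))) ;;
     Cond (Eq (Var 5) (Var 2)) ph_root (Asg 6 (ld 0 (Var 5)) ;; ph_node)"
  let ?D = "above (arr s 2 0)"
  let ?I = "\<lambda>k t. slots_ok (?D k) t \<and> elems_ok t"
  fix k t assume k: "k < lim 1" and I: "?I k t" and vk: "var t 4 = k" and f: "frame (Loop 4 1 ?c) s t"
  have b: "base t" using base_frame[OF assms(1) f] by (simp add: ph_defs)
  have kn: "k < n" using k by (simp add: lim_def)
  have Qt: "arr t 2 = arr s 2" using f by (simp add: frame_def ph_defs)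
  have idx: "k \<le> n - Suc 0" "n - Suc 0 < 2 ^ w" "n < 2 ^ w" "n - Suc k < n" using kn n_bound by linarith+
  let ?v = "arr s 2 0 (n - 1 - k)"
  note node = above_node[OF Q kn]
  have D: "?D (Suc k) = insert ?v (?D k)" by (rule node(2))
  have ch: "children ?v \<inter> ?D k = {}" "?v \<notin> children ?v" using node(2,5) by auto
  let ?t = "setv 5 ?v t"
  show "wp ?c (\<lambda>t'. ?I (Suc k) (setv 4 (Suc k) t')) t"
  proof (cases "?v = r")
    case True
    have "base ?t" "var ?t 5 = r" using b True by (simp_all add: base_def)
    then have "wp ph_root (\<lambda>t'. ?I (Suc k) (setv 4 (Suc k) t')) ?t"
    proof (rule wp_mono[OF wp_frame[OF wp_root]])
      fix t' assume t': "(columns r ?t t' \<and> (\<forall>i\<le>m. arr t' 8 i r = i \<and> arr t' 9 i r = 0)) \<and> frame ph_root ?t t'"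
      have "arr t' 7 = arr ?t 7" "earr t' = earr t" using t' by (simp_all add: frame_def ph_defs)
      moreover have "slots_ok (?D k) ?t" using I by (simp add: slots_ok_def mask_step_def)
      ultimately have "slots_ok (?D k) t'" "elems_ok t'"
        using slots_ok_columns[of "?D k" ?t ?v t'] t' node ch I True by (auto simp: elems_ok_def)
      then show "?I (Suc k) (setv 4 (Suc k) t')"
        using t' True by (auto simp: D slots_ok_def mask_step_def elems_ok_def)
    qed
    then show ?thesis using b vk idx Qt True by (simp add: base_def)
  next
    case False
    let ?t = "setv 6 (pa ?v) (setv 5 ?v t)"
    have pv: "pa ?v < n" "pa ?v \<noteq> ?v" using node(1,3,4,6) False by auto
    have "at_node ?v ?t" "elems_ok ?t"
      using b I pv False node(1) by (simp_all add: at_node_def base_def elems_ok_def)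
    then have "wp ph_node (\<lambda>t'. ?I (Suc k) (setv 4 (Suc k) t')) ?t"
    proof (rule wp_mono[OF wp_frame[OF wp_node]])
      fix t' assume t': "(columns ?v ?t t' \<and> slot_step (earr t') (arr t' 8) ?v \<and> (\<forall>i\<le>m. mask_step t' ?v i) \<and>
        (\<forall>i\<le>m. earr t' (i + 1) ?v \<in> S)) \<and> frame ph_node ?t t'"
      have "arr t' 7 = arr ?t 7" using t' by (simp add: frame_def ph_defs)
      moreover have "slots_ok (?D k) ?t" using I by (simp add: slots_ok_def mask_step_def)
      ultimately have sl: "slots_ok (?D k) t'"
        using slots_ok_columns[of "?D k" ?t ?v t'] t' node ch I by blast
      have "elems_ok t'"
        unfolding elems_ok_def
      proof (intro conjI allI impI)
        fix u assume "u < n" "u \<noteq> r"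
        then show "earr t' 0 u = lab u" using t' I by (auto simp: columns_def elems_ok_def)
      next
        fix i u assume iu: "i \<le> m" "u < n"
        show "earr t' (i + 1) u \<in> S"
        proof (cases "u = ?v")
          case True
          then show ?thesis using t' iu by auto
        next
          case False
          then show ?thesis using t' I iu by (auto simp: columns_def elems_ok_def)
        qed
      qed
      then show "?I (Suc k) (setv 4 (Suc k) t')"
        using sl t' False by (auto simp: D slots_ok_def mask_step_def elems_ok_def)
    qed
    then show ?thesis using b vk idx Qt False node(1) by (simp add: base_def)
  qed
qed (use assms in \<open>auto simp: base_def lim_def slots_ok_def mask_step_def elems_ok_def\<close>)

end

section \<open>Tables for finding the next marked node\<close>

context labeled_numbering
begin

definition heads :: "(nat \<Rightarrow> bool) \<Rightarrow> nat set \<Rightarrow> (nat \<Rightarrow> nat) \<Rightarrow> (nat \<Rightarrow> nat) \<Rightarrow> bool" where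
  "heads mk P hm nx \<longleftrightarrow>
     (\<forall>I<n. hm I = n \<and> (\<forall>z\<in>P. mk z \<longrightarrow> inl z - 1 \<noteq> I) \<or>
        hm I < n \<and> hm I \<in> P \<and> mk (hm I) \<and> inl (hm I) - 1 = I \<and>
          (\<forall>z\<in>P. mk z \<and> inl z - 1 = I \<longrightarrow> anc (hm I) z)) \<and>
     (\<forall>v\<in>P. next_spec mk nx v)"

text \<open>Visited nodes in the class of \<open>v\<close> lie below \<open>v\<close>: they are
  comparable with it, and an ancestor of \<open>v\<close> cannot precede it in the order. So the old
  entry is the next marked node below \<open>v\<close>, and \<open>v\<close>, if marked, is the new
  topmost one.\<close>

lemma heads_step:
  assumes Q: "topological Q" and k: "k < n" and h: "heads mk (below Q k) hm nx"
  defines "v \<equiv> Q k"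
  shows "inl v - 1 < n" "1 \<le> inl v"
    and "\<not> mk v \<Longrightarrow> heads mk (below Q (Suc k)) hm (nx(v := hm (inl v - 1)))"
    and "mk v \<Longrightarrow> heads mk (below Q (Suc k)) (hm(inl v - 1 := v)) (nx(v := hm (inl v - 1)))"
proof -
  note node = topological_node[OF Q k, folded v_def]
  let ?P = "below Q k" and ?I = "inl v - 1" and ?nx = "nx(v := hm (inl v - 1))"
  have P: "below Q (Suc k) = insert v ?P" by (simp add: below_Suc v_def)
  have Pn: "z < n" if "z \<in> ?P" for z
    using that topological_node(1)[OF Q] k by (auto simp: below_def)
  have pos: "1 \<le> inl z" if "z < n" for z using inl_interval[OF that] by simp
  show I: "?I < n" "1 \<le> inl v" using pos[OF node(1)] inl_le[OF node(1)] by linarith+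
  have desc: "z \<in> ?P" if "z < n" "anc v z" "z \<noteq> v" for z
    using below_closed[OF Q, of "Suc k" v z] that k by (simp add: P)
  have up: "anc v z" if z: "z \<in> ?P" "inl z - 1 = ?I" for z
  proof -
    have "inl z = inl v" using z(2) pos[OF Pn[OF z(1)]] I by simp
    then have "anc v z \<or> anc z v" using same_inl_comparable[OF node(1) Pn[OF z(1)]] by simp
    moreover have "\<not> anc z v" using below_closed[OF Q _ z(1) node(1)] k node(2) by auto
    ultimately show ?thesis by blast
  qed
  have new: "next_spec mk ?nx v"
  proof -
    consider "hm ?I = n" "\<forall>z\<in>?P. mk z \<longrightarrow> inl z - 1 \<noteq> ?I"
      | "hm ?I < n" "hm ?I \<in> ?P" "mk (hm ?I)" "inl (hm ?I) - 1 = ?I"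
        "\<forall>z\<in>?P. mk z \<and> inl z - 1 = ?I \<longrightarrow> anc (hm ?I) z"
      using h I(1) unfolding heads_def by blast
    then show ?thesis
    proof cases
      case 1
      then have "inl z \<noteq> inl v" if "z < n" "mk z" "anc v z" "z \<noteq> v" for z
        using desc[OF that(1,3,4)] that(2) by auto
      then show ?thesis using 1 by (simp add: next_spec_def)
    next
      case 2
      have "inl (hm ?I) = inl v" using 2(4) pos[OF 2(1)] I(2) by simp
      moreover have "hm ?I \<noteq> v" using 2(2) node(2) by auto
      moreover have "anc v (hm ?I)" using up 2(2,4) by blast
      moreover have "anc (hm ?I) z" if "z < n" "mk z" "anc v z" "z \<noteq> v" "inl z = inl v" for z
        using desc[OF that(1,3,4)] that(2,5) 2(5) by simp
      ultimately show ?thesis using 2(1,3) by (simp add: next_spec_def)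
    qed
  qed
  have nx: "next_spec mk ?nx u" if "u \<in> insert v ?P" for u
  proof (cases "u = v")
    case False
    then have "next_spec mk nx u" using that h by (simp add: heads_def)
    then show ?thesis using False by (simp add: next_spec_def)
  qed (use new in simp)
  show "heads mk (below Q (Suc k)) hm ?nx" if "\<not> mk v"
    unfolding heads_def P
  proof (intro conjI allI impI ballI)
    fix J assume "J < n"
    then show "hm J = n \<and> (\<forall>z\<in>insert v ?P. mk z \<longrightarrow> inl z - 1 \<noteq> J) \<or>
        hm J < n \<and> hm J \<in> insert v ?P \<and> mk (hm J) \<and> inl (hm J) - 1 = J \<and>
          (\<forall>z\<in>insert v ?P. mk z \<and> inl z - 1 = J \<longrightarrow> anc (hm J) z)"
      using h that unfolding heads_def by blast
  qed (rule nx)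
  show "heads mk (below Q (Suc k)) (hm(?I := v)) ?nx" if "mk v"
    unfolding heads_def P
  proof (intro conjI allI impI ballI)
    fix J assume J: "J < n"
    let ?hm = "hm(?I := v)"
    show "?hm J = n \<and> (\<forall>z\<in>insert v ?P. mk z \<longrightarrow> inl z - 1 \<noteq> J) \<or>
        ?hm J < n \<and> ?hm J \<in> insert v ?P \<and> mk (?hm J) \<and> inl (?hm J) - 1 = J \<and>
          (\<forall>z\<in>insert v ?P. mk z \<and> inl z - 1 = J \<longrightarrow> anc (?hm J) z)"
    proof (cases "J = ?I")
      case True
      have "anc v z" if "z \<in> insert v ?P" "inl z - 1 = ?I" for z using up that by auto
      then show ?thesis using True that node(1) by simp
    next
      case False
      then have "?hm J = hm J" by simp
      then show ?thesis using h J False unfolding heads_def by (metis insert_iff)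
    qed
  qed (rule nx)
qed

lemma heads_final:
  assumes "heads mk {..<n} hm nx" "z < n"
  shows "next_spec mk nx z" "head_spec mk hm z"
proof -
  show "next_spec mk nx z" using assms by (simp add: heads_def)
  have pos: "1 \<le> inl z" if "z < n" for z using inl_interval[OF that] by simp
  have I: "inl z - 1 < n" using inl_le[OF assms(2)] pos[OF assms(2)] by linarith
  show "head_spec mk hm z"
    unfolding head_spec_def
  proof
    assume mk: "mk z"
    let ?h = "hm (inl z - 1)"
    have h: "?h < n" "mk ?h" "inl ?h - 1 = inl z - 1" "anc ?h z"
      using assms I mk unfolding heads_def by (metis lessThan_iff)+
    then show "?h < n \<and> mk ?h \<and> inl ?h = inl z \<and> anc ?h z"
      using pos[OF h(1)] pos[OF assms(2)] by auto
  qed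
qed

end

context slot_builder
begin

definition marked :: "'a hstate \<Rightarrow> nat \<Rightarrow> nat \<Rightarrow> bool" where
  "marked s i z \<longleftrightarrow> arr s 8 i z \<noteq> i"

abbreviation numbered :: "'a hstate \<Rightarrow> bool" where
  "numbered s \<equiv> labeled_numbering n r pa E (arr s 4 0) (arr s 3 0) (arr s 6 0)"

abbreviation linked :: "'a hstate \<Rightarrow> nat \<Rightarrow> nat \<Rightarrow> bool" where
  "linked s i z \<equiv> labeled_numbering.next_spec n E (arr s 6 0) (marked s i) (arr s 10 i) z \<and>
     labeled_numbering.head_spec n E (arr s 6 0) (marked s i) (arr s 11 i) z"

abbreviation masked :: "'a hstate \<Rightarrow> nat \<Rightarrow> nat \<Rightarrow> bool" where
  "masked s i z \<equiv> labeled_numbering.mask_spec n E (arr s 6 0) w (marked s i) z (arr s 9 i z)"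

definition tables :: "'a hstate \<Rightarrow> bool" where
  "tables s \<longleftrightarrow> numbered s \<and>
     (\<forall>v<n. arr s 7 0 v = lowbit (arr s 6 0 v)) \<and>
     (\<forall>v<n. v \<noteq> r \<longrightarrow> slot_step (earr s) (arr s 8) v) \<and>
     (\<forall>i\<le>m. \<forall>v<n. masked s i v \<and>
        linked s i v)"

lemma wp_head:
  assumes "base s" and Q: "topological (arr s 2 0)"
    and L: "numbered s"
    and i: "var s 8 = i" "i \<le> m"
  shows "wp ph_head (\<lambda>t. (\<forall>z<n. linked t i z) \<and>
     (\<forall>j. j \<noteq> i \<longrightarrow> arr t 10 j = arr s 10 j \<and> arr t 11 j = arr s 11 j)) s"
  unfolding ph_head_def
proof (rule wp_seqI[where P = "\<lambda>t. (\<forall>I<n. arr t 11 i I = n) \<and> (\<forall>j. j \<noteq> i \<longrightarrow> arr t 11 j = arr s 11 j)"])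
  interpret L: labeled_numbering n r pa E "arr s 4 0" "arr s 3 0" "arr s 6 0" by (rule L)
  let ?c1 = "St 11 (Var 8) (Var 4) (Var 1)"
  let ?I1 = "\<lambda>k t. (\<forall>I<k. arr t 11 i I = n) \<and> (\<forall>j. j \<noteq> i \<longrightarrow> arr t 11 j = arr s 11 j)"
  show "wp (Loop 4 1 ?c1) (?I1 n) s"
  proof (rule wp_Loop[where I = ?I1])
    fix k t assume k: "k < lim 1" and I: "?I1 k t" and v: "var t 4 = k" and f: "frame (Loop 4 1 ?c1) s t"
    have "base t" "var t 8 = i" using base_frame[OF assms(1) f] f i by (simp_all add: frame_def)
    then show "wp ?c1 (\<lambda>t'. ?I1 (Suc k) (setv 4 (Suc k) t')) t"
      using I v k i(2) by (auto simp: lim_def base_def less_Suc_eq)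
  qed (use assms in \<open>auto simp: base_def lim_def\<close>)
  fix s1 assume s1: "?I1 n s1" and f1: "frame (Loop 4 1 ?c1) s s1"
  have b1: "base s1" using base_frame[OF assms(1) f1] by simp
  have kd1: "\<And>kd. kd \<noteq> 11 \<Longrightarrow> arr s1 kd = arr s kd" and i1: "var s1 8 = i"
    using f1 i by (simp_all add: frame_def)
  let ?c = "Asg 5 (ld 2 (Var 4)) ;; St 10 (Var 8) (Var 5) (Ld 11 (Var 8) (minus1 (ld 6 (Var 5)))) ;;
       Cond (Eq (Ld 8 (Var 8) (Var 5)) (Var 8)) Nop (St 11 (Var 8) (minus1 (ld 6 (Var 5))) (Var 5))"
  let ?J = "\<lambda>k t. L.heads (marked s i) (below (arr s 2 0) k) (arr t 11 i) (arr t 10 i) \<and>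
     (\<forall>j. j \<noteq> i \<longrightarrow> arr t 10 j = arr s 10 j \<and> arr t 11 j = arr s 11 j)"
  show "wp (Loop 4 1 ?c) (\<lambda>t. (\<forall>z<n. linked t i z) \<and>
     (\<forall>j. j \<noteq> i \<longrightarrow> arr t 10 j = arr s 10 j \<and> arr t 11 j = arr s 11 j)) s1"
  proof (rule wp_Loop[where I = ?J])
    show "?J 0 (setv 4 0 s1)" using s1 kd1 by (simp add: L.heads_def)
  next
    fix k t assume k: "k < lim 1" and J: "?J k t" and v: "var t 4 = k" and f: "frame (Loop 4 1 ?c) s1 t"
    have b: "base t" using base_frame[OF b1 f] by simp
    have kn: "k < n" using k by (simp add: lim_def)
    have kd: "\<And>kd. kd \<noteq> 10 \<Longrightarrow> kd \<noteq> 11 \<Longrightarrow> arr t kd = arr s kd" and it: "var t 8 = i"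
      using f kd1 i1 by (simp_all add: frame_def)
    let ?v = "arr s 2 0 k"
    note node = topological_node[OF Q kn] and st = L.heads_step[OF Q kn conjunct1[OF J]]
    have inl: "arr s 6 0 ?v < 2 ^ w" using L.inl_le[OF node(1)] n_bound n_pos by linarith
    show "wp ?c (\<lambda>t'. ?J (Suc k) (setv 4 (Suc k) t')) t"
    proof (cases "arr s 8 i ?v = i")
      case True
      then have "\<not> marked s i ?v" by (simp add: marked_def)
      then show ?thesis
        using st(3) True J v kn it b node(1) st(1,2) inl i(2) n_bound by (simp add: kd base_def)
    next
      case False
      then have "marked s i ?v" by (simp add: marked_def)
      then show ?thesis
        using st(4) False J v kn it b node(1) st(1,2) inl i(2) n_bound by (simp add: kd base_def)
    qed
  next
    fix t assume J: "?J (lim 1) t" and f: "frame (Loop 4 1 ?c) s1 t"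
    have kd: "\<And>kd. kd \<noteq> 10 \<Longrightarrow> kd \<noteq> 11 \<Longrightarrow> arr t kd = arr s kd"
      using f kd1 by (simp add: frame_def)
    then have "marked t i = marked s i" by (simp add: marked_def fun_eq_iff)
    moreover have "L.heads (marked s i) {..<n} (arr t 11 i) (arr t 10 i)"
      using J below_n[OF Q] by (simp add: lim_def)
    ultimately show "(\<forall>z<n. linked t i z) \<and>
     (\<forall>j. j \<noteq> i \<longrightarrow> arr t 10 j = arr s 10 j \<and> arr t 11 j = arr s 11 j)"
      using L.heads_final J kd by simp
  qed (use b1 in \<open>simp add: base_def lim_def\<close>)
qed

lemma wp_heads:
  assumes "base s" and Q: "topological (arr s 2 0)"
    and L: "numbered s"
  shows "wp ph_heads (\<lambda>t. \<forall>i\<le>m. \<forall>z<n. linked t i z) s"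
  unfolding ph_heads_def
proof (rule wp_Loop[where I = "\<lambda>k t. \<forall>i<k. \<forall>z<n. linked t i z"])
  let ?P = "\<lambda>i t. \<forall>z<n. linked t i z"
  fix k t assume k: "k < lim 3" and I: "\<forall>i<k. ?P i t" and v: "var t 8 = k" and f: "frame (Loop 8 3 ph_head) s t"
  have b: "base t" using base_frame[OF assms(1) f] by (simp add: ph_head_def)
  have kd: "\<And>kd. kd \<noteq> 10 \<Longrightarrow> kd \<noteq> 11 \<Longrightarrow> arr t kd = arr s kd"
    using f by (simp add: frame_def ph_head_def)
  have Qt: "topological (arr t 2 0)" and Lt: "numbered t"
    using Q L kd by simp_all
  have km: "k \<le> m" using k by (simp add: lim_def)
  show "wp ph_head (\<lambda>t'. \<forall>i<Suc k. ?P i (setv 8 (Suc k) t')) t"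
  proof (rule wp_mono[OF wp_frame[OF wp_head[OF b Qt Lt v km]]])
    fix t' assume t': "(?P k t' \<and> (\<forall>j. j \<noteq> k \<longrightarrow> arr t' 10 j = arr t 10 j \<and> arr t' 11 j = arr t 11 j)) \<and>
      frame ph_head t t'"
    have "arr t' 6 = arr t 6" "arr t' 8 = arr t 8" using t' by (simp_all add: frame_def ph_head_def)
    moreover from this have "marked t' i = marked t i" for i by (simp add: marked_def fun_eq_iff)
    ultimately have "?P i t'" if "i < k" for i using that I t' by simp
    then show "\<forall>i<Suc k. ?P i (setv 8 (Suc k) t')"
      using t' by (simp add: less_Suc_eq marked_def[abs_def])
  qed
qed (use assms in \<open>auto simp: base_def lim_def less_Suc_eq_le\<close>)

text \<open>The ancestors of a node are itself and those of its parent, and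
  \<open>2 ^ (w - 1) div lowbit (inl v)\<close> is a single power of two, so \<open>or\<close> adds
  just the bit of \<open>v\<close>.\<close>

lemma mask_final:
  assumes sl: "slots_ok {..<n} s" and L: "labeled_numbering n r pa E lo sz (arr s 6 0)"
    and lb: "\<forall>v<n. arr s 7 0 v = lowbit (arr s 6 0 v)" and i: "i \<le> m" and "v < n"
  shows "masked s i v"
  using \<open>v < n\<close>
proof (induction v rule: node_induct)
  interpret L: labeled_numbering n r pa E lo sz "arr s 6 0" by (rule L)
  case root
  have "arr s 8 i r = i" "arr s 9 i r = 0" using sl i root_less by (auto simp: slots_ok_def)
  moreover have "z = r" if "anc z r" for z using that anc_rec[OF root_less, of z] by simp
  ultimately show ?case by (auto simp: L.mask_spec_def marked_def)
next
  interpret L: labeled_numbering n r pa E lo sz "arr s 6 0" by (rule L)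
  case (child v)
  let ?b = "2 ^ (w - 1) div lowbit (arr s 6 0 v) :: nat"
  have step: "arr s 9 i v = (if marked s i v then Bit_Operations.or (arr s 9 i (pa v)) ?b else arr s 9 i (pa v))"
    using sl i child.hyps lb by (auto simp: slots_ok_def mask_step_def marked_def)
  obtain j where j: "lowbit (arr s 6 0 v) = 2 ^ j" "2 ^ j \<le> n" using L.lowbit_inl_power[OF child.hyps(1)] by blast
  have "(2::nat) ^ j < 2 ^ w" using j(2) n_bound n_pos by linarith
  then have "j < w" by (rule power_less_imp_less_exp[rotated]) simp
  then have "?b = 2 ^ (w - 1 - j)" unfolding j(1) by (intro power_diff[symmetric]) auto
  then have bit: "bit ?b k \<longleftrightarrow> ?b = 2 ^ k" for k
    by (auto simp: bit_exp_iff)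
  have anc: "anc z v \<longleftrightarrow> z = v \<or> anc z (pa v)" for z using anc_rec[of v z] child.hyps by simp
  show ?case
    unfolding L.mask_spec_def step anc
    using child.IH child.hyps bit by (auto simp: L.mask_spec_def bit_or_iff)
qed

lemma ready_frame:
  assumes "base s \<and> elems_ok s" "frame c s t" "mods c \<inter> {0, 1, 2, 3} = {}" "0 \<notin> kinds c" "\<not> estores c"
  shows "base t \<and> elems_ok t"
  using assms base_frame[of s c t] by (simp add: frame_def elems_ok_def)

lemma wp_build:
  assumes "var s 0 = m" "var s 1 = n" "var s 2 = r" "\<forall>v<n. v \<noteq> r \<longrightarrow> arr s 0 0 v = pa v" "elems_ok s"
  shows "wp ph_build (\<lambda>t. tables t \<and> arr t 0 0 0 = n \<and> arr t 1 0 0 = m) s"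
proof -
  let ?Q = "\<lambda>t. tables t \<and> arr t 0 0 0 = n \<and> arr t 1 0 0 = m"
  let ?c8 = "st 0 (Lit 0) (Var 1) ;; st 1 (Lit 0) (Var 0)"
  let ?c7 = "ph_heads ;; ?c8"
  let ?c6 = "ph_slots ;; ?c7"
  let ?c5 = "ph_inlabel ;; ?c6"
  let ?c4 = "ph_number ;; ?c5"
  let ?c3 = "ph_size ;; ?c4"
  let ?c2 = "ph_peel ;; ?c3"
  let ?c1 = "ph_queue ;; ?c2"
  let ?L = "\<lambda>s. numbered s \<and>
    (\<forall>v<n. arr s 7 0 v = lowbit (arr s 6 0 v))"
  have step7: "wp ?c7 ?Q s" if s: "base s" "topological (arr s 2 0)" "slots_ok {..<n} s" "?L s" for s
  proof (rule wp_seqI[OF wp_heads[OF s(1,2) conjunct1[OF s(4)]]])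
    fix t assume t: "\<forall>i\<le>m. \<forall>z<n. linked t i z"
      and f: "frame ph_heads s t"
    have kd: "\<And>kd. kd \<noteq> 10 \<Longrightarrow> kd \<noteq> 11 \<Longrightarrow> arr t kd = arr s kd" and e: "earr t = earr s"
      using f by (simp_all add: frame_def ph_heads_def ph_head_def)
    have b: "base t" using base_frame[OF s(1) f] by (simp add: ph_heads_def ph_head_def)
    have mk: "marked t i = marked s i" for i by (simp add: marked_def fun_eq_iff kd)
    have "masked t i v"
      if "i \<le> m" "v < n" for i v
      using mask_final[OF s(3) conjunct1[OF s(4)] conjunct2[OF s(4)] that] mk by (simp add: kd)
    moreover have "slot_step (earr t) (arr t 8) v" if "v < n" "v \<noteq> r" for v
      using s(3) that by (simp add: slots_ok_def kd e)
    ultimately have "tables t" using t s(4) by (simp add: tables_def kd)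
    \<comment> \<open>\<open>tables\<close> does not mention kinds 0 and 1, so their cells may be
      overwritten by \<open>n\<close> and \<open>m\<close>.\<close>
    moreover have "tables (t\<lparr>arr := (arr t)(0 := x, 1 := y)\<rparr>) = tables t" for t x y
      by (simp add: tables_def marked_def[abs_def])
    ultimately show "wp ?c8 ?Q t" using b n_pos by (simp add: base_def)
  qed
  have step6: "wp ?c6 ?Q s" if s: "base s \<and> elems_ok s" "topological (arr s 2 0)" "?L s" for s
  proof (rule wp_seqI[OF wp_slots[OF conjunct1[OF s(1)] conjunct2[OF s(1)] s(2)]], rule step7)
    fix t assume t: "slots_ok {..<n} t \<and> elems_ok t" and f: "frame ph_slots s t"
    have "\<And>kd. kd \<noteq> 8 \<Longrightarrow> kd \<noteq> 9 \<Longrightarrow> arr t kd = arr s kd"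
      using f by (simp add: frame_def ph_slots_def ph_defs)
    then show "topological (arr t 2 0)" "?L t" using s by simp_all
    show "base t" using base_frame[OF conjunct1[OF s(1)] f] by (simp add: ph_slots_def ph_defs)
    show "slots_ok {..<n} t" using t by blast
  qed
  have step5: "wp ?c5 ?Q s" if s: "base s \<and> elems_ok s" "topological (arr s 2 0)"
    "numbered_tree n r pa E (arr s 4 0) (arr s 3 0)" for s
  proof (rule wp_seqI[OF wp_inlabel[OF conjunct1[OF s(1)] s(2,3)]], rule step6)
    fix t assume f: "frame ph_inlabel s t"
    show "base t \<and> elems_ok t" using ready_frame[OF s(1) f] by (simp add: ph_inlabel_def)
    show "topological (arr t 2 0)" using s(2) f by (simp add: frame_def ph_inlabel_def)
  qed
  have step4: "wp ?c4 ?Q s" if s: "base s \<and> elems_ok s" "topological (arr s 2 0)"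
    "sizes {..<n} (arr s 3 0)" for s
  proof (rule wp_seqI[OF wp_number[OF conjunct1[OF s(1)] s(2,3)]], rule step5)
    fix t assume f: "frame ph_number s t"
    show "base t \<and> elems_ok t" using ready_frame[OF s(1) f] by (simp add: ph_number_def)
    show "topological (arr t 2 0)" using s(2) f by (simp add: frame_def ph_number_def)
  qed
  have step3: "wp ?c3 ?Q s" if s: "base s \<and> elems_ok s" "topological (arr s 2 0)" for s
  proof (rule wp_seqI[OF wp_size[OF conjunct1[OF s(1)] s(2)]], rule step4)
    fix t assume f: "frame ph_size s t"
    show "base t \<and> elems_ok t" using ready_frame[OF s(1) f] by (simp add: ph_size_def)
    show "topological (arr t 2 0)" using s(2) f by (simp add: frame_def ph_size_def)
  qed
  have step2: "wp ?c2 ?Q s" if s: "base s \<and> elems_ok s" "peeling 0 (var s 7) (arr s 2 0) (arr s 1 0)" for s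
  proof (rule wp_seqI[OF wp_peel[OF conjunct1[OF s(1)] s(2)]], rule step3)
    fix t assume f: "frame ph_peel s t"
    show "base t \<and> elems_ok t" using ready_frame[OF s(1) f] by (simp add: ph_peel_def)
  qed
  have step1: "wp ?c1 ?Q s" if s: "base s \<and> elems_ok s" "\<forall>u<n. arr s 1 0 u = card (children u)" for s
  proof (rule wp_seqI[OF wp_queue[OF conjunct1[OF s(1)] s(2)]], rule step2)
    fix t assume f: "frame ph_queue s t"
    show "base t \<and> elems_ok t" using ready_frame[OF s(1) f] by (simp add: ph_queue_def)
  qed
  let ?s = "setv 3 (m + 1) s"
  have s0: "base ?s \<and> elems_ok ?s" using assms by (simp add: base_def elems_ok_def)
  have "wp (ph_count ;; ?c1) ?Q ?s"
  proof (rule wp_seqI[OF wp_count[OF conjunct1[OF s0]]], rule step1)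
    fix t assume f: "frame ph_count ?s t"
    show "base t \<and> elems_ok t" using ready_frame[OF s0 f] by (simp add: ph_count_def)
  qed
  then show ?thesis using assms slot_bounds[of m] by (simp add: ph_build_def)
qed

end

section \<open>Queries\<close>

definition query_below :: hcom where
  "query_below = Asg 15 (Bin Div (Bin Div (Ld 9 (Var 8) (Var 2)) (Bin Div Top (ld 7 (Var 13)))) (Lit 2)) ;;
     Cond (Eq (Var 15) (Lit 0)) Nop
       (Asg 16 (Bin Div (Bin Div (ld 7 (Var 13)) (Lit 2)) (lowbit_exp (Var 15))) ;;
        Asg 17 (Bin Mult (Var 16) (Lit 2)) ;;
        Asg 14 (Ld 11 (Var 8) (minus1 (Bin Add (Bin Mult (Bin Div (ld 6 (Var 2)) (Var 17)) (Var 17)) (Var 16)))))"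

definition query_find :: hcom where
  "query_find = Asg 14 (Ld 10 (Var 8) (Var 13)) ;;
     Cond (Lt (Var 14) (Var 1))
       (Cond (Lt (ld 4 (Var 2)) (ld 4 (Var 14))) (Asg 14 (Var 1))
         (Cond (Lt (ld 4 (Var 2)) (Bin Add (ld 4 (Var 14)) (ld 3 (Var 14)))) Nop (Asg 14 (Var 1)))) Nop ;;
     Cond (Lt (Var 14) (Var 1)) Nop query_below"

definition query_step :: hcom where
  "query_step = query_find ;;
     Cond (Lt (Var 14) (Var 1)) (Asg 8 (Ld 8 (Var 8) (Var 14)) ;; Asg 13 (Var 14)) Nop"

definition query_main :: hcom where
  "query_main = Asg 0 (ld 1 (Lit 0)) ;; Asg 8 (Var 0) ;; Asg 3 (plus1 (Var 0)) ;;
     Loop 9 3 query_step ;; ELd 0 (plus1 (Var 8)) (Var 2)"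

lemmas query_defs = query_below_def query_find_def query_step_def lowbit_exp_def

text \<open>The slot reached by a product that starts in slot \<open>i\<close> and follows the edges
  \<open>es\<close>.\<close>

definition track :: "(nat \<Rightarrow> nat \<Rightarrow> nat) \<Rightarrow> nat \<Rightarrow> (nat \<times> nat) list \<Rightarrow> nat" where
  "track tg i es = foldl (\<lambda>i e. tg i (snd e)) i es"

lemma track_simps [simp]:
  "track tg i [] = i" "track tg i (e # es) = track tg (tg i (snd e)) es"
  "track tg i (es @ es') = track tg (track tg i es) es'"
  by (simp_all add: track_def)

lemma track_unmarked: "\<forall>e\<in>set es. tg i (snd e) = i \<Longrightarrow> track tg i es = i"
  by (induction es) auto

lemma is_path_append: "is_path E x (es @ es') y \<longleftrightarrow> (\<exists>z. is_path E x es z \<and> is_path E z es' y)"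
  by (induction es arbitrary: x) auto

lemma is_path_rtrancl: "is_path E x es y \<Longrightarrow> (x, y) \<in> E\<^sup>*"
proof (induction es arbitrary: x)
  case (Cons e es)
  then have "(x, snd e) \<in> E" "(snd e, y) \<in> E\<^sup>*" by (auto simp flip: surjective_pairing)
  then show ?case by (rule converse_rtrancl_into_rtrancl)
qed simp

lemma is_path_trancl: "is_path E x es y \<Longrightarrow> es \<noteq> [] \<Longrightarrow> (x, y) \<in> E\<^sup>+"
proof (cases es)
  case (Cons e es')
  assume "is_path E x es y"
  then have "(x, snd e) \<in> E" "(snd e, y) \<in> E\<^sup>*" using Cons is_path_rtrancl by (auto simp flip: surjective_pairing)
  then show ?thesis by (rule rtrancl_into_trancl2)
qed simp

lemma trancl_is_path: "(x, y) \<in> E\<^sup>+ \<Longrightarrow> \<exists>es. es \<noteq> [] \<and> is_path E x es y"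
proof (induction rule: trancl_induct)
  case (base y)
  then have "is_path E x [(x, y)] y" by simp
  then show ?case by blast
next
  case (step y z)
  then obtain es where "is_path E x es y" by blast
  then have "is_path E x (es @ [(y, z)]) z" using step(2) by (auto simp: is_path_append)
  then show ?case by blast
qed

section \<open>Paths and the slots along them\<close>

context parent_tree
begin

lemma is_path_edges: "is_path E x es y \<Longrightarrow> e \<in> set es \<Longrightarrow> e \<in> E"
  by (induction es arbitrary: x) auto

lemma edge_node: "e \<in> E \<Longrightarrow> snd e < n \<and> snd e \<noteq> r \<and> fst e = pa (snd e)"
  by (cases e) (simp add: edge_iff)

text \<open>Parents are unique, so the last edge is determined; acyclicity settles the empty case.
  This justifies the definite description in \<open>path_product\<close>.\<close>

lemma path_unique: "is_path E x es y \<Longrightarrow> is_path E x es' y \<Longrightarrow> es = es'"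
proof (induction es arbitrary: y es' rule: rev_induct)
  case Nil
  then have "x = y" by simp
  then have "(x, x) \<in> E\<^sup>+" if "es' \<noteq> []" using is_path_trancl[OF Nil.prems(2) that] by simp
  then show ?case using acyclic unfolding acyclic_def by blast
next
  case (snoc e es)
  have es': "es' \<noteq> []"
  proof
    assume "es' = []"
    then have "(x, x) \<in> E\<^sup>+" using is_path_trancl[OF snoc.prems(1)] snoc.prems(2) by simp
    then show False using acyclic unfolding acyclic_def by blast
  qed
  then obtain e' es2 where es2: "es' = es2 @ [e']" by (metis rev_exhaust)
  have e: "e \<in> E" "snd e = y" "is_path E x es (fst e)" using snoc.prems(1) by (auto simp: is_path_append)
  have e': "e' \<in> E" "snd e' = y" "is_path E x es2 (fst e')" using snoc.prems(2) by (auto simp: is_path_append es2)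
  have "fst e = pa y" "fst e' = pa y"
    using pa[of "fst e" y] pa[of "fst e'" y] e(1,2) e'(1,2) by (metis prod.collapse)+
  then have "e = e'" "is_path E x es2 (fst e)" using e e' by (auto intro: prod_eqI)
  then show ?case using snoc.IH[OF e(3)] es2 by simp
qed

lemma path_node:
  assumes "is_path E x es y" "y < n" "e \<in> set es"
  shows "anc x (snd e)" "snd e \<noteq> x" "anc (snd e) y" "snd e < n"
proof -
  obtain as bs where "es = as @ e # bs" using assms(3) by (meson split_list)
  then have p: "is_path E x (as @ [e]) (snd e)" "is_path E (snd e) bs y"
    using assms(1) by (auto simp: is_path_append)
  show "anc x (snd e)" "anc (snd e) y"
    using is_path_rtrancl[OF p(1)] is_path_rtrancl[OF p(2)] by (simp_all add: anc_def)
  then show "snd e < n" using anc_less assms(2) by blast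
  show "snd e \<noteq> x" using is_path_trancl[OF p(1)] acyclic unfolding acyclic_def by auto
qed

lemma path_split:
  assumes "is_path E x es y" "y < n" "anc x f" "f \<noteq> x" "anc f y"
  shows "\<exists>as e bs. es = as @ e # bs \<and> snd e = f \<and> is_path E x (as @ [e]) f \<and> is_path E f bs y"
  using assms(1,3,4)
proof (induction es arbitrary: x)
  case Nil
  then show ?case using assms(5) anc_antisym by auto
next
  case (Cons e es)
  have e: "e \<in> E" "fst e = x" "is_path E (snd e) es y" using Cons.prems by auto
  show ?case
  proof (cases "snd e = f")
    case True
    then show ?thesis using e by (intro exI[of _ "[]"] exI[of _ e] exI[of _ es]) auto
  next
    case False
    have c: "anc (snd e) y" using is_path_rtrancl[OF e(3)] by (simp add: anc_def)
    have cn: "snd e < n" "snd e \<noteq> r" "pa (snd e) = x" using edge_node[OF e(1)] e(2) by simp_all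
    have "\<not> anc f (snd e)"
      using anc_rec[OF cn(1), of f] False cn(3) anc_antisym[OF Cons.prems(2)] Cons.prems(3) by auto
    then have "anc (snd e) f" using anc_linear[OF assms(2) assms(5) c] by blast
    then obtain as e' bs where "es = as @ e' # bs" "snd e' = f" "is_path E (snd e) (as @ [e']) f" "is_path E f bs y"
      using Cons.IH[OF e(3)] False by auto
    then show ?thesis using e by (intro exI[of _ "e # as"] exI[of _ e'] exI[of _ bs]) auto
  qed
qed

end

context labeled_numbering
begin

lemma track_none:
  assumes "is_path E x es y" "y < n" "none_marked (\<lambda>z. tg i z \<noteq> i) x y"
  shows "track tg i es = i"
proof (rule track_unmarked, rule ballI)
  fix e assume "e \<in> set es"
  note nd = path_node[OF assms(1,2) this]
  show "tg i (snd e) = i" using assms(3) nd unfolding none_marked_def by blast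
qed

text \<open>A marked node on the path before \<open>f\<close> would lie below \<open>f\<close> by
  minimality, closing a cycle. So the slot stays \<open>i\<close> until \<open>f\<close> is
  reached.\<close>

lemma track_first:
  assumes "is_path E x es y" "y < n" "first_marked (\<lambda>z. tg i z \<noteq> i) x y f"
  shows "\<exists>es1 es2. es = es1 @ es2 \<and> is_path E x es1 f \<and> is_path E f es2 y \<and> track tg i es1 = tg i f"
proof -
  have f: "f < n" "anc x f" "f \<noteq> x" "anc f y"
    and least: "\<And>z. z < n \<Longrightarrow> tg i z \<noteq> i \<Longrightarrow> anc x z \<Longrightarrow> z \<noteq> x \<Longrightarrow> anc z y \<Longrightarrow> anc f z"
    using assms(3) by (auto simp: first_marked_def)
  obtain as e bs where sp: "es = as @ e # bs" "snd e = f" "is_path E x (as @ [e]) f" "is_path E f bs y"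
    using path_split[OF assms(1,2) f(2-4)] by blast
  have "tg i (snd e') = i" if e': "e' \<in> set as" for e'
  proof (rule ccontr)
    assume m: "tg i (snd e') \<noteq> i"
    have pe: "is_path E x as (fst e)" "e \<in> E" using sp(3) by (auto simp: is_path_append)
    have en: "fst e < n" "(fst e, f) \<in> E"
      using edge_node[OF pe(2)] pa_less[of f] pe(2) sp(2) by (simp, metis prod.collapse)
    note nd = path_node[OF pe(1) en(1) e']
    have "anc (fst e) f" using en(2) by (auto simp: anc_def)
    then have "anc (snd e') f" using nd(3) anc_trans by blast
    then have "anc f (snd e')" using least[OF nd(4) m nd(1,2)] f(4) anc_trans by blast
    then have "anc f (fst e)" using nd(3) anc_trans by blast
    then have "f = fst e" using \<open>anc (fst e) f\<close> anc_antisym by blast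
    then show False using en(2) acyclic unfolding acyclic_def by auto
  qed
  then have "track tg i (as @ [e]) = tg i f" using track_unmarked[of as tg i] sp(2) by simp
  then show ?thesis using sp by (intro exI[of _ "as @ [e]"] exI[of _ bs]) simp
qed

end

lemma semigroup_prod_closed:
  assumes "\<And>a b. a \<in> S \<Longrightarrow> b \<in> S \<Longrightarrow> mul a b \<in> S"
  shows "as \<noteq> [] \<Longrightarrow> set as \<subseteq> S \<Longrightarrow> semigroup_prod mul as \<in> S"
proof (induction as rule: list_nonempty_induct)
  case (cons x xs)
  then show ?case using assms by (cases xs) auto
qed simp

text \<open>\<open>semigroup_prod\<close> brackets to the right, whereas slots are multiplied from
  the right by one label after the other. Associativity reconciles the two.\<close>

lemma semigroup_prod_snoc:
  assumes "\<And>a b. a \<in> S \<Longrightarrow> b \<in> S \<Longrightarrow> mul a b \<in> S"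
    and "\<And>a b c. a \<in> S \<Longrightarrow> b \<in> S \<Longrightarrow> c \<in> S \<Longrightarrow> mul (mul a b) c = mul a (mul b c)"
  shows "as \<noteq> [] \<Longrightarrow> set as \<subseteq> S \<Longrightarrow> a \<in> S \<Longrightarrow>
    semigroup_prod mul (as @ [a]) = mul (semigroup_prod mul as) a"
proof (induction as rule: list_nonempty_induct)
  case (single x)
  then show ?case by simp
next
  case (cons x xs)
  then obtain y ys where ys: "xs = y # ys" by (cases xs) auto
  have "semigroup_prod mul xs \<in> S" using semigroup_prod_closed[OF assms(1)] cons by auto
  then show ?case using cons assms(2) ys by simp
qed

section \<open>Correctness of queries\<close>

context slot_builder
begin

text \<open>Induction from the lower end of the path. The first edge leaves slot \<open>m\<close>
  with its label as the value; afterwards slots never increase, so the path stays among proper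
  slots, where each step multiplies by a label.\<close>

lemma slot_value:
  assumes assoc: "\<And>a b c. a \<in> S \<Longrightarrow> b \<in> S \<Longrightarrow> c \<in> S \<Longrightarrow> mul (mul a b) c = mul a (mul b c)"
    and step: "\<And>v. v < n \<Longrightarrow> v \<noteq> r \<Longrightarrow> slot_step e tg v"
    and "is_path E x es y" "es \<noteq> []"
  shows "track tg m es < m \<and> e (track tg m es + 1) y = semigroup_prod mul (map (\<lambda>e. lab (snd e)) es)"
  using assms(3,4)
proof (induction es arbitrary: y rule: rev_induct)
  case (snoc a es)
  have a: "a \<in> E" "snd a = y" "is_path E x es (fst a)" using snoc.prems by (auto simp: is_path_append)
  have y: "y < n" "y \<noteq> r" "fst a = pa y" using edge_node[OF a(1)] a(2) by simp_all
  note st = step[OF y(1,2)]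
  show ?case
  proof (cases "es = []")
    case True
    then show ?thesis using st a by (simp add: slot_step_def)
  next
    case False
    note IH = snoc.IH[OF a(3) False]
    let ?i = "track tg m es"
    have "lab (snd b) \<in> S" if "b \<in> set es" for b
      using lab[of "snd b"] edge_node[OF is_path_edges[OF a(3) that]] by simp
    then have "set (map (\<lambda>e. lab (snd e)) es) \<subseteq> S" by (simp add: image_subset_iff)
    then have "semigroup_prod mul (map (\<lambda>e. lab (snd e)) es @ [lab y]) =
        mul (semigroup_prod mul (map (\<lambda>e. lab (snd e)) es)) (lab y)"
      using semigroup_prod_snoc[OF closed assoc] False lab[OF y(1,2)] by simp
    moreover have "tg ?i y \<le> ?i" "e (tg ?i y + 1) y = mul (e (?i + 1) (pa y)) (lab y)"
      using st IH by (auto simp: slot_step_def)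
    ultimately show ?thesis using IH a y by (simp add: le_less_trans)
  qed
qed simp

definition query_base :: "'a hstate \<Rightarrow> bool" where
  "query_base s \<longleftrightarrow> tables s \<and> var s 0 = m \<and> var s 1 = n \<and> var s 3 = m + 1"

lemma query_base_frame:
  "query_base s \<Longrightarrow> frame c s t \<Longrightarrow> mods c \<inter> {0, 1, 3} = {} \<Longrightarrow> kinds c = {} \<Longrightarrow> \<not> estores c \<Longrightarrow> query_base t"
  using frame_arr[of c s t] by (simp add: query_base_def tables_def frame_def marked_def[abs_def])

lemma wp_query_find:
  assumes "query_base s" and x: "var s 13 = x" and y: "var s 2 = y" "y < n" and i: "var s 8 = i" "i \<le> m"
    and xy: "anc x y"
  shows "wp query_find (\<lambda>t.
     var t 14 = n \<and> labeled_numbering.none_marked n E (marked s i) x y \<or>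
     labeled_numbering.first_marked n E (marked s i) x y (var t 14)) s"
proof -
  have L: "numbered s"
    using assms(1) by (simp add: query_base_def tables_def)
  interpret L: labeled_numbering n r pa E "arr s 4 0" "arr s 3 0" "arr s 6 0" by (rule L)
  have xn: "x < n" using xy y(2) anc_less by blast
  let ?mk = "marked s i" and ?nx = "arr s 10 i" and ?lo = "arr s 4 0" and ?sz = "arr s 3 0" and ?inl = "arr s 6 0"
  have nx: "L.next_spec ?mk ?nx x" and hm: "\<And>z. z < n \<Longrightarrow> L.head_spec ?mk (arr s 11 i) z"
    and A: "L.mask_spec w ?mk y (arr s 9 i y)" and lb: "arr s 7 0 x = lowbit (?inl x)"
    using assms(1) i xn y(2) unfolding query_base_def tables_def by blast+
  have v: "var s 0 = m" "var s 1 = n" using assms(1) by (simp_all add: query_base_def)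
  have wn: "n < 2 ^ w" using n_bound n_pos by linarith
  let ?f = "?nx x"
  have nxn: "?f \<le> n" using nx by (auto simp: L.next_spec_def)
  have ancf: "anc ?f y \<longleftrightarrow> ?lo ?f \<le> ?lo y \<and> ?lo y < ?lo ?f + ?sz ?f" if "?f < n"
    using L.anc_iff[OF that y(2)] .
  \<comment> \<open>The interval of a node ends at \<open>n\<close> at the latest, so the sum in the
    ancestor test does not wrap around.\<close>
  have safe: "?lo ?f + ?sz ?f < 2 ^ w" if "?f < n"
    using L.anc_nested[OF that anc_root[OF that]] L.lo_root L.sz_root wn by simp
  show ?thesis
  proof (cases "?f < n \<and> anc ?f y")
    case True
    then have "L.first_marked ?mk x y ?f" using L.first_marked_chain[OF xn y(2) nx] by simp
    then show ?thesis using True ancf safe v x y i xn by (simp add: query_find_def)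
  next
    case False
    define Q where "Q = arr s 9 i y div (2 ^ (w - 1) div lowbit (?inl x)) div 2"
    define p where "p = lowbit (?inl x) div 2 div lowbit Q"
    define I where "I = ?inl y div (p * 2) * (p * 2) + p"
    have chain: "?inl z \<noteq> ?inl x" if "z < n" "?mk z" "anc x z" "z \<noteq> x" "anc z y" for z
      using L.chain_unmarked[OF y(2) nx False that] .
    have below1: "L.none_marked ?mk x y" if "Q = 0"
      by (rule L.first_marked_below(1)[OF wn y(2) xy A, of "arr s 11 i"])
        (erule (4) chain, erule hm, rule that[unfolded Q_def])
    have below2: "L.first_marked ?mk x y (arr s 11 i (I - 1)) \<and> 1 \<le> p \<and> p * 2 \<le> n \<and> 1 \<le> I \<and> I \<le> n"
      if "Q \<noteq> 0"
      unfolding I_def p_def Q_def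
      by (rule L.first_marked_below(2)[OF wn y(2) xy A, of "arr s 11 i"])
        (erule (4) chain, erule hm, rule that[unfolded Q_def])
    let ?R = "\<lambda>t. var t 14 = n \<and> L.none_marked ?mk x y \<or> L.first_marked ?mk x y (var t 14)"
    have "Q \<le> arr s 9 i y" unfolding Q_def by (meson div_le_dividend le_trans)
    moreover have "arr s 9 i y < 2 ^ w" using L.mask_less[OF wn w_pos A] .
    ultimately have Qw: "Q < 2 ^ w" by (rule le_less_trans)
    have below: "wp query_below ?R (setv 14 n s)"
    proof (cases "Q = 0")
      case True
      then show ?thesis using below1 v x y i xn lb by (simp add: query_below_def Q_def)
    next
      case ne: False
      have b: "L.first_marked ?mk x y (arr s 11 i (I - 1))" "p * 2 \<le> n" "1 \<le> p" "1 \<le> I" "I \<le> n"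
        using below2[OF ne] by blast+
      have "?inl y div (p * 2) * (p * 2) \<le> I" by (simp add: I_def)
      then have s1: "?inl y div (p * 2) * (p * 2) < 2 ^ w" "I < 2 ^ w" "p * 2 < 2 ^ w" "I - Suc 0 < n"
        using b wn by linarith+
      have ev: "arr s 9 i y div (2 ^ (w - Suc 0) div lowbit (?inl x)) div 2 = Q" by (simp add: Q_def)
      show ?thesis
        using v x y i xn lb ne Qw s1 b
        by (simp add: query_below_def lowbit_exp ev) (simp add: flip: p_def, simp add: flip: I_def)
    qed
    show ?thesis
    proof (cases "?f < n")
      case True
      then have "\<not> (?lo ?f \<le> ?lo y \<and> ?lo y < ?lo ?f + ?sz ?f)" using False ancf by blast
      then show ?thesis
        using True safe[OF True] v x y i xn below by (simp add: query_find_def)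
    next
      case f: False
      then have "?f = n" using nxn by simp
      then show ?thesis using v x y i xn below by (simp add: query_find_def)
    qed
  qed
qed

lemma wp_query:
  assumes tab: "tables s" and s: "arr s 1 0 0 = m" "var s 1 = n" "var s 13 = x" "var s 2 = y"
    and es: "is_path E x es y" "es \<noteq> []" and y: "y < n"
    and assoc: "\<And>a b c. a \<in> S \<Longrightarrow> b \<in> S \<Longrightarrow> c \<in> S \<Longrightarrow> mul (mul a b) c = mul a (mul b c)"
  shows "wp query_main (\<lambda>t. evar t 0 = semigroup_prod mul (map (\<lambda>e. lab (snd e)) es)) s"
proof -
  have L: "numbered s"
    using tab by (simp add: tables_def)
  interpret L: labeled_numbering n r pa E "arr s 4 0" "arr s 3 0" "arr s 6 0" by (rule L)
  let ?tg = "arr s 8"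
  have slots: "slot_step (earr s) ?tg v" if "v < n" "v \<noteq> r" for v
    using tab that by (simp add: tables_def)
  have mk: "marked s i = (\<lambda>z. ?tg i z \<noteq> i)" for i by (simp add: marked_def fun_eq_iff)
  let ?s = "setv 3 (m + 1) (setv 8 m (setv 0 m s))"
  \<comment> \<open>The last disjunct counts rounds: each round that moves lowers the slot, which
    starts at \<open>m\<close>. After \<open>m + 1\<close> rounds only the first alternative is
    left, and the slot keeps its number down to \<open>y\<close>.\<close>
  let ?J = "\<lambda>k t. \<exists>es1 es2. es = es1 @ es2 \<and> is_path E x es1 (var t 13) \<and> is_path E (var t 13) es2 y \<and>
    var t 8 = track ?tg m es1 \<and> var t 8 \<le> m \<and>
    (L.none_marked (marked s (var t 8)) (var t 13) y \<or> var t 8 + k \<le> m)"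
  have qb: "query_base ?s" using tab s by (simp add: query_base_def tables_def marked_def[abs_def])
  have no: "mods query_step \<inter> {0, 1, 3} = {}" "kinds query_step = {}" "\<not> estores query_step"
    "2 \<notin> mods query_step" "2 \<notin> mods query_find" "8 \<notin> mods query_find" "13 \<notin> mods query_find"
    "mods query_find \<inter> {0, 1, 3} = {}" "kinds query_find = {}" "\<not> estores query_find"
    by (simp_all add: query_defs)
  have loop: "wp (Loop 9 3 query_step) (\<lambda>t. ?J (m + 1) t \<and> frame (Loop 9 3 query_step) ?s t) ?s"
  proof (rule wp_frame, rule wp_Loop[where I = ?J])
    show "var ?s 3 = lim 3" by (simp add: lim_def)
    show "?J 0 (setv 9 0 ?s)" using es s by (intro exI[of _ "[]"] exI[of _ es]) simp
    show "?J (m + 1) t" if "?J (lim 3) t" for t using that by (simp add: lim_def)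
  next
    fix k t assume J: "?J k t" and v: "var t 9 = k" and f: "frame (Loop 9 3 query_step) ?s t"
    have ar: "arr t = arr s" using frame_arr[OF f] no by simp
    have qt: "query_base t" using query_base_frame[OF qb f] no by auto
    have yt: "var t 2 = y" using f no s by (simp add: frame_def)
    have mt: "marked t = marked s" by (simp add: marked_def[abs_def] ar)
    obtain es1 es2 where p: "es = es1 @ es2" "is_path E x es1 (var t 13)" "is_path E (var t 13) es2 y"
      "var t 8 = track ?tg m es1" "var t 8 \<le> m"
      and prog: "L.none_marked (marked s (var t 8)) (var t 13) y \<or> var t 8 + k \<le> m"
      using J by blast
    have xy: "anc (var t 13) y" using is_path_rtrancl[OF p(3)] by (simp add: anc_def)
    let ?i = "var t 8" and ?x = "var t 13"
    show "wp query_step (\<lambda>t'. ?J (Suc k) (setv 9 (Suc k) t')) t"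
      unfolding query_step_def
    proof (rule wp_seqI[OF wp_query_find[OF qt refl yt y refl p(5) xy]])
      fix u assume u: "var u 14 = n \<and> labeled_numbering.none_marked n E (marked t ?i) ?x y \<or>
         labeled_numbering.first_marked n E (marked t ?i) ?x y (var u 14)" and fu: "frame query_find t u"
      have qu: "query_base u" using query_base_frame[OF qt fu] no by auto
      have aru: "arr u = arr s" using frame_arr[OF fu] no ar by simp
      have vu: "var u 8 = ?i" "var u 13 = ?x" using fu no by (simp_all add: frame_def)
      have un: "var u 1 = n" using qu by (simp add: query_base_def)
      show "wp (Cond (Lt (Var 14) (Var 1)) (Asg 8 (Ld 8 (Var 8) (Var 14)) ;; Asg 13 (Var 14)) Nop)
         (\<lambda>t'. ?J (Suc k) (setv 9 (Suc k) t')) u"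
        using u[unfolded mt]
      proof
        assume none: "var u 14 = n \<and> L.none_marked (marked s ?i) ?x y"
        have "?J (Suc k) (setv 9 (Suc k) u)"
          using p none vu by (intro exI[of _ es1] exI[of _ es2]) simp
        then show ?thesis using none un by simp
      next
        assume first: "L.first_marked (marked s ?i) ?x y (var u 14)"
        let ?f = "var u 14"
        have fn: "?f < n" "?tg ?i ?f \<noteq> ?i" "anc ?x ?f" "?f \<noteq> ?x"
          using first by (auto simp: L.first_marked_def marked_def)
        have "?f \<noteq> r" using fn(3,4) anc_rec[OF root_less, of ?x] by auto
        then have "?tg ?i ?f \<le> ?i" using slots[OF fn(1)] p(5) by (cases "?i = m") (auto simp: slot_step_def)
        then have less: "?tg ?i ?f < ?i" using fn(2) by simp
        have "\<not> L.none_marked (marked s ?i) ?x y"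
          using first unfolding L.none_marked_def L.first_marked_def by blast
        then have prog': "?tg ?i ?f + Suc k \<le> m" using prog less by simp
        obtain es3 es4 where q: "es2 = es3 @ es4" "is_path E ?x es3 ?f" "is_path E ?f es4 y"
          "track ?tg ?i es3 = ?tg ?i ?f"
          using L.track_first[where tg = ?tg and i = ?i, OF p(3) y first[unfolded mk]] by blast
        have "?J (Suc k) (setv 9 (Suc k) (setv 13 ?f (setv 8 (?tg ?i ?f) u)))"
        proof (rule exI[of _ "es1 @ es3"], rule exI[of _ es4], intro conjI)
          show "is_path E x (es1 @ es3) (var (setv 9 (Suc k) (setv 13 ?f (setv 8 (?tg ?i ?f) u))) 13)"
            using p(2) q(2) by (auto simp: is_path_append)
        qed (use p q prog' in simp_all)
        then show ?thesis using fn(1) un vu p(5) by (simp add: aru)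
      qed
    qed
  qed
  then have "wp (Loop 9 3 query_step) (wp (ELd 0 (plus1 (Var 8)) (Var 2))
     (\<lambda>t. evar t 0 = semigroup_prod mul (map (\<lambda>e. lab (snd e)) es))) ?s"
  proof (rule wp_mono)
    fix t assume t: "?J (m + 1) t \<and> frame (Loop 9 3 query_step) ?s t"
    then have f: "frame (Loop 9 3 query_step) ?s t" by blast
    have et: "earr t = earr s" using f no by (simp add: frame_def)
    have qt: "query_base t" using query_base_frame[OF qb f] no by auto
    have yt: "var t 2 = y" using f no s by (simp add: frame_def)
    obtain es1 es2 where p: "es = es1 @ es2" "is_path E (var t 13) es2 y" "var t 8 = track ?tg m es1" "var t 8 \<le> m"
      and "L.none_marked (marked s (var t 8)) (var t 13) y"
      using t by auto
    then have "track ?tg (var t 8) es2 = var t 8" using L.track_none[where tg = ?tg and i = "var t 8", OF p(2) y] mk by simp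
    then have "track ?tg m es = var t 8" using p(1,3) by simp
    then have "earr s (var t 8 + 1) y = semigroup_prod mul (map (\<lambda>e. lab (snd e)) es)"
      using slot_value[OF assoc slots es] by simp
    then show "wp (ELd 0 (plus1 (Var 8)) (Var 2)) (\<lambda>t. evar t 0 = semigroup_prod mul (map (\<lambda>e. lab (snd e)) es)) t"
      using qt yt y p(4) slot_bounds[OF p(4)] by (simp add: query_base_def et)
  qed
  then show ?thesis using s n_pos slot_bounds[of m] unfolding query_main_def by (simp del: wp.simps(9))
qed

end

text \<open>Every instruction or test performs at most one semigroup operation in its unit of time,
  so the time bound serves for both.\<close>

lemma exec_ops_le_time: "exec w m k mul c s t p s' \<Longrightarrow> p \<le> t"
proof (induction rule: exec.induct)
  case (exec_IfTrue b s c t p s' c')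
  then show ?case by (cases b) auto
next
  case (exec_IfFalse b s c' t p s' c)
  then show ?case by (cases b) auto
next
  case (exec_WhileTrue b s c t p s' t' p' s'')
  then show ?case by (cases b) auto
next
  case (exec_WhileFalse b s c)
  then show ?case by (cases b) auto
qed auto

text \<open>A syntactic check that a query leaves both memories, and with them the data structure,
  intact.\<close>

fun stores :: "com \<Rightarrow> bool" where
  "stores (Store i j) = True"
| "stores (ElemStore i j) = True"
| "stores (Seq c d) = (stores c \<or> stores d)"
| "stores (If b c d) = (stores c \<or> stores d)"
| "stores (While b c) = stores c"
| "stores _ = False"

lemma exec_not_stores: "exec w m k mul c s t p s' \<Longrightarrow> \<not> stores c \<Longrightarrow> mem s' = mem s \<and> elem_mem s' = elem_mem s"
  by (induction rule: exec.induct) auto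

lemma compile_exp_not_stores: "\<not> stores (compile_exp e i)"
  by (induction e arbitrary: i) auto

lemma compile_not_stores: "kinds c = {} \<Longrightarrow> \<not> estores c \<Longrightarrow> \<not> stores (compile c)"
proof (induction c)
  case (Cond b c d)
  then show ?case by (cases b) (auto simp: compile_exp_not_stores)
qed (auto simp: compile_exp_not_stores)

section \<open>Resource bounds\<close>

text \<open>Compiled code expects \<open>n\<close> in register 1, where \<open>y\<close> is passed.
  So \<open>x\<close> and \<open>y\<close> move away and \<open>n\<close> is read from address 0
  before it starts.\<close>

definition query_program :: com where
  "query_program = Seq (Move 13 0) (Seq (Move 2 1) (Seq (Const 1 0) (Seq (Load 1 1) (compile query_main))))"

context machine
begin

lemma monomials: "n \<le> m * m * n" "m * n \<le> m * m * n" "m \<le> m * m * n" "1 \<le> m * m * n"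
  using n_pos m_pos by simp_all

text \<open>The quadratic term stems from \<open>ph_scan\<close>, run for each slot at each node.
  The coefficients add up to 1243.\<close>

lemma time_build: "time_com ph_build \<le> 2000 * (m * m * n)"
proof -
  have "time_com ph_build = 57 + 7 * m + 863 * n + 295 * (m * n) + 21 * (m * m * n)"
    by (simp add: ph_build_def ph_count_def ph_queue_def ph_peel_def ph_size_def ph_number_def ph_inlabel_def
       ph_slots_def ph_heads_def ph_head_def ph_defs lim_def lowbit_exp_def algebra_simps)
  then show ?thesis using monomials by linarith
qed

lemma time_query: "time_com query_main + 4 \<le> 2000 * (m * m)"
proof -
  have "time_com query_main + 4 = 208 + 176 * m"
    by (simp add: query_main_def query_defs lim_def algebra_simps)
  moreover have "m \<le> m * m" "1 \<le> m * m" using m_pos by simp_all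
  ultimately show ?thesis by linarith
qed

end

lemma wf_build: "wf_com ph_build"
  by (simp add: ph_build_def ph_count_def ph_queue_def ph_peel_def ph_size_def ph_number_def ph_inlabel_def
       ph_slots_def ph_heads_def ph_head_def ph_defs lowbit_exp_def)

lemma wf_query: "wf_com query_main"
  by (simp add: query_main_def query_defs)

lemma data_structure:
  fixes S :: "'a set" and mul and T :: "(nat, 'a) labeled_tree"
  assumes S: "finite_semigroup S mul" and T: "is_labeled_tree S T" and nodes: "nodes T = {..<card (nodes T)}"
    and w: "2000 * card S ^ 2 * card (nodes T) \<le> 2 ^ w" and s: "input_state w S T s"
  defines "q \<equiv> 2000 * card S ^ 2"
  defines "M \<equiv> q * card (nodes T)"
  shows "\<exists>t p D. exec w M M mul (compile ph_build) s t p D \<and> t \<le> M \<and>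
    (\<forall>x\<in>nodes T. \<forall>y\<in>nodes T. \<forall>s1. strict_ancestor T x y \<longrightarrow> query_state w S D x y s1 \<longrightarrow>
      (\<exists>t1 p1 s2. exec w M M mul query_program s1 t1 p1 s2 \<and> t1 \<le> q \<and> p1 \<le> q \<and>
         elem_reg s2 0 = path_product mul T x y \<and> mem s2 = mem D \<and> elem_mem s2 = elem_mem D))"
proof -
  define n where "n = card (nodes T)"
  define m where "m = card S"
  define E where "E = edges T"
  define r where "r = tree_root T"
  define lab where "lab v = elem_mem s (m + v)" for v
  have tree: "rooted_tree {..<n} E r"
    using T nodes unfolding is_labeled_tree_def n_def E_def r_def by simp
  have input: "valid_state w S s" "reg s 0 = m" "reg s 1 = n" "reg s 2 = r"
    "\<And>u v. (u, v) \<in> E \<Longrightarrow> mem s v = u \<and> lab v = label T (u, v)"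
    using s by (auto simp: input_state_def n_def m_def r_def E_def lab_def)
  have m_pos: "1 \<le> m" using S by (auto simp: finite_semigroup_def m_def Suc_le_eq card_gt_0_iff)
  have "r < n" using tree by (auto simp: rooted_tree_def)
  then have n_pos: "1 \<le> n" by simp
  have M: "M = 2000 * (m * m * n)" by (simp add: M_def q_def m_def n_def power2_eq_square)
  have monomials: "n \<le> m * m * n" "m * n \<le> m * m * n" "m \<le> m * m * n" using m_pos n_pos by simp_all
  have expand: "12 * (m + 1) * n = 12 * (m * n) + 12 * n" "m + (m + 2) * n = m + m * n + 2 * n"
    by (simp_all add: algebra_simps)
  have space: "12 * (m + 1) * n \<le> M" "m + (m + 2) * n \<le> M"
    unfolding M expand using monomials by linarith+
  have M_pos: "0 < M" using m_pos n_pos unfolding M by simp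
  \<comment> \<open>The initial memory itself serves as the parent map; its cell at the root is
    arbitrary, which \<open>parent_tree\<close> permits.\<close>
  interpret slot_builder w n m M mul r "mem s" E S lab
  proof
    show "M \<le> 2 ^ w" using w by (simp add: M_def q_def)
    show "mul a b \<in> S" if "a \<in> S" "b \<in> S" for a b using S that by (simp add: finite_semigroup_def)
    show "lab v \<in> S" for v using input(1) by (simp add: valid_state_def lab_def)
  qed (use S tree n_pos m_pos space input in \<open>auto simp: finite_semigroup_def m_def\<close>)
  have assoc: "mul (mul a b) c = mul a (mul b c)" if "a \<in> S" "b \<in> S" "c \<in> S" for a b c
    using S that by (simp add: finite_semigroup_def)
  define h where "h = \<lparr>var = reg s, arr = \<lambda>kd i v. mem s (addr kd i v), evar = elem_reg s,
    earr = \<lambda>i v. elem_mem s (eaddr i v)\<rparr>"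
  have rel: "rel s h" using input by (simp add: rel_def h_def)
  have "wp ph_build (\<lambda>t. tables t \<and> arr t 0 0 0 = n \<and> arr t 1 0 0 = m) h"
    by (rule wp_build)
      (use input in \<open>auto simp: h_def addr_def eaddr_def elems_ok_def valid_state_def lab_def add.commute\<close>)
  from runs_compile[OF this wf_build rel] obtain t p D h' where D:
    "exec w M M mul (compile ph_build) s t p D" "t \<le> time_com ph_build" "rel D h'" "tables h'"
    "arr h' 0 0 0 = n" "arr h' 1 0 0 = m"
    unfolding runs_def by blast
  have "t \<le> M" using D(2) time_build by (simp add: M)
  moreover have "\<exists>t1 p1 s2. exec w M M mul query_program s1 t1 p1 s2 \<and> t1 \<le> q \<and> p1 \<le> q \<and>
       elem_reg s2 0 = path_product mul T x y \<and> mem s2 = mem D \<and> elem_mem s2 = elem_mem D"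
    if "x \<in> nodes T" "y \<in> nodes T" and xy: "strict_ancestor T x y" and s1: "query_state w S D x y s1" for x y s1
  proof -
    obtain es where es: "es \<noteq> []" "is_path E x es y"
      using trancl_is_path xy unfolding strict_ancestor_def E_def by metis
    have "(THE es. is_path E x es y) = es" using es(2) path_unique by blast
    moreover have "map (label T) es = map (\<lambda>e. lab (snd e)) es"
      using input(5) is_path_edges[OF es(2)] by (intro map_cong) (auto, metis)
    ultimately have val: "path_product mul T x y = semigroup_prod mul (map (\<lambda>e. lab (snd e)) es)"
      unfolding path_product_def E_def[symmetric] by (simp only:)
    have "y \<in> {..<n}" using that(2) nodes unfolding n_def by (simp only:)
    then have yn: "y < n" by simp
    have q1: "reg s1 0 = x" "reg s1 1 = y" "mem s1 = mem D" "elem_mem s1 = elem_mem D"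
      using s1 by (simp_all add: query_state_def)
    \<comment> \<open>Row 0 of kind 0 starts at address 0, where the construction left
      \<open>n\<close>.\<close>
    have D0: "mem D 0 = n"
      using D(3,5) n_pos unfolding rel_def by (auto simp: addr_def dest!: spec[of _ 0])
    let ?s = "step (Load 1 1) (step (Const 1 0) (step (Move 2 1) (step (Move 13 0) s1)))"
    let ?h = "h'\<lparr>var := reg ?s, evar := elem_reg ?s\<rparr>"
    have regs: "reg ?s 13 = x" "reg ?s 2 = y" "reg ?s 1 = n" using q1 D0 by simp_all
    have rel': "rel ?s ?h" using D(3) q1 D0 by (simp add: rel_def)
    have tab: "tables ?h" using D(4) by (simp add: tables_def marked_def[abs_def])
    have "wp query_main (\<lambda>t. evar t 0 = semigroup_prod mul (map (\<lambda>e. lab (snd e)) es)) ?h"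
      by (rule wp_query[OF tab _ _ _ _ es(2,1) yn assoc]) (use D(6) regs in simp_all)
    from runs_compile[OF this wf_query rel']
    have run: "runs (compile query_main) ?s (time_com query_main) (\<lambda>s2. elem_reg s2 0 = path_product mul T x y)"
      by (rule runs_mono) (auto simp: rel_def val)
    have "runs query_program s1 (time_com query_main + 4) (\<lambda>s2. elem_reg s2 0 = path_product mul T x y)"
      unfolding query_program_def
      by ((rule runs_step_Seq, (simp add: M_pos; fail))+, rule runs_mono[OF run]) simp_all
    then obtain t1 p1 s2 where e: "exec w M M mul query_program s1 t1 p1 s2" "t1 \<le> time_com query_main + 4"
      "elem_reg s2 0 = path_product mul T x y" unfolding runs_def by blast
    have "t1 \<le> q" using e(2) time_query by (simp add: q_def m_def power2_eq_square)
    moreover have "p1 \<le> t1" using exec_ops_le_time[OF e(1)] .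
    moreover have "\<not> stores query_program"
      using compile_not_stores[of query_main] by (simp add: query_program_def query_main_def query_defs)
    then have "mem s2 = mem D \<and> elem_mem s2 = elem_mem D" using exec_not_stores[OF e(1)] q1 by simp
    ultimately show ?thesis using e by (meson le_trans)
  qed
  ultimately show ?thesis using D(1) by blast
qed

theorem theorem5p1:
  shows "\<exists>(build :: com) (query :: com) (C :: nat) (d :: nat).
    \<forall>(S :: 'a set) mul (T :: (nat, 'a) labeled_tree) w s.
      finite_semigroup S mul \<longrightarrow>
      is_labeled_tree S T \<longrightarrow>
      nodes T = {..<card (nodes T)} \<longrightarrow>
      C * card S ^ d * card (nodes T) \<le> 2 ^ w \<longrightarrow>
      input_state w S T s \<longrightarrow>
      (let q = C * card S ^ d; N = q * card (nodes T) in
        \<exists>t p D. exec w N N mul build s t p D \<and> t \<le> N \<and>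
          (\<forall>x\<in>nodes T. \<forall>y\<in>nodes T. \<forall>s1. strict_ancestor T x y \<longrightarrow> query_state w S D x y s1 \<longrightarrow>
            (\<exists>t1 p1 s2. exec w N N mul query s1 t1 p1 s2 \<and> t1 \<le> q \<and> p1 \<le> q \<and>
               elem_reg s2 0 = path_product mul T x y \<and>
               mem s2 = mem D \<and> elem_mem s2 = elem_mem D)))"
  unfolding Let_def
  by (rule exI[of _ "compile ph_build"], rule exI[of _ query_program], rule exI[of _ 2000], rule exI[of _ 2])
    (blast intro: data_structure)

end
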